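(* Let $v(0)\in\mathcal N^*$, $\lambda>0$, and let $v^\lambda(t)$ be the solution of the random alternating equations with constant rate function $\lambda(t)\equiv\lambda$ and initial condition $v(0)$, with random burning times $\beta_1<\beta_2<\dots$. Let $\epsilon_\lambda>0$ satisfy $\lambda^{1/2}\epsilon_\lambda\to\infty$ and $\epsilon_\lambda\to0$ as $\lambda\to\infty$. Define $$\Phi_\lambda(t,x):=\sum_{j=1}^{M(t)}\theta^\lambda(\beta_j)\,\mathbb I[\theta^\lambda(\beta_j)>x],\qquad \theta^\lambda(\beta_j):=m^\lambda_0(\beta_{j-1})-m^\lambda_0(\beta_j)\ (\beta_0=0),$$ the mass of frozen giants of mass larger than $x$ burnt before $t$. Then for every $t\ge1/m_1(0)$ and $x\ge0$, $$\lim_{\lambda\to\infty}\frac{\Phi_\lambda\big(t+\epsilon_\lambda,2\sqrt{\varphi_{crit}(t)/\lambda}\,x\big)-\Phi_\lambda\big(t,2\sqrt{\varphi_{crit}(t)/\lambda}\,x\big)}{\epsilon_\lambda\varphi_{crit}(t)}=\int_x^\infty\frac{4}{\sqrt\pi}y^2e^{-y^2}dy$$ in probability.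
   Context: $\mathcal N$: sequences $v=(v_k)_{k\ge1}$ of nonnegative reals with $\sum_kv_k<\infty$; $\mathcal N^*$: those with finitely many nonzero terms; $m_0=\sum_kv_k$, $m_1=\sum_kkv_k$. Alternating equations with burning times $0=\beta_0<\beta_1<\dots$ (no accumulation), $M(t)=\max\{i:\beta_i<t\}$: $v(t)\in\mathcal N$, $v_k$ continuous, $\dot v_k(t)=\tfrac k2\sum_{l=1}^{k-1}v_lv_{k-l}-kv_km_0(\beta_{M(t)})$; $\theta(t):=m_0(\beta_{M(t)})-m_0(t)$ (left-continuous; the mass of the giant component). Random alternating equations with rate $\lambda(\cdot)$: $v$ evolves deterministically by the alternating equations, and the burning times are random with $\lim_{dt\to0}\frac1{dt}P(t\le\beta_{M(t)+1}\le t+dt\mid\mathcal F_t)=\lambda(t)\theta(t)$, $\mathcal F_t$ the natural filtration (a giant is burnt at rate proportional to its mass). Critical equations: $v_k(t)=v_k(0)+\int_0^t\big(\tfrac k2\sum_{l=1}^{k-1}v_lv_{k-l}-kv_km_0(s)\big)ds$ with $m_0(0)-m_0(t)$ nondecreasing in $[0,m_0(0))$; for its solution with initial condition $v(0)$, $m_0(0)-m_0(t)=\int_{1/m_1(0)}^t\varphi_{crit}(s)ds$ for $t\ge1/m_1(0)$ with $\varphi_{crit}:[1/m_1(0),\infty)\to(0,\infty)$ continuous; $\varphi_{crit}$ denotes this function. *)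

theory Defs
  imports "HOL-Probability.Probability"
begin

text \<open>Sequences v = (v_k)_{k>=1} are represented as functions nat => real; the
  entry at index 0 is ignored throughout.\<close>

definition m0 :: "(nat \<Rightarrow> real) \<Rightarrow> real" where
  "m0 w = (\<Sum>k. w (Suc k))"

definition m1 :: "(nat \<Rightarrow> real) \<Rightarrow> real" where
  "m1 w = (\<Sum>k. real (Suc k) * w (Suc k))"

definition in_N :: "(nat \<Rightarrow> real) \<Rightarrow> bool" where
  "in_N w \<longleftrightarrow> (\<forall>k\<ge>1. 0 \<le> w k) \<and> summable (\<lambda>k. w (Suc k))"

definition in_Nstar :: "(nat \<Rightarrow> real) \<Rightarrow> bool" where
  "in_Nstar w \<longleftrightarrow> in_N w \<and> finite {k. 1 \<le> k \<and> w k \<noteq> 0}"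

definition coag :: "(nat \<Rightarrow> real) \<Rightarrow> nat \<Rightarrow> real" where
  "coag w k = real k / 2 * (\<Sum>l=1..k-1. w l * w (k - l))"

definition burning_times :: "(nat \<Rightarrow> real) \<Rightarrow> bool" where
  "burning_times bt \<longleftrightarrow> bt 0 = 0 \<and> strict_mono bt \<and> filterlim bt at_top sequentially"

text \<open>M(t) = max {i. beta_i < t}  (= number of i >= 1 with beta_i < t)\<close>
definition Mc :: "(nat \<Rightarrow> real) \<Rightarrow> real \<Rightarrow> nat" where
  "Mc bt t = card {i. 1 \<le> i \<and> bt i < t}"

text \<open>theta(t) = m0(beta_{M(t)}) - m0(t), the mass of the giant component\<close>
definition theta :: "(nat \<Rightarrow> real) \<Rightarrow> (real \<Rightarrow> nat \<Rightarrow> real) \<Rightarrow> real \<Rightarrow> real" where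
  "theta bt w t = m0 (w (bt (Mc bt t))) - m0 (w t)"

definition alt_sol :: "(nat \<Rightarrow> real) \<Rightarrow> (nat \<Rightarrow> real) \<Rightarrow> (real \<Rightarrow> nat \<Rightarrow> real) \<Rightarrow> bool" where
  "alt_sol v0 bt w \<longleftrightarrow> burning_times bt \<and> (\<forall>k\<ge>1. w 0 k = v0 k) \<and>
     (\<forall>t\<ge>0. in_N (w t)) \<and>
     (\<forall>k\<ge>1. continuous_on {0..} (\<lambda>t. w t k)) \<and>
     (\<forall>k\<ge>1. \<forall>t>0. t \<notin> range bt \<longrightarrow>
        ((\<lambda>s. w s k) has_real_derivative
           (coag (w t) k - real k * w t k * m0 (w (bt (Mc bt t))))) (at t))"

definition nat_filt :: "'a measure \<Rightarrow> (nat \<Rightarrow> 'a \<Rightarrow> real) \<Rightarrow> (real \<Rightarrow> 'a \<Rightarrow> nat \<Rightarrow> real)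
    \<Rightarrow> real \<Rightarrow> 'a measure" where
  "nat_filt \<Omega> bt w t = sigma (space \<Omega>)
     ((\<Union>i. {(\<lambda>\<omega>. min (bt i \<omega>) t) -` B \<inter> space \<Omega> | B. B \<in> sets borel}) \<union>
      (\<Union>s\<in>{0..t}. \<Union>k. {(\<lambda>\<omega>. w s \<omega> k) -` B \<inter> space \<Omega> | B. B \<in> sets borel}))"

text \<open>Random alternating equations with constant rate lam: each realisation solves the
  alternating equations, and the counting process M(t) of burning times has F_t-intensity
  lam * theta(t), i.e. M(t) - int_0^t lam theta(s) ds is an F_t-martingale (stated via
  E[(M(t)-M(s)) 1_A] = E[(int_s^t lam theta) 1_A] for A in F_s).\<close>
definition random_alt_sol :: "'a measure \<Rightarrow> real \<Rightarrow> (nat \<Rightarrow> real) \<Rightarrow> (nat \<Rightarrow> 'a \<Rightarrow> real)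
    \<Rightarrow> (real \<Rightarrow> 'a \<Rightarrow> nat \<Rightarrow> real) \<Rightarrow> bool" where
  "random_alt_sol \<Omega> lam v0 bt w \<longleftrightarrow> prob_space \<Omega> \<and>
     (\<forall>i. bt i \<in> borel_measurable \<Omega>) \<and>
     (\<forall>t k. (\<lambda>\<omega>. w t \<omega> k) \<in> borel_measurable \<Omega>) \<and>
     (\<forall>\<omega>\<in>space \<Omega>. alt_sol v0 (\<lambda>i. bt i \<omega>) (\<lambda>t. w t \<omega>)) \<and>
     (\<forall>s t A. 0 \<le> s \<longrightarrow> s \<le> t \<longrightarrow> A \<in> sets (nat_filt \<Omega> bt w s) \<longrightarrow>
        (\<integral>\<^sup>+\<omega>. indicator A \<omega> *
            ennreal (real (Mc (\<lambda>i. bt i \<omega>) t) - real (Mc (\<lambda>i. bt i \<omega>) s)) \<partial>\<Omega>) =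
        (\<integral>\<^sup>+\<omega>. indicator A \<omega> *
            ennreal (integral {s..t} (\<lambda>r. lam * theta (\<lambda>i. bt i \<omega>) (\<lambda>t. w t \<omega>) r)) \<partial>\<Omega>))"

definition Phi :: "(nat \<Rightarrow> real) \<Rightarrow> (real \<Rightarrow> nat \<Rightarrow> real) \<Rightarrow> real \<Rightarrow> real \<Rightarrow> real" where
  "Phi bt w t x = (\<Sum>j=1..Mc bt t.
      let th = m0 (w (bt (j - 1))) - m0 (w (bt j)) in (if th > x then th else 0))"

definition crit_sol :: "(nat \<Rightarrow> real) \<Rightarrow> (real \<Rightarrow> nat \<Rightarrow> real) \<Rightarrow> bool" where
  "crit_sol v0 u \<longleftrightarrow> (\<forall>k\<ge>1. u 0 k = v0 k) \<and> (\<forall>t\<ge>0. in_N (u t)) \<and>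
     (\<forall>k\<ge>1. \<forall>t\<ge>0. ((\<lambda>s. coag (u s) k - real k * u s k * m0 (u s)) has_integral
         (u t k - v0 k)) {0..t}) \<and>
     mono_on {0..} (\<lambda>t. m0 (u 0) - m0 (u t))"

end

(*
Let G x = sum_k v_k(0) exp(-k x). If mu is the loss rate (the total mass just after the last burning,
resp. the current total mass in the critical equations) and A its integral, then v_k exp(k A) does
not depend on mu; comparing with Flory's equation, which conserves mass up to its gelation time,
gives sum_k v_k(t) exp(k (A(t) - x - t G x)) = G x whenever t <= -1 / G' x. Hence after every burning
the state is a single number x, the mass being G x, and a burning at time t moves x to the other
point x' where the line of slope -1/t through (x, G x) meets the graph of G. In the critical
equations the mass is G x at the time -1 / G' x, and phi_crit is read off from this.

The integrals E_j of lam * theta over the successive intervals between burnings are independent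
Exp(1) variables. If phi_crit is close to phi along a cycle, then the burnt mass is close to
2 sqrt(phi E_j / lam). In a window the burnt masses add up, except for the two cycles that straddle
its ends, to the decrease phi * epsilon of the critical mass, and a second moment estimate compares
the sum of sqrt(E_j) 1[sqrt(E_j) > x] with the sum of sqrt(E_j). The straddling cycles are short
because the expected number of visits of the mass to a block of width 1 / sqrt(lam) is bounded.
*)
theory Submission
  imports Defs
begin

section \<open>Truncated moments of the coagulation equations\<close>

text \<open>A cycle in state x starts growing its giant at the gelation time s0 of x. At time s the
  giant has mass about 2 phi (s - s0), so the hazard E gathered so far is lam phi (s - s0)^2, and
  eliminating s gives the size 2 sqrt(phi E / lam). The limit density is the size-biased law of sqrt
  E for an exponential E.

  The obstacle is that a time window selects cycles by the time of their burning, which depends on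
  the hazard of that very cycle, so the selected terms are not orthogonal. Cycles are therefore
  selected by the mass with which they begin. This is known before the cycle runs, and the two
  selections differ only in cycles that straddle an end.

  The number of cycles is only bounded from above. Each truncated sqrt E is centred by a multiple of
  the full sqrt E, and the burnt masses telescope, so the number of cycles enters through a variance
  alone. As sizes are known up to a factor r, the cut-off is moved to x / r and to x r, with r
  chosen close to 1 according to the tolerated error.\<close>

definition psum :: "(nat \<Rightarrow> real) \<Rightarrow> nat \<Rightarrow> real" where
  "psum q n = (\<Sum>k=1..n. q k)"

definition pmom :: "(nat \<Rightarrow> real) \<Rightarrow> nat \<Rightarrow> real" where
  "pmom q n = (\<Sum>k=1..n. real k * q k)"

text \<open>Both sides run over the pairs of positive indices l, j with l + j at most n.\<close>

lemma sum_triangle_convolution: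
  fixes f :: "nat \<Rightarrow> nat \<Rightarrow> 'a::comm_monoid_add"
  shows "(\<Sum>k=1..n. \<Sum>l=1..k-1. f l (k - l)) = (\<Sum>l=1..n. \<Sum>j=1..n-l. f l j)"
proof -
  have "(\<Sum>k=1..n. \<Sum>l=1..k-1. f l (k - l)) = (\<Sum>(k,l)\<in>Sigma {1..n} (\<lambda>k. {1..k-1}). f l (k - l))"
    by (subst sum.Sigma) auto
  also have "\<dots> = (\<Sum>(l,j)\<in>Sigma {1..n} (\<lambda>l. {1..n-l}). f l j)"
    by (rule sum.reindex_bij_witness[of _ "\<lambda>(l,j). (l + j, l)" "\<lambda>(k,l). (l, k - l)"]) auto
  also have "\<dots> = (\<Sum>l=1..n. \<Sum>j=1..n-l. f l j)"
    by (subst sum.Sigma) auto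
  finally show ?thesis .
qed

lemma sum_convolution_flip:
  fixes f :: "nat \<Rightarrow> nat \<Rightarrow> 'a::comm_monoid_add"
  shows "(\<Sum>l=1..k-1. f l (k - l)) = (\<Sum>l=1..k-1. f (k - l) l)"
  by (rule sum.reindex_bij_witness[of _ "\<lambda>l. k - l" "\<lambda>l. k - l"]) auto

text \<open>Writing k = l + (k - l) and flipping the second half of the convolution removes the
  factor 1/2. In this asymmetric form the truncated sums below factor.\<close>

lemma coag_alt: "coag q k = (\<Sum>l=1..k-1. real l * q l * q (k - l))"
proof -
  have "2 * coag q k = (\<Sum>l=1..k-1. (real l + real (k - l)) * q l * q (k - l))"
    unfolding coag_def sum_distrib_left by (simp add: sum_distrib_left) (rule sum.cong, auto simp: of_nat_diff)
  also have "\<dots> = (\<Sum>l=1..k-1. real l * q l * q (k - l)) + (\<Sum>l=1..k-1. real (k - l) * q (k - l) * q l)"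
    by (simp add: sum.distrib[symmetric] algebra_simps)
  also have "(\<Sum>l=1..k-1. real (k - l) * q (k - l) * q l) = (\<Sum>l=1..k-1. real l * q l * q (k - l))"
    using sum_convolution_flip[of "\<lambda>a b. real a * q a * q b" k] by simp
  finally show ?thesis by simp
qed

text \<open>Splitting k l into l^2 and l (k - l) separates the part that the loss term compensates
  from the product that yields the square of \<open>pmom\<close>.\<close>

lemma coag_moment:
  "real k * coag q k = (\<Sum>l=1..k-1. (real l)\<^sup>2 * q l * q (k - l)) + (\<Sum>l=1..k-1. real l * q l * (real (k - l) * q (k - l)))"
proof -
  have "real k * coag q k = (\<Sum>l=1..k-1. real k * (real l * q l * q (k - l)))"
    by (simp add: coag_alt sum_distrib_left)
  also have "\<dots> = (\<Sum>l=1..k-1. (real l)\<^sup>2 * q l * q (k - l) + real l * q l * (real (k - l) * q (k - l)))"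
  proof (rule sum.cong)
    fix l assume "l \<in> {1..k-1}"
    then have k: "real k = real l + real (k - l)" by auto
    show "real k * (real l * q l * q (k - l)) = (real l)\<^sup>2 * q l * q (k - l) + real l * q l * (real (k - l) * q (k - l))"
      unfolding k by (simp add: algebra_simps power2_eq_square)
  qed simp
  finally show ?thesis by (simp add: sum.distrib)
qed

text \<open>A cluster of size l stays within {1..n} only by merging with a partner of size at most n
  - l, so it is lost against the part of \<mu> that \<open>psum q (n - l)\<close> misses.\<close>

lemma psum_rate:
  "(\<Sum>k=1..n. coag q k - real k * q k * \<mu>) = - (\<Sum>l=1..n. real l * q l * (\<mu> - psum q (n - l)))"
proof -
  have "(\<Sum>k=1..n. coag q k) = (\<Sum>l=1..n. real l * q l * psum q (n - l))"
    unfolding coag_alt sum_triangle_convolution[of "\<lambda>a b. real a * q a * q b"] psum_def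
    by (simp add: sum_distrib_left)
  then show ?thesis
    by (simp add: sum_subtractf algebra_simps)
qed

lemma psum_mono: "(\<And>k. 1 \<le> k \<Longrightarrow> 0 \<le> q k) \<Longrightarrow> m \<le> n \<Longrightarrow> psum q m \<le> psum q n"
  unfolding psum_def by (rule sum_mono2) auto

lemma pmom_mono: "(\<And>k. 1 \<le> k \<Longrightarrow> 0 \<le> q k) \<Longrightarrow> m \<le> n \<Longrightarrow> pmom q m \<le> pmom q n"
  unfolding pmom_def by (rule sum_mono2) auto

lemma pmom_nonneg: "(\<And>k. 1 \<le> k \<Longrightarrow> 0 \<le> q k) \<Longrightarrow> 0 \<le> pmom q n"
  unfolding pmom_def by (rule sum_nonneg) auto

text \<open>The terms weighted by l^2 are absorbed by the loss because \<open>psum q n\<close> is at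
  most \<mu>. What remains is at most \<open>pmom q n\<close> times itself: a Riccati inequality
  whose form is the same for every n.\<close>

lemma pmom_rate_le:
  assumes q: "\<And>k. 1 \<le> k \<Longrightarrow> 0 \<le> q k" and \<mu>: "psum q n \<le> \<mu>"
  shows "(\<Sum>k=1..n. real k * (coag q k - real k * q k * \<mu>)) \<le> (pmom q n)\<^sup>2"
proof -
  have "(\<Sum>k=1..n. real k * (coag q k - real k * q k * \<mu>))
      = (\<Sum>k=1..n. \<Sum>l=1..k-1. (real l)\<^sup>2 * q l * q (k - l))
      + (\<Sum>k=1..n. \<Sum>l=1..k-1. real l * q l * (real (k - l) * q (k - l))) - (\<Sum>k=1..n. (real k)\<^sup>2 * q k * \<mu>)"
    by (simp add: right_diff_distrib sum_subtractf coag_moment sum.distrib power2_eq_square mult_ac)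
  also have "(\<Sum>k=1..n. \<Sum>l=1..k-1. (real l)\<^sup>2 * q l * q (k - l)) = (\<Sum>l=1..n. (real l)\<^sup>2 * q l * psum q (n - l))"
    unfolding sum_triangle_convolution[of "\<lambda>a b. (real a)\<^sup>2 * q a * q b"] psum_def by (simp add: sum_distrib_left)
  also have "(\<Sum>k=1..n. \<Sum>l=1..k-1. real l * q l * (real (k - l) * q (k - l))) = (\<Sum>l=1..n. real l * q l * pmom q (n - l))"
    unfolding sum_triangle_convolution[of "\<lambda>a b. real a * q a * (real b * q b)"] pmom_def by (simp add: sum_distrib_left)
  also have "(\<Sum>l=1..n. (real l)\<^sup>2 * q l * psum q (n - l)) + (\<Sum>l=1..n. real l * q l * pmom q (n - l)) - (\<Sum>k=1..n. (real k)\<^sup>2 * q k * \<mu>)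
     \<le> (\<Sum>l=1..n. (real l)\<^sup>2 * q l * \<mu>) + (\<Sum>l=1..n. real l * q l * pmom q n) - (\<Sum>k=1..n. (real k)\<^sup>2 * q k * \<mu>)"
    by (intro diff_mono add_mono sum_mono mult_left_mono order_refl pmom_mono q order_trans[OF psum_mono \<mu>])
       (auto intro!: mult_nonneg_nonneg q)
  also have "\<dots> = (pmom q n)\<^sup>2"
    by (simp add: pmom_def power2_eq_square sum_distrib_right)
  finally show ?thesis .
qed

text \<open>Applied with f the mass deficit of the truncations. After summation over n the loss rate
  is a convolution, bounded by the first moment times the summed deficits, and this closes a
  Gronwall inequality.\<close>

lemma sum_tail_rate_le:
  assumes q: "\<And>k. 1 \<le> k \<Longrightarrow> 0 \<le> q k" and f: "\<And>n. 0 \<le> f n"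
  shows "(\<Sum>n\<le>N. \<Sum>l=1..n. real l * q l * f (n - l)) \<le> pmom q N * (\<Sum>n\<le>N. f n)"
proof -
  have "(\<Sum>n\<le>N. \<Sum>l=1..n. real l * q l * f (n - l)) = (\<Sum>(n,l)\<in>Sigma {..N} (\<lambda>n. {1..n}). real l * q l * f (n - l))"
    by (subst sum.Sigma) auto
  also have "\<dots> = (\<Sum>(l,j)\<in>Sigma {1..N} (\<lambda>l. {..N-l}). real l * q l * f j)"
    by (rule sum.reindex_bij_witness[of _ "\<lambda>(l,j). (l + j, l)" "\<lambda>(k,l). (l, k - l)"]) auto
  also have "\<dots> = (\<Sum>l=1..N. \<Sum>j\<le>N-l. real l * q l * f j)"
    by (subst sum.Sigma) auto
  also have "\<dots> \<le> (\<Sum>l=1..N. \<Sum>j\<le>N. real l * q l * f j)"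
    by (intro sum_mono sum_mono2) (auto intro!: mult_nonneg_nonneg q f)
  also have "\<dots> = pmom q N * (\<Sum>n\<le>N. f n)"
    by (simp add: pmom_def sum_product)
  finally show ?thesis .
qed

section \<open>Integral inequalities and conservation of mass before gelation\<close>

lemma integral_gronwall:
  fixes y :: "real \<Rightarrow> real"
  assumes cont: "continuous_on {0..T} y" and C: "0 \<le> C" and T: "0 \<le> T"
    and le: "\<And>t. t \<in> {0..T} \<Longrightarrow> y t \<le> a + integral {0..t} (\<lambda>s. C * y s)"
  shows "y T \<le> a * exp (C * T)"
proof -
  define z where "z t = a + integral {0..t} (\<lambda>s. C * y s)" for t
  have c': "continuous_on {0..T} (\<lambda>s. C * y s)" by (intro continuous_intros cont)
  have zc: "continuous_on {0..T} z"
    unfolding z_def by (intro continuous_intros indefinite_integral_continuous_1 integrable_continuous_real c')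
  have dz: "(z has_real_derivative C * y t) (at t)" if "0 < t" "t < T" for t
  proof -
    have "((\<lambda>x. integral {0..x} (\<lambda>s. C * y s)) has_real_derivative C * y t) (at t within {0..T})"
      using that by (intro integral_has_real_derivative c') auto
    then have "((\<lambda>x. integral {0..x} (\<lambda>s. C * y s)) has_real_derivative C * y t) (at t)"
      using that at_within_Icc_at[of 0 t T] by (simp del: integral_mult_right)
    from DERIV_add[OF DERIV_const[of a] this] show ?thesis unfolding z_def by (simp del: integral_mult_right)
  qed
  have "z T * exp (- C * T) \<le> z 0 * exp (- C * 0)"
  proof (rule DERIV_nonpos_imp_decreasing_open[OF T])
    fix t assume t: "0 < t" "t < T"
    have "((\<lambda>t. z t * exp (- C * t)) has_real_derivative (C * y t - C * z t) * exp (- C * t)) (at t)"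
      by (auto intro!: derivative_eq_intros dz t simp: algebra_simps)
    moreover have "C * y t \<le> C * z t"
      using le[of t] t C by (intro mult_left_mono) (auto simp: z_def)
    ultimately show "\<exists>d. ((\<lambda>t. z t * exp (- C * t)) has_real_derivative d) (at t) \<and> d \<le> 0"
      by (intro exI conjI) (auto intro!: mult_nonpos_nonneg)
  qed (intro continuous_intros zc)
  then have "z T * exp (- C * T) \<le> a" by (simp add: z_def)
  then have "z T \<le> a * exp (C * T)"
    by (simp add: exp_minus field_simps)
  moreover have "y T \<le> z T" using le[of T] T by (simp add: z_def)
  ultimately show ?thesis by simp
qed

text \<open>With z the right-hand side, -1 / z - t does not increase. The bound is the solution of
  z' = z^2 started at a; it explodes at 1 / a, which for the first moment is the gelation
  time.\<close>

lemma integral_riccati: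
  fixes y :: "real \<Rightarrow> real"
  assumes cont: "continuous_on {0..T} y" and a: "0 < a" and T: "0 \<le> T" and Ta: "T * a < 1"
    and nonneg: "\<And>t. t \<in> {0..T} \<Longrightarrow> 0 \<le> y t"
    and le: "\<And>t. t \<in> {0..T} \<Longrightarrow> y t \<le> a + integral {0..t} (\<lambda>s. (y s)\<^sup>2)"
  shows "y T \<le> a / (1 - T * a)"
proof -
  define z where "z t = a + integral {0..t} (\<lambda>s. (y s)\<^sup>2)" for t
  have c': "continuous_on {0..T} (\<lambda>s. (y s)\<^sup>2)" by (intro continuous_intros cont)
  have zc: "continuous_on {0..T} z"
    unfolding z_def by (intro continuous_intros indefinite_integral_continuous_1 integrable_continuous_real c')
  have zpos: "0 < z t" if "t \<in> {0..T}" for t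
  proof -
    have "0 \<le> integral {0..t} (\<lambda>s. (y s)\<^sup>2)" 
      using that by (intro integral_nonneg integrable_continuous_real continuous_on_subset[OF c']) auto
    then show ?thesis using a by (simp add: z_def)
  qed
  have dz: "(z has_real_derivative (y t)\<^sup>2) (at t)" if "0 < t" "t < T" for t
  proof -
    have "((\<lambda>x. integral {0..x} (\<lambda>s. (y s)\<^sup>2)) has_real_derivative (y t)\<^sup>2) (at t within {0..T})"
      using that by (intro integral_has_real_derivative c') auto
    then have "((\<lambda>x. integral {0..x} (\<lambda>s. (y s)\<^sup>2)) has_real_derivative (y t)\<^sup>2) (at t)"
      using that at_within_Icc_at[of 0 t T] by simp
    then show ?thesis unfolding z_def by (auto intro!: derivative_eq_intros)
  qed
  have zne: "z t \<noteq> 0" if "t \<in> {0..T}" for t using zpos[OF that] by simp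
  have "- (1 / z T) - T \<le> - (1 / z 0) - 0"
  proof (rule DERIV_nonpos_imp_decreasing_open[OF T, where f="\<lambda>t. - (1 / z t) - t"])
    fix t assume t: "0 < t" "t < T"
    have z0: "0 < z t" using zpos t by simp
    have "((\<lambda>t. - (1 / z t) - t) has_real_derivative ((y t)\<^sup>2 / (z t)\<^sup>2 - 1)) (at t)"
      using z0 by (auto intro!: derivative_eq_intros dz t simp: power2_eq_square)
    moreover have "(y t)\<^sup>2 \<le> (z t)\<^sup>2"
      using le[of t] nonneg[of t] t by (intro power_mono) (auto simp: z_def)
    ultimately show "\<exists>d. ((\<lambda>t. - (1 / z t) - t) has_real_derivative d) (at t) \<and> d \<le> 0"
      using z0 by (intro exI conjI) (auto simp: divide_simps)
  qed (intro continuous_intros zc, auto dest: zne)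
  then have "1 / a - T \<le> 1 / z T" by (simp add: z_def)
  moreover have zT: "0 < z T" using zpos T by simp
  ultimately have "(1 - T * a) * z T \<le> a"
    using a by (simp add: field_simps)
  then have "z T \<le> a / (1 - T * a)" using Ta by (simp add: field_simps)
  moreover have "y T \<le> z T" using le[of T] T by (simp add: z_def)
  ultimately show ?thesis by simp
qed

text \<open>Before time 1 / a the first moment is bounded uniformly in the truncation. The summed
  deficits \<open>F N\<close> then satisfy a Gronwall inequality with a constant independent of N,
  and they start below m g because the initial data vanish beyond m. Deficits decrease in the index,
  so the one at N is O(1 / N) and no mass escapes. A time-dependent \<mu> covers both Flory's and
  the critical equation.\<close>

lemma mass_conserved:
  fixes q :: "real \<Rightarrow> nat \<Rightarrow> real"
  assumes T: "0 \<le> T"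
    and int: "\<And>k t. 1 \<le> k \<Longrightarrow> t \<in> {0..T} \<Longrightarrow>
        ((\<lambda>s. coag (q s) k - real k * q s k * \<mu> s) has_integral (q t k - q 0 k)) {0..t}"
    and nonneg: "\<And>k t. 1 \<le> k \<Longrightarrow> t \<in> {0..T} \<Longrightarrow> 0 \<le> q t k"
    and psum_le: "\<And>n t. t \<in> {0..T} \<Longrightarrow> psum (q t) n \<le> \<mu> t"
    and \<mu>_le: "\<And>t. t \<in> {0..T} \<Longrightarrow> \<mu> t \<le> g"
    and supp: "\<And>k. m < k \<Longrightarrow> q 0 k = 0" and g: "psum (q 0) m = g"
    and a: "pmom (q 0) m \<le> a" "0 < a" "T * a < 1"
  shows "(\<lambda>k. q T (Suc k)) sums g"
proof -
  have qc: "continuous_on {0..T} (\<lambda>t. q t k)" if "1 \<le> k" for k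
  proof -
    have "continuous_on {0..T} (\<lambda>t. q 0 k + integral {0..t} (\<lambda>s. coag (q s) k - real k * q s k * \<mu> s))"
      using int[OF that, of T] T by (intro continuous_intros indefinite_integral_continuous_1) (auto simp: integrable_on_def)
    moreover have "q 0 k + integral {0..t} (\<lambda>s. coag (q s) k - real k * q s k * \<mu> s) = q t k" if "t \<in> {0..T}" for t
      using integral_unique[OF int[OF \<open>1 \<le> k\<close> that]] by simp
    ultimately show ?thesis using continuous_on_cong[OF refl, of "{0..T}"] by (metis (no_types, lifting))
  qed
  have psc: "continuous_on {0..T} (\<lambda>t. psum (q t) n)" for n
    unfolding psum_def by (intro continuous_intros qc) auto
  have pmc: "continuous_on {0..T} (\<lambda>t. pmom (q t) n)" for n
    unfolding pmom_def by (intro continuous_intros qc) auto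
  have supp_psum: "psum (q 0) n = g" if "m \<le> n" for n
    unfolding psum_def g[symmetric] using supp that by (intro sum.mono_neutral_right) auto
  have supp_pmom: "pmom (q 0) n \<le> pmom (q 0) m" for n
  proof -
    have "pmom (q 0) (max m n) = pmom (q 0) m"
      unfolding pmom_def using supp by (intro sum.mono_neutral_right) auto
    then show ?thesis using pmom_mono[of "q 0" n "max m n"] nonneg[of _ 0] T by auto
  qed
  \<comment> \<open>The Riccati bound at the final time, which is its largest value on the
    interval.\<close>
  define C where "C = a / (1 - T * a)"
  have pm: "pmom (q t) n \<le> C" if t: "t \<in> {0..T}" for n t
  proof -
    have ta: "t * a \<le> T * a" using t a by (intro mult_right_mono) auto
    have "pmom (q t) n \<le> a / (1 - t * a)"
    proof (rule integral_riccati)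
      show "continuous_on {0..t} (\<lambda>t. pmom (q t) n)" using t by (intro continuous_on_subset[OF pmc]) auto
      show "t * a < 1" using ta a(3) by linarith
      show "0 \<le> pmom (q s) n" if "s \<in> {0..t}" for s
        using that t by (intro pmom_nonneg nonneg) auto
      fix s assume "s \<in> {0..t}"
      then have s: "s \<in> {0..T}" using t by auto
      have "((\<lambda>r. \<Sum>k=1..n. real k * (coag (q r) k - real k * q r k * \<mu> r)) has_integral 
          (\<Sum>k=1..n. real k * (q s k - q 0 k))) {0..s}"
        using s by (intro has_integral_sum has_integral_mult_right int) auto
      moreover have "((\<lambda>r. (pmom (q r) n)\<^sup>2) has_integral integral {0..s} (\<lambda>r. (pmom (q r) n)\<^sup>2)) {0..s}"
        using s by (intro integrable_integral integrable_continuous_real continuous_intros continuous_on_subset[OF pmc]) auto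
      ultimately have "(\<Sum>k=1..n. real k * (q s k - q 0 k)) \<le> integral {0..s} (\<lambda>r. (pmom (q r) n)\<^sup>2)"
      proof (rule has_integral_le)
        fix r assume "r \<in> {0..s}"
        then have "r \<in> {0..T}" using s by auto
        then show "(\<Sum>k=1..n. real k * (coag (q r) k - real k * q r k * \<mu> r)) \<le> (pmom (q r) n)\<^sup>2"
          by (intro pmom_rate_le nonneg psum_le)
      qed
      moreover have "(\<Sum>k=1..n. real k * (q s k - q 0 k)) = pmom (q s) n - pmom (q 0) n"
        by (simp add: pmom_def right_diff_distrib sum_subtractf)
      ultimately show "pmom (q s) n \<le> a + integral {0..s} (\<lambda>r. (pmom (q r) n)\<^sup>2)"
        using supp_pmom[of n] a(1) by linarith
    qed (use t a in auto)
    also have "\<dots> \<le> C"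
    proof -
      have "1 - T * a \<le> 1 - t * a" "0 < 1 - T * a" using ta a(3) by linarith+
      then show ?thesis unfolding C_def by (intro divide_left_mono mult_pos_pos) (use ta a in linarith)+
    qed
    finally show ?thesis .
  qed
  have C0: "0 \<le> C" using a by (auto simp: C_def)
  define F where "F N t = (\<Sum>n\<le>N. g - psum (q t) n)" for N t
  have f_nonneg: "0 \<le> g - psum (q t) n" if "t \<in> {0..T}" for t n
    using psum_le[OF that, of n] \<mu>_le[OF that] by simp
  have FT: "F N T \<le> F N 0 * exp (C * T)" for N
  proof (rule integral_gronwall[OF _ C0 T])
    show Fc: "continuous_on {0..T} (F N)"
      unfolding F_def by (intro continuous_intros psc)
    fix t assume t: "t \<in> {0..T}"
    have "((\<lambda>r. \<Sum>n\<le>N. \<Sum>k=1..n. coag (q r) k - real k * q r k * \<mu> r) has_integral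
       (\<Sum>n\<le>N. \<Sum>k=1..n. q t k - q 0 k)) {0..t}"
      using t by (intro has_integral_sum int) auto
    then have "((\<lambda>r. - (\<Sum>n\<le>N. \<Sum>k=1..n. coag (q r) k - real k * q r k * \<mu> r)) has_integral
       - (\<Sum>n\<le>N. \<Sum>k=1..n. q t k - q 0 k)) {0..t}"
      by (rule has_integral_neg)
    moreover have "((\<lambda>r. C * F N r) has_integral integral {0..t} (\<lambda>r. C * F N r)) {0..t}"
      using t by (intro integrable_integral integrable_continuous_real continuous_intros continuous_on_subset[OF Fc]) auto
    ultimately have "- (\<Sum>n\<le>N. \<Sum>k=1..n. q t k - q 0 k) \<le> integral {0..t} (\<lambda>r. C * F N r)"
    proof (rule has_integral_le)
      fix r assume "r \<in> {0..t}"
      then have r: "r \<in> {0..T}" using t by auto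
      have "- (\<Sum>n\<le>N. \<Sum>k=1..n. coag (q r) k - real k * q r k * \<mu> r)
         = (\<Sum>n\<le>N. \<Sum>l=1..n. real l * q r l * (\<mu> r - psum (q r) (n - l)))"
        unfolding psum_rate by (simp add: sum_negf)
      also have "\<dots> \<le> (\<Sum>n\<le>N. \<Sum>l=1..n. real l * q r l * (g - psum (q r) (n - l)))"
        by (intro sum_mono mult_left_mono) (use \<mu>_le[OF r] nonneg r in auto)
      also have "\<dots> \<le> pmom (q r) N * (\<Sum>n\<le>N. g - psum (q r) n)"
        by (rule sum_tail_rate_le) (use nonneg f_nonneg r in auto)
      also have "\<dots> \<le> C * F N r"
        unfolding F_def using pm[OF r] f_nonneg[OF r] by (intro mult_right_mono sum_nonneg) auto
      finally show "- (\<Sum>n\<le>N. \<Sum>k=1..n. coag (q r) k - real k * q r k * \<mu> r) \<le> C * F N r" .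
    qed
    moreover have "- (\<Sum>n\<le>N. \<Sum>k=1..n. q t k - q 0 k) = F N t - F N 0"
      by (simp add: F_def psum_def sum_subtractf)
    ultimately show "F N t \<le> F N 0 + integral {0..t} (\<lambda>r. C * F N r)" by simp
  qed
  have g0: "0 \<le> g" using f_nonneg[of 0 0] T by (simp add: psum_def)
  have F0: "F N 0 \<le> real m * g" for N
  proof -
    have "F N 0 \<le> (\<Sum>n\<le>N. if n < m then g else 0)"
      unfolding F_def 
      by (intro sum_mono) (use supp_psum in \<open>auto simp: psum_def intro!: sum_nonneg nonneg T\<close>)
    also have "\<dots> = (\<Sum>n\<in>{..N} \<inter> {..<m}. g)"
      by (simp add: sum.If_cases lessThan_def)
    also have "\<dots> \<le> (\<Sum>n\<in>{..<m}. g)" by (intro sum_mono2) (use g0 in auto)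
    finally show ?thesis by simp
  qed
  have bnd: "g - psum (q T) N \<le> real m * g * exp (C * T) / real (Suc N)" for N
  proof -
    have "real (Suc N) * (g - psum (q T) N) = (\<Sum>n\<le>N. g - psum (q T) N)" by simp
    also have "\<dots> \<le> F N T" unfolding F_def
      by (intro sum_mono diff_left_mono psum_mono nonneg) (use T in auto)
    also have "\<dots> \<le> real m * g * exp (C * T)"
      by (rule order_trans[OF FT mult_right_mono[OF F0]]) simp
    finally show ?thesis by (simp add: field_simps)
  qed
  have "(\<lambda>N. g - psum (q T) N) \<longlonglongrightarrow> 0"
  proof (rule tendsto_sandwich[OF _ _ tendsto_const])
    show "(\<lambda>N. real m * g * exp (C * T) / real (Suc N)) \<longlonglongrightarrow> 0"
      using LIMSEQ_Suc[OF lim_const_over_n[of "real m * g * exp (C * T)"]] by simp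
  qed (use bnd f_nonneg T in auto)
  then have "(\<lambda>N. g - (g - psum (q T) N)) \<longlonglongrightarrow> g - 0" by (intro tendsto_intros)
  then show ?thesis
    by (simp add: sums_def psum_def lessThan_atLeast0 sum.shift_bounds_Suc_ivl[symmetric] atLeastLessThanSuc_atLeastAtMost flip: sum.atLeast_Suc_lessThan)
qed

text \<open>The exceptional points will be the burning times, where the loss rate jumps and only
  continuity of the solution is known.\<close>

lemma nonincreasing_except_finite:
  fixes f :: "real \<Rightarrow> real"
  assumes F: "finite F" and ab: "a \<le> b" and cont: "continuous_on {a..b} f"
    and deriv: "\<And>x. x \<in> {a<..<b} - F \<Longrightarrow> (f has_real_derivative f' x) (at x)"
    and le: "\<And>x. x \<in> {a<..<b} - F \<Longrightarrow> f' x \<le> 0"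
  shows "f b \<le> f a"
proof -
  define f'' where "f'' x = (if x \<in> {a<..<b} - F then f' x else 0)" for x
  have "(f'' has_integral (f b - f a)) {a..b}"
  proof (rule fundamental_theorem_of_calculus_interior_strong[OF F ab _ cont])
    fix x assume "x \<in> {a<..<b} - F"
    then show "(f has_vector_derivative f'' x) (at x)"
      using deriv[of x] by (simp add: f''_def has_real_derivative_iff_has_vector_derivative)
  qed
  moreover have "((\<lambda>x. 0) has_integral 0) {a..b}" by simp
  ultimately have "f b - f a \<le> 0"
    by (rule has_integral_le) (use le in \<open>auto simp: f''_def\<close>)
  then show ?thesis by simp
qed

text \<open>The bound of the truncated masses by g comes from an integrating factor: the rate of
  \<open>psum\<close> is at most D (psum - g), with D the truncated first moment, so (psum - g)
  exp(- I) does not increase from its nonpositive initial value. Conservation then follows with the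
  constant loss rate g.\<close>

lemma flory_mass_conserved:
  fixes q :: "real \<Rightarrow> nat \<Rightarrow> real"
  assumes T: "0 \<le> T" and F: "finite F"
    and cont: "\<And>k. 1 \<le> k \<Longrightarrow> continuous_on {0..T} (\<lambda>t. q t k)"
    and deriv: "\<And>k t. 1 \<le> k \<Longrightarrow> t \<in> {0<..<T} - F \<Longrightarrow>
        ((\<lambda>s. q s k) has_real_derivative (coag (q t) k - real k * q t k * g)) (at t)"
    and nonneg: "\<And>k t. 1 \<le> k \<Longrightarrow> t \<in> {0..T} \<Longrightarrow> 0 \<le> q t k"
    and supp: "\<And>k. m < k \<Longrightarrow> q 0 k = 0" and g: "psum (q 0) m = g"
    and a: "pmom (q 0) m \<le> a" "0 < a" "T * a < 1"
  shows "(\<lambda>k. q T (Suc k)) sums g"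
proof (rule mass_conserved[where q=q and \<mu>="\<lambda>_. g" and a=a and m=m, OF T _ nonneg _ order_refl supp g a])
  fix k t assume k: "1 \<le> (k::nat)" and t: "t \<in> {0..T}"
  show "((\<lambda>s. coag (q s) k - real k * q s k * g) has_integral q t k - q 0 k) {0..t}"
  proof (rule fundamental_theorem_of_calculus_interior_strong[OF F])
    show "continuous_on {0..t} (\<lambda>t. q t k)" using t by (intro continuous_on_subset[OF cont[OF k]]) auto
    fix x assume "x \<in> {0<..<t} - F"
    then show "((\<lambda>t. q t k) has_vector_derivative coag (q x) k - real k * q x k * g) (at x)"
      using deriv[OF k, of x] t by (simp add: has_real_derivative_iff_has_vector_derivative)
  qed (use t in auto)
next
  fix n t assume t: "t \<in> {0..T}"
  define D where "D s = pmom (q s) n" for s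
  have Dc: "continuous_on {0..T} D"
    unfolding D_def pmom_def by (intro continuous_intros cont) auto
  define I where "I s = integral {0..s} D" for s
  have Ic: "continuous_on {0..T} I"
    unfolding I_def by (intro indefinite_integral_continuous_1 integrable_continuous_real Dc)
  have dI: "(I has_real_derivative D s) (at s)" if "s \<in> {0<..<T}" for s
  proof -
    have "(I has_real_derivative D s) (at s within {0..T})"
      unfolding I_def using that by (intro integral_has_real_derivative Dc) auto
    then show ?thesis using that at_within_Icc_at[of 0 s T] by simp
  qed
  define R where "R s = (\<Sum>k=1..n. coag (q s) k - real k * q s k * g)" for s
  have dS: "((\<lambda>s. psum (q s) n) has_real_derivative R s) (at s)" if "s \<in> {0<..<T} - F" for s
    unfolding psum_def R_def using that by (intro DERIV_sum deriv) auto
  have R: "R s \<le> D s * (psum (q s) n - g)" if s: "s \<in> {0..T}" for s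
  proof -
    have "R s = (\<Sum>l=1..n. real l * q s l * (psum (q s) (n - l) - g))"
      unfolding R_def psum_rate by (simp add: sum_negf[symmetric] algebra_simps)
    also have "\<dots> \<le> (\<Sum>l=1..n. real l * q s l * (psum (q s) n - g))"
      by (intro sum_mono mult_left_mono diff_right_mono psum_mono nonneg s) (use nonneg s in auto)
    finally show ?thesis by (simp add: D_def pmom_def sum_distrib_right)
  qed
  have "(psum (q t) n - g) * exp (- I t) \<le> (psum (q 0) n - g) * exp (- I 0)"
  proof (rule nonincreasing_except_finite[OF F, where f="\<lambda>s. (psum (q s) n - g) * exp (- I s)"
        and f'="\<lambda>s. (R s - D s * (psum (q s) n - g)) * exp (- I s)"])
    show "continuous_on {0..t} (\<lambda>s. (psum (q s) n - g) * exp (- I s))"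
      unfolding psum_def using t
      by (intro continuous_intros continuous_on_subset[OF Ic] continuous_on_subset[OF cont]) auto
    fix s assume s: "s \<in> {0<..<t} - F"
    then have s': "s \<in> {0<..<T} - F" "s \<in> {0<..<T}" "s \<in> {0..T}" using t by auto
    show "((\<lambda>s. (psum (q s) n - g) * exp (- I s)) has_real_derivative (R s - D s * (psum (q s) n - g)) * exp (- I s)) (at s)"
      by (rule derivative_eq_intros dI dS s' refl)+ (simp add: algebra_simps)
    show "(R s - D s * (psum (q s) n - g)) * exp (- I s) \<le> 0"
      using R[OF s'(3)] by (intro mult_nonpos_nonneg) auto
  qed (use t in auto)
  moreover have "psum (q 0) n \<le> g"
  proof -
    have "psum (q 0) (max m n) = psum (q 0) m"
      unfolding psum_def using supp by (intro sum.mono_neutral_right) auto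
    then show ?thesis using psum_mono[of "q 0" n "max m n"] nonneg[of _ 0] T g by auto
  qed
  ultimately have "(psum (q t) n - g) * exp (- I t) \<le> 0"
    by (simp add: I_def)
  then show "psum (q t) n \<le> g" by (simp add: mult_le_0_iff)
qed

section \<open>Exponential tilting and the mass along characteristics\<close>

definition gf :: "(nat \<Rightarrow> real) \<Rightarrow> nat \<Rightarrow> real \<Rightarrow> real" where
  "gf v m x = (\<Sum>k=1..m. v k * exp (- (real k * x)))"

definition gf1 :: "(nat \<Rightarrow> real) \<Rightarrow> nat \<Rightarrow> real \<Rightarrow> real" where
  "gf1 v m x = (\<Sum>k=1..m. real k * v k * exp (- (real k * x)))"

definition gf2 :: "(nat \<Rightarrow> real) \<Rightarrow> nat \<Rightarrow> real \<Rightarrow> real" where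
  "gf2 v m x = (\<Sum>k=1..m. (real k)\<^sup>2 * v k * exp (- (real k * x)))"

lemma DERIV_gf: "(gf v m has_real_derivative - gf1 v m x) (at x)"
  unfolding gf_def[abs_def] gf1_def
  by (auto intro!: derivative_eq_intros simp: sum_negf[symmetric]) (simp add: mult_ac)

lemma DERIV_gf1: "(gf1 v m has_real_derivative - gf2 v m x) (at x)"
  unfolding gf1_def[abs_def] gf2_def
  by (auto intro!: derivative_eq_intros sum.cong simp: sum_negf[symmetric] power2_eq_square)

lemma continuous_on_gf2: "continuous_on A (gf2 v m)"
  unfolding gf2_def[abs_def] by (intro continuous_intros)

text \<open>The weights of the two partners multiply to exp (k b), so tilting commutes with
  coagulation and, when b depends on time, only alters the loss rate.\<close>

lemma coag_exp: "coag (\<lambda>k. w k * exp (real k * b)) k = coag w k * exp (real k * b)"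
proof -
  have "(\<Sum>l = 1..k - 1. real l * (w l * exp (real l * b)) * (w (k - l) * exp (real (k - l) * b)))
    = (\<Sum>l = 1..k - 1. real l * w l * w (k - l) * exp (real k * b))"
  proof (rule sum.cong)
    fix l assume "l \<in> {1..k-1}"
    then have k: "real k = real l + real (k - l)" by auto
    show "real l * (w l * exp (real l * b)) * (w (k - l) * exp (real (k - l) * b)) = real l * w l * w (k - l) * exp (real k * b)"
      unfolding k distrib_right exp_add by simp
  qed simp
  then show ?thesis unfolding coag_alt by (simp add: sum_distrib_right)
qed

text \<open>Multiplying by \<open>exp (k (A t - x - t G x))\<close>, where \<open>G\<close> is the generating function of
  the initial data, turns a solution with loss rate \<open>\<mu> = A'\<close> into a solution of Flory's equation
  whose loss rate is its own initial mass \<open>G x\<close> and whose gelation time is \<open>1 / M1 x\<close>.\<close>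

lemma mass_on_characteristic_strict:
  fixes w :: "real \<Rightarrow> nat \<Rightarrow> real"
  assumes T: "0 \<le> T" and F: "finite F"
    and w0: "\<And>k. 1 \<le> k \<Longrightarrow> w 0 k = v k" and supp: "\<And>k. m < k \<Longrightarrow> v k = 0"
    and w_nonneg: "\<And>k t. 1 \<le> k \<Longrightarrow> 0 \<le> t \<Longrightarrow> 0 \<le> w t k"
    and w_cont: "\<And>k. 1 \<le> k \<Longrightarrow> continuous_on {0..T} (\<lambda>t. w t k)"
    and A_cont: "continuous_on {0..T} A" and A0: "A 0 = 0"
    and dA: "\<And>t. t \<in> {0<..<T} - F \<Longrightarrow> (A has_real_derivative \<mu> t) (at t)"
    and dw: "\<And>k t. 1 \<le> k \<Longrightarrow> t \<in> {0<..<T} - F \<Longrightarrow>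
        ((\<lambda>s. w s k) has_real_derivative (coag (w t) k - real k * w t k * \<mu> t)) (at t)"
    and M1: "0 < gf1 v m x" "T * gf1 v m x < 1"
  shows "(\<lambda>k. w T (Suc k) * exp (real (Suc k) * (A T - (x + T * gf v m x)))) sums gf v m x"
proof -
  define b where "b t = A t - (x + t * gf v m x)" for t
  define q where "q t k = w t k * exp (real k * b t)" for t k
  have psum0: "psum (q 0) m = gf v m x"
    by (auto simp: psum_def q_def b_def A0 gf_def w0)
  have pmom0: "pmom (q 0) m = gf1 v m x"
    by (auto simp: pmom_def q_def b_def A0 gf1_def w0 mult.assoc)
  have "(\<lambda>k. q T (Suc k)) sums gf v m x"
  proof (rule flory_mass_conserved[where q=q, OF T F _ _ _ _ psum0 _ M1])
    fix k :: nat assume k: "1 \<le> k"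
    show "continuous_on {0..T} (\<lambda>t. q t k)"
      unfolding q_def b_def by (intro continuous_intros w_cont A_cont k)
    show "0 \<le> q t k" if "t \<in> {0..T}" for t
      using w_nonneg[OF k] that by (simp add: q_def)
    fix t assume t: "t \<in> {0<..<T} - F"
    have db: "(b has_real_derivative (\<mu> t - gf v m x)) (at t)"
      unfolding b_def by (rule derivative_eq_intros dA t refl)+ simp
    have "((\<lambda>s. q s k) has_real_derivative
        (coag (w t) k - real k * w t k * \<mu> t) * exp (real k * b t) + 
        w t k * (exp (real k * b t) * (real k * (\<mu> t - gf v m x)))) (at t)"
      unfolding q_def by (rule derivative_eq_intros dw k t db refl)+ simp
    moreover have "coag (q t) k = coag (w t) k * exp (real k * b t)"
      unfolding q_def by (rule coag_exp)
    ultimately show "((\<lambda>s. q s k) has_real_derivative coag (q t) k - real k * q t k * gf v m x) (at t)"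
      by (simp add: q_def algebra_simps)
  next
    show "q 0 k = 0" if "m < k" for k
      using that w0[of k] supp[of k] by (auto simp: q_def)
  qed (simp add: pmom0)
  then show ?thesis by (simp add: q_def b_def)
qed

text \<open>The gelation point itself is reached as a limit of y decreasing to x. Partial sums pass
  to the limit by continuity, which gives one inequality. For the other, \<open>K\<close> increases
  to the right of x, so the series at y is dominated term by term by the series at x, while its sum
  \<open>gf v m y\<close> tends to \<open>gf v m x\<close>.\<close>

lemma mass_on_characteristic:
  fixes w :: "real \<Rightarrow> nat \<Rightarrow> real"
  assumes T: "0 \<le> T" and F: "finite F"
    and w0: "\<And>k. 1 \<le> k \<Longrightarrow> w 0 k = v k" and supp: "\<And>k. m < k \<Longrightarrow> v k = 0"
    and w_nonneg: "\<And>k t. 1 \<le> k \<Longrightarrow> 0 \<le> t \<Longrightarrow> 0 \<le> w t k"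
    and w_cont: "\<And>k. 1 \<le> k \<Longrightarrow> continuous_on {0..T} (\<lambda>t. w t k)"
    and A_cont: "continuous_on {0..T} A" and A0: "A 0 = 0"
    and dA: "\<And>t. t \<in> {0<..<T} - F \<Longrightarrow> (A has_real_derivative \<mu> t) (at t)"
    and dw: "\<And>k t. 1 \<le> k \<Longrightarrow> t \<in> {0<..<T} - F \<Longrightarrow>
        ((\<lambda>s. w s k) has_real_derivative (coag (w t) k - real k * w t k * \<mu> t)) (at t)"
    and gf1_pos: "\<And>y. 0 < gf1 v m y" and gf1_strict: "\<And>y z. y < z \<Longrightarrow> gf1 v m z < gf1 v m y"
    and le: "T * gf1 v m x \<le> 1"
  shows "(\<lambda>k. w T (Suc k) * exp (real (Suc k) * (A T - (x + T * gf v m x)))) sums gf v m x"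
proof (cases "T = 0")
  case True
  then show ?thesis using mass_on_characteristic_strict[OF T F w0 supp w_nonneg w_cont A_cont A0 dA dw gf1_pos, of x] by simp
next
  case False
  then have Tpos: "0 < T" using T by simp
  define K where "K y = y + T * gf v m y" for y
  define s where "s y k = w T (Suc k) * exp (real (Suc k) * (A T - K y))" for y k
  have lt: "T * gf1 v m y < 1" if "x < y" for y
    using mult_strict_left_mono[OF gf1_strict[OF that] Tpos] le by simp
  have sums: "s y sums gf v m y" if "x < y" for y
    unfolding s_def K_def
    using lt[OF that] gf1_pos
    by (intro mass_on_characteristic_strict[OF T F w0 supp w_nonneg w_cont A_cont A0 dA dw])
  have s_nonneg: "0 \<le> s y k" for y k using w_nonneg[of "Suc k" T] T by (simp add: s_def)
  have gf_cont: "isCont (gf v m) y" for y by (rule DERIV_isCont[OF DERIV_gf])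
  have gf_anti: "gf v m y \<le> gf v m x" if "x \<le> y" for y
    using that by (intro DERIV_nonpos_imp_nonincreasing[of x y "gf v m"]) (auto intro!: exI[of _ "- gf1 v m _"] DERIV_gf simp: gf1_pos less_imp_le)
  have K_mono: "K x \<le> K y" if "x \<le> y" for y
  proof (rule DERIV_nonneg_imp_nondecreasing[OF that])
    fix z assume z: "x \<le> z" "z \<le> y"
    have "T * gf1 v m z \<le> 1" using lt[of z] le z by (cases "z = x") auto
    then show "\<exists>d. (K has_real_derivative d) (at z) \<and> 0 \<le> d"
      unfolding K_def by (intro exI[of _ "1 + T * - gf1 v m z"] conjI) (auto intro!: derivative_eq_intros DERIV_gf)
  qed
  have s_cont: "isCont (\<lambda>y. s y k) x" for k
    unfolding s_def K_def by (intro continuous_intros gf_cont)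
  have part: "sum (s x) {..<n} \<le> gf v m x" for n
  proof (rule tendsto_upperbound)
    show "((\<lambda>y. sum (s y) {..<n}) \<longlongrightarrow> sum (s x) {..<n}) (at_right x)"
      using s_cont by (intro tendsto_sum) (auto simp: isCont_def intro: filterlim_at_within_not_equal tendsto_within_subset)
    show "\<forall>\<^sub>F y in at_right x. sum (s y) {..<n} \<le> gf v m x"
    proof (rule eventually_at_rightI[of x "x+1"])
      fix y assume "y \<in> {x<..<x+1}"
      then have y: "x < y" by simp
      have "sum (s y) {..<n} \<le> suminf (s y)" 
        by (intro sum_le_suminf sums_summable[OF sums[OF y]]) (auto intro: s_nonneg)
      also have "\<dots> = gf v m y" using sums[OF y] by (rule sums_unique[symmetric])
      finally show "sum (s y) {..<n} \<le> gf v m x" using gf_anti[of y] y by simp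
    qed simp
  qed simp
  have summ: "summable (s x)"
    by (rule summableI_nonneg_bounded[OF s_nonneg part])
  have "suminf (s x) \<le> gf v m x" by (rule suminf_le_const[OF summ part])
  moreover have "gf v m x \<le> suminf (s x)"
  proof (rule tendsto_upperbound)
    show "(gf v m \<longlongrightarrow> gf v m x) (at_right x)"
      using gf_cont[of x] by (auto simp: isCont_def intro: tendsto_within_subset)
    show "\<forall>\<^sub>F y in at_right x. gf v m y \<le> suminf (s x)"
    proof (rule eventually_at_rightI[of x "x+1"])
      fix y assume "y \<in> {x<..<x+1}"
      then have y: "x < y" by simp
      have "s y k \<le> s x k" for k
        unfolding s_def using K_mono[of y] y w_nonneg[of "Suc k" T] T
        by (intro mult_left_mono) (auto intro!: mult_left_mono)
      then have "suminf (s y) \<le> suminf (s x)"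
        by (intro suminf_le sums_summable[OF sums[OF y]] summ)
      then show "gf v m y \<le> suminf (s x)" using sums_unique[OF sums[OF y]] by simp
    qed simp
  qed simp
  ultimately have "s x sums gf v m x" using summable_sums[OF summ] by simp
  then show ?thesis by (simp add: s_def[abs_def] K_def)
qed

section \<open>Burning as a chord of the generating function\<close>

text \<open>The generating function of nonzero, finitely supported data in abstract form: positive,
  strictly decreasing and strictly convex. The vanishing slope at infinity makes every sufficiently
  late time the gelation time of some state.\<close>

locale mass_profile =
  fixes G M1 M2 :: "real \<Rightarrow> real"
  assumes G_pos: "0 < G x" and M1_pos: "0 < M1 x" and M2_pos: "0 < M2 x"
    and DERIV_G: "(G has_real_derivative - M1 x) (at x)"
    and DERIV_M1: "(M1 has_real_derivative - M2 x) (at x)"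
    and cont_M2: "continuous_on UNIV M2"
    and M1_lim: "(M1 \<longlongrightarrow> 0) at_top"
begin

definition K :: "real \<Rightarrow> real \<Rightarrow> real" where "K t x = x + t * G x"

text \<open>The time t at which the line of slope -1 / t is tangent to the graph of G at x. A state
  x has no giant up to and including this time.\<close>

definition gel :: "real \<Rightarrow> real" where "gel x = 1 / M1 x"

text \<open>The state \<open>x\<close> turns into \<open>burn t x\<close> when the giant is burnt at time \<open>t\<close>.\<close>
definition burn :: "real \<Rightarrow> real \<Rightarrow> real" where
  "burn t x = (if t * M1 x \<le> 1 then x else (THE y. x < y \<and> t * M1 y \<le> 1 \<and> K t y = K t x))"

definition giant :: "real \<Rightarrow> real \<Rightarrow> real" where "giant x t = G x - G (burn t x)"

text \<open>The integral starts at 0 instead of at the beginning of the cycle. Both give the same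
  value: every cycle in state x begins no later than \<open>gel x\<close>, and the giant is zero
  until then.\<close>

definition haz :: "real \<Rightarrow> real \<Rightarrow> real" where
  "haz x t = (LINT r|lborel. indicator {0..t} r *\<^sub>R giant x r)"

text \<open>Mass lost per unit of gelation time: as x increases, G falls at speed M1 while
  \<open>gel\<close> advances at speed M2 / M1^2. This is the critical burning rate at the time
  \<open>gel x\<close>.\<close>

definition rate :: "real \<Rightarrow> real" where "rate x = M1 x ^ 3 / M2 x"

lemma G_strict: "x < y \<Longrightarrow> G y < G x"
  by (rule DERIV_neg_imp_decreasing) (auto intro!: exI[of _ "- M1 _"] DERIV_G M1_pos)

lemma M1_strict: "x < y \<Longrightarrow> M1 y < M1 x"
  by (rule DERIV_neg_imp_decreasing) (auto intro!: exI[of _ "- M2 _"] DERIV_M1 M2_pos)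

lemma G_le_iff: "G y \<le> G x \<longleftrightarrow> x \<le> y"
  using G_strict[of x y] G_strict[of y x] by (cases x y rule: linorder_cases) auto

lemma G_less_iff: "G y < G x \<longleftrightarrow> x < y"
  using G_strict[of x y] G_strict[of y x] by (cases x y rule: linorder_cases) auto

lemma M1_le_iff: "M1 y \<le> M1 x \<longleftrightarrow> x \<le> y"
  using M1_strict[of x y] M1_strict[of y x] by (cases x y rule: linorder_cases) auto

lemma isCont_G: "isCont G x" by (rule DERIV_isCont[OF DERIV_G])
lemma isCont_M1: "isCont M1 x" by (rule DERIV_isCont[OF DERIV_M1])
lemma continuous_on_G: "continuous_on A G" by (auto intro: continuous_at_imp_continuous_on isCont_G)
lemma continuous_on_M1: "continuous_on A M1" by (auto intro: continuous_at_imp_continuous_on isCont_M1)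

lemma borel_measurable_G[measurable]: "G \<in> borel_measurable borel"
  by (intro borel_measurable_continuous_onI continuous_on_G)
lemma borel_measurable_M1[measurable]: "M1 \<in> borel_measurable borel"
  by (intro borel_measurable_continuous_onI continuous_on_M1)

lemma gel_pos: "0 < gel x" by (simp add: gel_def M1_pos)
lemma gel_le_iff: "gel x \<le> gel y \<longleftrightarrow> x \<le> y"
  using M1_pos[of x] M1_pos[of y] M1_le_iff[of y x] by (simp add: gel_def frac_le_eq divide_simps)
lemma gel_less_iff: "gel x < gel y \<longleftrightarrow> x < y"
  using gel_le_iff[of y x] by linarith
lemma M1_gel: "t * M1 x \<le> 1 \<longleftrightarrow> t \<le> gel x"
  using M1_pos[of x] by (simp add: gel_def field_simps)
lemma DERIV_gel: "(gel has_real_derivative M2 x / (M1 x)\<^sup>2) (at x)"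
  unfolding gel_def[abs_def] using M1_pos[of x]
  by (auto intro!: derivative_eq_intros DERIV_M1 simp: power2_eq_square)
lemma isCont_gel: "isCont gel x" by (rule DERIV_isCont[OF DERIV_gel])
lemma continuous_on_gel: "continuous_on A gel" by (auto intro: continuous_at_imp_continuous_on isCont_gel)

lemma rate_pos: "0 < rate x" by (simp add: rate_def M1_pos M2_pos)

lemma continuous_on_rate: "continuous_on A rate"
  unfolding rate_def[abs_def]
  by (intro continuous_intros continuous_on_M1 continuous_on_subset[OF cont_M2]) (auto simp: M2_pos less_imp_neq[symmetric] dest: sym intro: less_imp_neq[OF M2_pos, symmetric])

lemma gel_surj:
  assumes "gel x \<le> t"
  shows "\<exists>y\<ge>x. gel y = t"
proof -
  have t: "0 < t" using assms gel_pos[of x] by linarith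
  have "eventually (\<lambda>y. M1 y < 1 / t) at_top"
    using M1_lim t by (intro order_tendstoD) auto
  then have "eventually (\<lambda>y. M1 y < 1 / t \<and> x \<le> y) at_top"
    by (intro eventually_conj eventually_ge_at_top)
  then obtain z where z: "M1 z < 1 / t" "x \<le> z"
    by (auto dest: eventually_happens)
  then have "t \<le> gel z" using M1_pos[of z] t by (simp add: gel_def field_simps)
  then show ?thesis
    using IVT'[of gel x t z] assms z(2) continuous_on_gel by auto
qed

lemma DERIV_K: "(K t has_real_derivative 1 - t * M1 x) (at x)"
  unfolding K_def[abs_def] by (auto intro!: derivative_eq_intros DERIV_G)

lemma continuous_on_K: "continuous_on A (K t)"
  by (auto intro: continuous_at_imp_continuous_on DERIV_isCont[OF DERIV_K])

lemma K_strict: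
  assumes "t \<le> gel y" "y < z"
  shows "K t y < K t z"
proof (rule DERIV_pos_imp_increasing_open[OF assms(2) _ continuous_on_K])
  fix x assume "y < x" "x < z"
  then have "t < gel x" using assms(1) gel_less_iff[of y x] by linarith
  then have "0 < 1 - t * M1 x" using M1_pos[of x] by (simp add: gel_def field_simps)
  then show "\<exists>d. (K t has_real_derivative d) (at x) \<and> 0 < d" using DERIV_K by blast
qed

lemma K_strict_dec:
  assumes "gel z \<le> t" "y < z"
  shows "K t z < K t y"
proof (rule DERIV_neg_imp_decreasing_open[OF assms(2) _ continuous_on_K])
  fix x assume "y < x" "x < z"
  then have "gel x < t" using assms(1) gel_less_iff[of x z] by linarith
  then have "1 - t * M1 x < 0" using M1_pos[of x] by (simp add: gel_def field_simps)
  then show "\<exists>d. (K t has_real_derivative d) (at x) \<and> d < 0" using DERIV_K by blast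
qed

text \<open>\<open>K t\<close> decreases up to the point \<xi> with gelation time t and increases
  afterwards. Since K t y is at least y, it has returned to the value K t x at the latest at y = K t
  x.\<close>

lemma burn_ex1:
  assumes "gel x < t"
  shows "\<exists>!y. x < y \<and> t * M1 y \<le> 1 \<and> K t y = K t x"
proof -
  have t: "0 < t" using assms gel_pos[of x] by linarith
  obtain \<xi> where \<xi>: "x \<le> \<xi>" "gel \<xi> = t" using gel_surj[of x t] assms by auto
  then have x\<xi>: "x < \<xi>" using assms by (cases "x = \<xi>") auto
  have K1: "K t \<xi> < K t x" using K_strict_dec[of \<xi> t x] \<xi> x\<xi> by simp
  have Kge: "y \<le> K t y" for y using G_pos[of y] t by (simp add: K_def)
  obtain y where y: "\<xi> \<le> y" "y \<le> K t x" "K t y = K t x"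
    using IVT'[of "K t" \<xi> "K t x" "K t x"] K1 Kge[of "K t x"] Kge[of \<xi>] continuous_on_K by (auto)
  show ?thesis
  proof (rule ex1I[of _ y])
    show "x < y \<and> t * M1 y \<le> 1 \<and> K t y = K t x"
      using y x\<xi> \<xi> gel_le_iff[of \<xi> y] by (simp add: M1_gel)
    fix z assume z: "x < z \<and> t * M1 z \<le> 1 \<and> K t z = K t x"
    then have "t \<le> gel z" by (simp add: M1_gel)
    moreover have "t \<le> gel y" using y \<xi> gel_le_iff[of \<xi> y] by simp
    ultimately show "z = y"
      using K_strict[of t z y] K_strict[of t y z] z y by (cases z y rule: linorder_cases) auto
  qed
qed

lemma burn_eq_self: "t \<le> gel x \<Longrightarrow> burn t x = x"
  by (simp add: burn_def M1_gel)

lemma burn_greater: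
  assumes "gel x < t"
  shows "x < burn t x" "t \<le> gel (burn t x)" "K t (burn t x) = K t x"
  using theI'[OF burn_ex1[OF assms]] assms by (auto simp: burn_def M1_gel)

lemma burn_ge: "x \<le> burn t x"
  using burn_greater[of x t] burn_eq_self[of t x] by (cases "gel x < t") auto

lemma burn_gel: "t \<le> gel (burn t x)"
  using burn_greater[of x t] burn_eq_self[of t x] by (cases "gel x < t") auto

lemma burn_K: "K t (burn t x) = K t x"
  using burn_greater[of x t] burn_eq_self[of t x] by (cases "gel x < t") auto

text \<open>Describes the sublevel sets of \<open>burn\<close> by closed inequalities in t, x and y,
  so that joint measurability can be read off although \<open>burn\<close> is a definite
  description.\<close>

lemma burn_le_iff: "burn t x \<le> y \<longleftrightarrow> x \<le> y \<and> t * M1 y \<le> 1 \<and> K t x \<le> K t y"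
proof
  assume y: "burn t x \<le> y"
  then have "t \<le> gel y" using burn_gel[of t x] gel_le_iff[of "burn t x" y] by linarith
  moreover have "K t x \<le> K t y"
    using K_strict[of t "burn t x" y] burn_gel[of t x] burn_K[of t x] y by (cases "burn t x = y") auto
  ultimately show "x \<le> y \<and> t * M1 y \<le> 1 \<and> K t x \<le> K t y"
    using y burn_ge[of x t] by (auto simp: M1_gel)
next
  assume y: "x \<le> y \<and> t * M1 y \<le> 1 \<and> K t x \<le> K t y"
  show "burn t x \<le> y"
  proof (rule ccontr)
    assume "\<not> burn t x \<le> y"
    then have "K t y < K t (burn t x)" using y by (intro K_strict) (auto simp: M1_gel)
    then show False using y burn_K[of t x] by simp
  qed
qed

lemma burn_eqI: "x \<le> y \<Longrightarrow> t \<le> gel y \<Longrightarrow> K t y = K t x \<Longrightarrow> burn t x = y"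
  using burn_le_iff[of t x y] K_strict[of t "burn t x" y] burn_gel[of t x] burn_K[of t x]
  by (cases "burn t x = y") (auto simp: M1_gel)

lemma burn_measurable_pair[measurable]: "(\<lambda>p. burn (fst p) (snd p)) \<in> borel_measurable (borel \<Otimes>\<^sub>M borel)"
  unfolding borel_measurable_iff_le burn_le_iff K_def by measurable

lemma burn_measurable[measurable (raw)]:
  "f \<in> borel_measurable M \<Longrightarrow> g \<in> borel_measurable M \<Longrightarrow> (\<lambda>w. burn (f w) (g w)) \<in> borel_measurable M"
  using measurable_compose[OF measurable_Pair burn_measurable_pair, of f M g] by simp

lemma giant_nonneg: "0 \<le> giant x t"
  using burn_ge[of x t] by (simp add: giant_def G_le_iff)

lemma giant_le: "giant x t \<le> G x"
  using G_pos[of "burn t x"] by (simp add: giant_def)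

lemma giant_zero: "t \<le> gel x \<Longrightarrow> giant x t = 0"
  by (simp add: giant_def burn_eq_self)

lemma giant_chord: "t * giant x t = burn t x - x"
  using burn_K[of t x] by (simp add: K_def giant_def algebra_simps)

lemma giant_measurable[measurable (raw)]:
  "f \<in> borel_measurable M \<Longrightarrow> g \<in> borel_measurable M \<Longrightarrow> (\<lambda>w. giant (f w) (g w)) \<in> borel_measurable M"
  unfolding giant_def
  by (intro borel_measurable_diff measurable_compose[OF _ borel_measurable_G] burn_measurable)

text \<open>The chord identity at time t shows that K s x is at most K s (burn t x) for an earlier
  s. Hence \<open>burn t x\<close> lies at or beyond the return point belonging to s.\<close>

lemma burn_mono: 
  assumes "s \<le> t"
  shows "burn s x \<le> burn t x"
proof (cases "gel x < t")
  case True
  have y: "burn t x - x = t * (G x - G (burn t x))" using giant_chord[of t x] by (simp add: giant_def)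
  have "s * (G x - G (burn t x)) \<le> t * (G x - G (burn t x))"
    using assms giant_nonneg[of x t] by (intro mult_right_mono) (auto simp: giant_def)
  then have "K s x \<le> K s (burn t x)" using y by (simp add: K_def algebra_simps)
  then show ?thesis using burn_ge[of x t] burn_gel[of t x] assms by (simp add: burn_le_iff M1_gel)
next
  case False
  then show ?thesis using assms by (simp add: burn_eq_self)
qed

lemma giant_mono: "s \<le> t \<Longrightarrow> giant x s \<le> giant x t"
  using burn_mono[of s t x] by (simp add: giant_def G_le_iff)

section \<open>The accumulated hazard of a single state\<close>

lemma giant_integrable: "integrable lborel (\<lambda>r. indicator {a..t} r *\<^sub>R giant x r)"
proof (rule integrableI_bounded_set_indicator[where B="G x"])
  show "AE r in lborel. r \<in> {a..t} \<longrightarrow> norm (giant x r) \<le> G x"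
    using giant_nonneg[of x] giant_le[of x] by auto
  show "emeasure lborel {a..t} < \<infinity>" by (cases "a \<le> t") auto
qed auto

lemma haz_split:
  assumes "0 \<le> s" "s \<le> t"
  shows "haz x t = haz x s + (LINT r|lborel. indicator {s..t} r *\<^sub>R giant x r)"
proof -
  have "haz x t = (LINT r|lborel. indicator {0..s} r *\<^sub>R giant x r + indicator {s..t} r *\<^sub>R giant x r)"
    unfolding haz_def
  proof (rule integral_cong_AE)
    have "AE r in lborel. r \<noteq> s" by (rule AE_lborel_singleton)
    then show "AE r in lborel. indicator {0..t} r *\<^sub>R giant x r = indicator {0..s} r *\<^sub>R giant x r + indicator {s..t} r *\<^sub>R giant x r"
      by eventually_elim (use assms in \<open>auto simp: indicator_def\<close>)
  qed auto
  also have "\<dots> = haz x s + (LINT r|lborel. indicator {s..t} r *\<^sub>R giant x r)"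
    unfolding haz_def by (rule Bochner_Integration.integral_add[OF giant_integrable giant_integrable])
  finally show ?thesis .
qed

lemma haz_increment_bounds:
  assumes "0 \<le> s" "s \<le> t"
  shows "0 \<le> haz x t - haz x s" "haz x t - haz x s \<le> giant x t * (t - s)"
proof -
  have eq: "haz x t - haz x s = (LINT r|lborel. indicator {s..t} r *\<^sub>R giant x r)"
    using haz_split[OF assms] by simp
  show "0 \<le> haz x t - haz x s"
    unfolding eq by (intro integral_nonneg_AE) (auto simp: giant_nonneg)
  have "(LINT r|lborel. indicator {s..t} r *\<^sub>R giant x r) \<le> (LINT r|lborel. indicator {s..t} r *\<^sub>R giant x t)"
  proof (rule integral_mono[OF giant_integrable])
    show "integrable lborel (\<lambda>r. indicator {s..t} r *\<^sub>R giant x t)"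
      using assms by (intro integrable_scaleR_left) (auto simp: integrable_indicator_iff)
  qed (auto simp: indicator_def giant_mono)
  also have "\<dots> = giant x t * (t - s)" using assms by simp
  finally show "haz x t - haz x s \<le> giant x t * (t - s)" unfolding eq .
qed

lemma haz_mono: "s \<le> t \<Longrightarrow> haz x s \<le> haz x t"
proof (cases "0 \<le> s")
  case False
  then have "haz x s = 0" unfolding haz_def by (auto intro!: integral_eq_zero_AE)
  moreover have "0 \<le> haz x t" unfolding haz_def by (intro integral_nonneg_AE) (auto simp: giant_nonneg)
  ultimately show ?thesis by simp
qed (use haz_increment_bounds(1)[of s t x] in auto)

lemma haz_nonneg: "0 \<le> haz x t"
  unfolding haz_def by (intro integral_nonneg_AE) (auto simp: giant_nonneg)

lemma haz_zero: "t \<le> gel x \<Longrightarrow> haz x t = 0"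
  unfolding haz_def by (intro integral_eq_zero_AE AE_I2) (auto simp: indicator_def giant_zero)

text \<open>The giant never exceeds G x, so the hazard is Lipschitz with this constant.\<close>

lemma continuous_on_haz: "continuous_on {0..} (haz x)"
proof (rule continuous_onI)
  fix t e :: real assume t: "t \<in> {0..}" and e: "0 < e"
  show "\<exists>d>0. \<forall>s\<in>{0..}. dist s t < d \<longrightarrow> dist (haz x s) (haz x t) \<le> e"
  proof (intro exI[of _ "e / G x"] conjI ballI impI)
    fix s assume s: "s \<in> {0..}" "dist s t < e / G x"
    have "\<bar>haz x s - haz x t\<bar> \<le> G x * \<bar>s - t\<bar>"
    proof (cases "s \<le> t")
      case True
      then have ts: "0 \<le> s" "s \<le> t" using s by auto
      have "giant x t * (t - s) \<le> G x * (t - s)" using ts by (intro mult_right_mono giant_le) auto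
      then have "haz x t - haz x s \<le> G x * (t - s)" using haz_increment_bounds(2)[OF ts, of x] by linarith
      then show ?thesis using haz_increment_bounds(1)[OF ts, of x] ts
        unfolding abs_minus_commute[of "haz x s"] abs_minus_commute[of s] by (simp only: abs_of_nonneg diff_ge_0_iff_ge)
    next
      case False
      then have ts: "0 \<le> t" "t \<le> s" using t by auto
      have "giant x s * (s - t) \<le> G x * (s - t)" using ts by (intro mult_right_mono giant_le) auto
      then have "haz x s - haz x t \<le> G x * (s - t)" using haz_increment_bounds(2)[OF ts, of x] by linarith
      then show ?thesis using haz_increment_bounds(1)[OF ts, of x] ts by (simp only: abs_of_nonneg diff_ge_0_iff_ge)
    qed
    also have "\<dots> \<le> G x * (e / G x)"
      using s(2) G_pos[of x] by (intro mult_left_mono) (auto simp: dist_real_def)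
    finally show "dist (haz x s) (haz x t) \<le> e" using G_pos[of x] by (simp add: dist_real_def)
  qed (use e G_pos in auto)
qed

lemma haz_measurable_pair: "(\<lambda>p. haz (fst p) (snd p)) \<in> borel_measurable (borel \<Otimes>\<^sub>M borel)"
proof -
  have eq: "indicator {0..t} r *\<^sub>R giant x r = (if 0 \<le> r \<and> r \<le> t then giant x r else 0)" for x t r
    by auto
  have [measurable]: "(\<lambda>p. fst (fst p)) \<in> borel_measurable ((borel \<Otimes>\<^sub>M borel) \<Otimes>\<^sub>M lborel)"
    "(\<lambda>p. snd (fst p)) \<in> borel_measurable ((borel \<Otimes>\<^sub>M borel) \<Otimes>\<^sub>M lborel)"
    "(\<lambda>p. snd p) \<in> borel_measurable ((borel \<Otimes>\<^sub>M borel) \<Otimes>\<^sub>M lborel)"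
    for a :: "(real \<times> real) \<times> real" by measurable
  have [measurable]: "(\<lambda>p. giant (fst (fst p)) (snd p)) \<in> borel_measurable ((borel \<Otimes>\<^sub>M borel) \<Otimes>\<^sub>M lborel)"
    by (intro giant_measurable) auto
  show ?thesis
    unfolding haz_def eq by (intro lborel.borel_measurable_lebesgue_integral) (simp add: split_beta')
qed

lemma haz_measurable[measurable (raw)]:
  "f \<in> borel_measurable M \<Longrightarrow> g \<in> borel_measurable M \<Longrightarrow> (\<lambda>w. haz (f w) (g w)) \<in> borel_measurable M"
  using measurable_compose[OF measurable_Pair haz_measurable_pair, of f M g] by simp

section \<open>Second-order comparison of chords, giants and hazards\<close>

lemma chord_bounds:
  assumes xy: "x \<le> y" and ab: "0 < a" 
  shows "(\<And>z. z \<in> {x..y} \<Longrightarrow> a \<le> rate z) \<Longrightarrow> (y - x) - gel x * (G x - G y) \<le> (G x - G y)\<^sup>2 / (2 * a)"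
    and "(\<And>z. z \<in> {x..y} \<Longrightarrow> rate z \<le> a) \<Longrightarrow> (G x - G y)\<^sup>2 / (2 * a) \<le> (y - x) - gel x * (G x - G y)"
proof -
  \<comment> \<open>In the coordinate p = G x - G z, the state z has first derivative
    \<open>gel z\<close> and second derivative 1 / \<open>rate z\<close>. Thus D is the second-order
    remainder minus the one for the constant rate a, and f is the derivative of D in p.\<close>
  define f where "f z = gel z - gel x - (G x - G z) / a" for z
  define D where "D z = (z - x) - gel x * (G x - G z) - (G x - G z)\<^sup>2 / (2 * a)" for z
  have df: "(f has_real_derivative (M1 z * (1 / rate z - 1 / a))) (at z)" for z
  proof -
    have "(f has_real_derivative (M2 z / (M1 z)\<^sup>2 - M1 z / a)) (at z)"
      unfolding f_def using ab by (auto intro!: derivative_eq_intros DERIV_gel DERIV_G)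
    moreover have "M2 z / (M1 z)\<^sup>2 - M1 z / a = M1 z * (1 / rate z - 1 / a)"
      using M1_pos[of z] M2_pos[of z] ab by (simp add: rate_def field_simps power2_eq_square power3_eq_cube)
    ultimately show ?thesis by simp
  qed
  have dD: "(D has_real_derivative (M1 z * f z)) (at z)" for z
  proof -
    have "(D has_real_derivative (1 - gel x * M1 z - (G x - G z) * M1 z / a)) (at z)"
      unfolding D_def using ab by (auto intro!: derivative_eq_intros DERIV_G)
    moreover have "1 - gel x * M1 z - (G x - G z) * M1 z / a = M1 z * f z"
      using M1_pos[of z] by (simp add: f_def gel_def algebra_simps)
    ultimately show ?thesis by simp
  qed
  have f0: "f x = 0" and D0: "D x = 0" by (auto simp: f_def D_def)
  show "(y - x) - gel x * (G x - G y) \<le> (G x - G y)\<^sup>2 / (2 * a)" if le: "\<And>z. z \<in> {x..y} \<Longrightarrow> a \<le> rate z"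
  proof -
    have "f z \<le> f x" if z: "z \<in> {x..y}" for z
    proof (rule DERIV_nonpos_imp_nonincreasing[of x z f])
      fix s assume s: "x \<le> s" "s \<le> z"
      have "M1 s * (1 / rate s - 1 / a) \<le> 0"
        using le[of s] s z ab M1_pos[of s] by (intro mult_nonneg_nonpos) (auto intro!: divide_left_mono mult_pos_pos rate_pos)
      then show "\<exists>d. (f has_real_derivative d) (at s) \<and> d \<le> 0" using df by blast
    qed (use z in auto)
    then have fz: "f z \<le> 0" if "z \<in> {x..y}" for z using that f0 by simp
    have "D y \<le> D x"
    proof (rule DERIV_nonpos_imp_nonincreasing[OF xy])
      fix s assume s: "x \<le> s" "s \<le> y"
      have "M1 s * f s \<le> 0" using fz[of s] s M1_pos[of s] by (intro mult_nonneg_nonpos) auto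
      then show "\<exists>d. (D has_real_derivative d) (at s) \<and> d \<le> 0" using dD by blast
    qed
    then show ?thesis using D0 by (simp add: D_def)
  qed
  show "(G x - G y)\<^sup>2 / (2 * a) \<le> (y - x) - gel x * (G x - G y)" if le: "\<And>z. z \<in> {x..y} \<Longrightarrow> rate z \<le> a"
  proof -
    have "f x \<le> f z" if z: "z \<in> {x..y}" for z
    proof (rule DERIV_nonneg_imp_nondecreasing[of x z f])
      fix s assume s: "x \<le> s" "s \<le> z"
      have "0 \<le> M1 s * (1 / rate s - 1 / a)"
        using le[of s] s z ab M1_pos[of s] by (intro mult_nonneg_nonneg) (auto intro!: divide_left_mono mult_pos_pos rate_pos)
      then show "\<exists>d. (f has_real_derivative d) (at s) \<and> 0 \<le> d" using df by blast
    qed (use z in auto)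
    then have fz: "0 \<le> f z" if "z \<in> {x..y}" for z using that f0 by simp
    have "D x \<le> D y"
    proof (rule DERIV_nonneg_imp_nondecreasing[OF xy])
      fix s assume s: "x \<le> s" "s \<le> y"
      have "0 \<le> M1 s * f s" using fz[of s] s M1_pos[of s] by (intro mult_nonneg_nonneg) auto
      then show "\<exists>d. (D has_real_derivative d) (at s) \<and> 0 \<le> d" using dD by blast
    qed
    then show ?thesis using D0 by (simp add: D_def)
  qed
qed

text \<open>By \<open>giant_chord\<close> the second-order remainder of the chord equals giant times
  t - gel x, and \<open>chord_bounds\<close> puts it between giant^2 / (2 b) and giant^2 / (2 a).
  Division by the giant yields growth at twice the rate.\<close>

lemma giant_bounds:
  assumes ab: "0 < a" and range: "\<And>z. x \<le> z \<Longrightarrow> z \<le> burn t x \<Longrightarrow> a \<le> rate z \<and> rate z \<le> b"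
    and t: "gel x \<le> t"
  shows "2 * a * (t - gel x) \<le> giant x t" "giant x t \<le> 2 * b * (t - gel x)"
proof -
  have b: "0 < b" using range[of x] burn_ge[of x t] ab by auto
  let ?g = "giant x t"
  have eq: "(burn t x - x) - gel x * (G x - G (burn t x)) = ?g * (t - gel x)"
    using giant_chord[of t x] by (simp add: giant_def algebra_simps)
  have le: "?g * (t - gel x) \<le> ?g\<^sup>2 / (2 * a)" "?g\<^sup>2 / (2 * b) \<le> ?g * (t - gel x)"
    using chord_bounds(1)[OF burn_ge ab, of x t] chord_bounds(2)[OF burn_ge b, of x t] range
    unfolding eq by (auto simp: giant_def)
  have "2 * a * (t - gel x) \<le> ?g \<and> ?g \<le> 2 * b * (t - gel x)"
  proof (cases "t = gel x")
    case False
    then have "x < burn t x" using burn_greater[of x t] t by auto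
    then have "0 < ?g" by (simp add: giant_def G_less_iff)
    moreover have "2 * a * (t - gel x) * ?g \<le> ?g * ?g" "?g * ?g \<le> 2 * b * (t - gel x) * ?g"
      using le ab b by (simp_all add: power2_eq_square field_simps)
    ultimately show ?thesis by (simp only: mult_le_cancel_right_pos)
  qed (simp add: giant_zero)
  then show "2 * a * (t - gel x) \<le> giant x t" "giant x t \<le> 2 * b * (t - gel x)" by auto
qed

lemma linear_integral:
  assumes "s \<le> (t::real)"
  shows "integrable lborel (\<lambda>r. indicator {s..t} r *\<^sub>R (c * (r - s)))"
    "(LINT r|lborel. indicator {s..t} r *\<^sub>R (c * (r - s))) = c * (t - s)\<^sup>2 / 2"
proof -
  have "has_bochner_integral lborel (\<lambda>r. (c * (r - s)) * indicator {s..t} r) (c * (t - s)\<^sup>2 / 2 - c * (s - s)\<^sup>2 / 2)"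
    by (rule has_bochner_integral_FTC_Icc_real[where F="\<lambda>r. c * (r - s)\<^sup>2 / 2"]) (use assms in \<open>auto intro!: derivative_eq_intros\<close>)
  then have "has_bochner_integral lborel (\<lambda>r. indicator {s..t} r *\<^sub>R (c * (r - s))) (c * (t - s)\<^sup>2 / 2)"
    by (simp add: mult.commute)
  then show "integrable lborel (\<lambda>r. indicator {s..t} r *\<^sub>R (c * (r - s)))"
    "(LINT r|lborel. indicator {s..t} r *\<^sub>R (c * (r - s))) = c * (t - s)\<^sup>2 / 2"
    by (auto simp: has_bochner_integral_iff)
qed

lemma haz_from_gel:
  assumes "gel x \<le> t"
  shows "haz x t = (LINT r|lborel. indicator {gel x..t} r *\<^sub>R giant x r)"
  using haz_split[of "gel x" t x] haz_zero[of "gel x" x] gel_pos[of x] assms by simp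

text \<open>Integrating the linear upper bound of the giant gives b (t - gel x)^2, and t - gel x is
  at most giant / (2 a). For a nearly constant rate the hazard is thus about giant^2 / (4
  rate).\<close>

lemma haz_upper:
  assumes ab: "0 < a" and range: "\<And>z. x \<le> z \<Longrightarrow> z \<le> burn t x \<Longrightarrow> a \<le> rate z \<and> rate z \<le> b"
  shows "haz x t \<le> b * (giant x t)\<^sup>2 / (4 * a\<^sup>2)"
proof (cases "gel x \<le> t")
  case t: True
  have b: "0 < b" using range[of x] burn_ge[of x t] ab by auto
  have "haz x t \<le> (LINT r|lborel. indicator {gel x..t} r *\<^sub>R (2 * b * (r - gel x)))"
    unfolding haz_from_gel[OF t]
  proof (rule integral_mono[OF giant_integrable linear_integral(1)[OF t]])
    fix r
    show "indicator {gel x..t} r *\<^sub>R giant x r \<le> indicator {gel x..t} r *\<^sub>R (2 * b * (r - gel x))"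
      using giant_bounds(2)[OF ab, of x r b] range burn_mono[of r t x] by (auto simp: indicator_def intro: order_trans)
  qed
  also have "\<dots> = b * (t - gel x)\<^sup>2" unfolding linear_integral(2)[OF t] by simp
  also have "\<dots> \<le> b * (giant x t / (2 * a))\<^sup>2"
    using giant_bounds(1)[OF ab range t] ab t b by (intro mult_left_mono power_mono) (auto simp: field_simps)
  finally show ?thesis by (simp add: power_divide power_mult_distrib)
next
  case False
  then show ?thesis by (simp add: haz_zero giant_zero)
qed

text \<open>The rate is controlled only up to y, which may fall short of \<open>burn t x\<close>.
  The hazard is therefore followed only until the time r at which the chord from x ends in
  y.\<close>

lemma haz_lower:
  assumes ab: "0 < a" and range: "\<And>z. x \<le> z \<Longrightarrow> z \<le> y \<Longrightarrow> a \<le> rate z \<and> rate z \<le> b"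
    and xy: "x \<le> y" "y \<le> burn t x"
  shows "a * (G x - G y)\<^sup>2 / (4 * b\<^sup>2) \<le> haz x t"
proof (cases "x = y")
  case True
  then show ?thesis by (simp add: haz_nonneg)
next
  case False
  then have lt: "x < y" using xy by simp
  have b: "0 < b" using range[of x] xy ab by auto
  define D where "D = G x - G y"
  have D: "0 < D" using G_strict[OF lt] by (simp add: D_def)
  define r where "r = (y - x) / D"
  have rD: "r * D = y - x" using D by (simp add: r_def)
  have low: "D\<^sup>2 / (2 * b) \<le> (y - x) - gel x * D"
    using chord_bounds(2)[OF xy(1) b] range by (simp add: D_def)
  have "D * (D / (2 * b)) \<le> D * (r - gel x)"
    using low rD by (simp add: power2_eq_square algebra_simps)
  then have rg: "D / (2 * b) \<le> r - gel x" using D mult_le_cancel_left_pos by blast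
  have "0 < D / (2 * b)" using D b by simp
  then have gr: "gel x \<le> r" using rg by linarith
  have Kr: "K r y = K r x" using rD by (simp add: K_def D_def algebra_simps)
  have ygel: "r \<le> gel y"
  proof (rule ccontr)
    assume "\<not> r \<le> gel y"
    then have "K r y < K r x" using lt by (intro K_strict_dec) auto
    then show False using Kr by simp
  qed
  have cr: "burn r x = y" by (rule burn_eqI[OF xy(1) ygel Kr])
  have rt: "r \<le> t"
  proof (rule ccontr)
    assume "\<not> r \<le> t"
    then have tr: "t < r" by simp
    have "burn t x = y" using burn_mono[of t r x] tr cr xy(2) by simp
    then have "t * D = y - x" using giant_chord[of t x] by (simp add: giant_def D_def)
    then show False using rD tr D by (metis less_irrefl mult_strict_right_mono)
  qed
  have "a * D\<^sup>2 / (4 * b\<^sup>2) = a * (D / (2 * b))\<^sup>2"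
    by (simp add: power_divide power_mult_distrib)
  also have "\<dots> \<le> a * (r - gel x)\<^sup>2"
    using rg D b ab by (intro mult_left_mono power_mono) auto
  also have "\<dots> = (LINT r'|lborel. indicator {gel x..r} r' *\<^sub>R (2 * a * (r' - gel x)))"
    unfolding linear_integral(2)[OF gr] by simp
  also have "\<dots> \<le> haz x r"
    unfolding haz_from_gel[OF gr]
  proof (rule integral_mono[OF linear_integral(1)[OF gr] giant_integrable])
    fix r'
    show "indicator {gel x..r} r' *\<^sub>R (2 * a * (r' - gel x)) \<le> indicator {gel x..r} r' *\<^sub>R giant x r'"
      using giant_bounds(1)[OF ab, of x r' b] range burn_mono[of r' r x] cr by (auto simp: indicator_def intro: order_trans)
  qed
  also have "\<dots> \<le> haz x t" by (rule haz_mono[OF rt])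
  finally show ?thesis by (simp add: D_def)
qed

end

section \<open>Alternating and critical equations\<close>

text \<open>A function of the burning times alone, which later makes the masses after the burnings
  measurable with respect to them. The initial state 0 has as its mass the total initial
  mass.\<close>

primrec (in mass_profile) state :: "(nat \<Rightarrow> real) \<Rightarrow> nat \<Rightarrow> real" where
  "state b 0 = 0"
| "state b (Suc j) = burn (b (Suc j)) (state b j)"

lemma (in mass_profile) state_mono: "i \<le> j \<Longrightarrow> state b i \<le> state b j"
  by (rule lift_Suc_mono_le[of "state b"]) (auto simp: burn_ge)

locale finite_data =
  fixes v0 :: "nat \<Rightarrow> real" and m :: nat
  assumes v0_nonneg: "1 \<le> k \<Longrightarrow> 0 \<le> v0 k"
    and v0_supp: "m < k \<Longrightarrow> v0 k = 0"
    and v0_nonzero: "\<exists>k\<ge>1. 0 < v0 k"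
begin

lemma weighted_sum_pos:
  assumes "\<And>k. 1 \<le> k \<Longrightarrow> 0 < c k"
  shows "0 < (\<Sum>k=1..m. c k * v0 k * exp (- (real k * x)))"
proof -
  obtain k where k: "1 \<le> k" "0 < v0 k" using v0_nonzero by auto
  then have "k \<le> m" using v0_supp[of k] by (cases "k \<le> m") auto
  then show ?thesis
    using k assms by (intro sum_pos2[of _ k]) (auto intro!: mult_pos_pos mult_nonneg_nonneg v0_nonneg less_imp_le[OF assms])
qed

sublocale mass_profile "gf v0 m" "gf1 v0 m" "gf2 v0 m"
proof
  fix x
  show "0 < gf v0 m x" using weighted_sum_pos[of "\<lambda>_. 1" x] by (simp add: gf_def)
  show "0 < gf1 v0 m x" using weighted_sum_pos[of "\<lambda>k. real k" x] by (simp add: gf1_def)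
  show "0 < gf2 v0 m x" using weighted_sum_pos[of "\<lambda>k. (real k)\<^sup>2" x] by (simp add: gf2_def)
  show "continuous_on UNIV (gf2 v0 m)" by (rule continuous_on_gf2)
  have "((\<lambda>x. real k * v0 k * exp (- (real k * x))) \<longlongrightarrow> 0) at_top" if "1 \<le> k" for k
  proof -
    have "((\<lambda>x. real k * v0 k * exp (- (real k * x))) \<longlongrightarrow> real k * v0 k * 0) at_top"
      using that by (intro tendsto_intros filterlim_compose[OF exp_at_bot] filterlim_compose[OF filterlim_uminus_at_bot_at_top]
          filterlim_tendsto_pos_mult_at_top[OF tendsto_const] filterlim_ident) auto
    then show ?thesis by simp
  qed
  then have "((\<lambda>x. \<Sum>k=1..m. real k * v0 k * exp (- (real k * x))) \<longlongrightarrow> (\<Sum>k=1..m. 0)) at_top"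
    by (intro tendsto_sum) auto
  then show "(gf1 v0 m \<longlongrightarrow> 0) at_top" by (simp add: gf1_def[abs_def])
qed (rule DERIV_gf DERIV_gf1)+

lemma suminf_v0:
  "(\<lambda>k. c (Suc k) * v0 (Suc k)) sums (\<Sum>k=1..m. c k * v0 k)"
proof -
  have "(\<lambda>k. c (Suc k) * v0 (Suc k)) sums (\<Sum>k<m. c (Suc k) * v0 (Suc k))"
    by (rule sums_finite) (auto simp: v0_supp)
  also have "(\<Sum>k<m. c (Suc k) * v0 (Suc k)) = (\<Sum>k=1..m. c k * v0 k)"
    by (rule sum.reindex_bij_witness[of _ "\<lambda>k. k - 1" Suc]) auto
  finally show ?thesis .
qed

lemma m0_v0: "m0 v0 = gf v0 m 0"
  using sums_unique[OF suminf_v0[of "\<lambda>_. 1"]] by (simp add: m0_def gf_def)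

lemma m1_v0: "m1 v0 = gf1 v0 m 0"
  using sums_unique[OF suminf_v0[of real]] by (simp add: m1_def gf1_def)

lemma m0_initial: "(\<And>k. 1 \<le> k \<Longrightarrow> w k = v0 k) \<Longrightarrow> m0 w = gf v0 m 0"
  using m0_v0 by (simp add: m0_def)

end

section \<open>Burning times and their counting function\<close>

lemma burning_timesD:
  assumes "burning_times b"
  shows "b 0 = 0" "strict_mono b" "i < j \<Longrightarrow> b i < b j" "i \<le> j \<Longrightarrow> b i \<le> b j" "0 \<le> b i"
proof -
  show b: "b 0 = 0" "strict_mono b" using assms unfolding burning_times_def by blast+
  show "i < j \<Longrightarrow> b i < b j" by (rule strict_monoD[OF b(2)])
  show "i \<le> j \<Longrightarrow> b i \<le> b j" by (rule monoD[OF strict_mono_mono[OF b(2)]])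
  show "0 \<le> b i" using monoD[OF strict_mono_mono[OF b(2)], of 0 i] b(1) by simp
qed

lemma burning_interval:
  assumes b: "burning_times b" and t: "0 < t"
  obtains j where "b j < t" "t \<le> b (Suc j)"
proof -
  have "filterlim b at_top sequentially" using b by (simp add: burning_times_def)
  then have "eventually (\<lambda>n. t \<le> b n) sequentially" by (simp add: filterlim_at_top)
  then obtain n where n: "t \<le> b n" by (auto simp: eventually_sequentially)
  define l where "l = (LEAST n. t \<le> b n)"
  have l: "t \<le> b l" unfolding l_def by (rule LeastI[of _ n]) (rule n)
  have "l \<noteq> 0" using l t burning_timesD(1)[OF b] by (cases "l = 0") auto
  then obtain j where j: "l = Suc j" by (cases l) auto
  have "b j < t" using not_less_Least[of j "\<lambda>n. t \<le> b n"] j by (auto simp: l_def)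
  then show ?thesis using that l j by auto
qed

lemma Mc_eqI:
  assumes b: "burning_times b" and t: "b j < t" "t \<le> b (Suc j)"
  shows "Mc b t = j"
proof -
  have "{i. 1 \<le> i \<and> b i < t} = {1..j}"
  proof (intro set_eqI iffI)
    fix i assume i: "i \<in> {i. 1 \<le> i \<and> b i < t}"
    have "i \<le> j"
    proof (rule ccontr)
      assume "\<not> i \<le> j"
      then have "b (Suc j) \<le> b i" by (intro burning_timesD(4)[OF b]) auto
      then show False using i t by auto
    qed
    then show "i \<in> {1..j}" using i by auto
  next
    fix i assume "i \<in> {1..j}"
    then show "i \<in> {i. 1 \<le> i \<and> b i < t}" using t burning_timesD(4)[OF b, of i j] by auto
  qed
  then show ?thesis by (simp add: Mc_def)
qed

lemma Mc_bounds:
  assumes b: "burning_times b" and t: "0 < t"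
  shows "b (Mc b t) < t" "t \<le> b (Suc (Mc b t))"
proof -
  obtain j where "b j < t" "t \<le> b (Suc j)" by (rule burning_interval[OF b t])
  then show "b (Mc b t) < t" "t \<le> b (Suc (Mc b t))" by (simp_all add: Mc_eqI[OF b])
qed

lemma Mc_0: "burning_times b \<Longrightarrow> t \<le> 0 \<Longrightarrow> Mc b t = 0"
proof -
  assume b: "burning_times b" and t: "t \<le> 0"
  have "\<not> b i < t" for i using burning_timesD(5)[OF b, of i] t by linarith
  then have "{i. 1 \<le> i \<and> b i < t} = {}" by blast
  then show "Mc b t = 0" by (simp only: Mc_def card.empty)
qed

text \<open>The inequality on the right is strict because M is left-continuous: a burning at time t
  is not yet counted at t.\<close>

lemma Mc_ge_iff:
  assumes b: "burning_times b" and j: "1 \<le> j"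
  shows "j \<le> Mc b t \<longleftrightarrow> b j < t"
proof (cases "0 < t")
  case True
  note B = Mc_bounds[OF b True]
  show ?thesis
  proof
    assume "j \<le> Mc b t" then show "b j < t" using B burning_timesD(4)[OF b, of j "Mc b t"] by linarith
  next
    assume t: "b j < t"
    show "j \<le> Mc b t"
    proof (rule ccontr)
      assume "\<not> j \<le> Mc b t"
      then have "b (Suc (Mc b t)) \<le> b j" by (intro burning_timesD(4)[OF b]) auto
      then show False using B t by linarith
    qed
  qed
next
  case False
  then show ?thesis using Mc_0[OF b, of t] burning_timesD(5)[OF b, of j] j by auto
qed

lemma DERIV_min_left:
  "s \<noteq> (c::real) \<Longrightarrow> ((\<lambda>s. min s c) has_real_derivative (if s < c then 1 else 0)) (at s)"
proof (cases "s < c")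
  case True
  have "((\<lambda>s. min s c) has_real_derivative 1) (at s)"
    by (rule has_field_derivative_transform_within_open[of "\<lambda>s. s" _ _ "{..<c}", OF DERIV_ident])
       (use True in \<open>auto simp: min_def\<close>)
  then show ?thesis using True by simp
next
  case False
  assume "s \<noteq> c"
  then have "((\<lambda>s. min s c) has_real_derivative 0) (at s)"
    by (intro has_field_derivative_transform_within_open[of "\<lambda>s. c" _ _ "{c<..}", OF DERIV_const])
       (use False in \<open>auto simp: min_def\<close>)
  then show ?thesis using False by simp
qed

section \<open>Masses of alternating and critical solutions\<close>

context finite_data
begin

text \<open>When A n t = K t x and t is at most \<open>gel x\<close>, the exponent in
  \<open>mass_on_characteristic\<close> vanishes and the mass is G x. During a cycle A grows with
  slope G of the current state, so it stays equal to K t of that state; \<open>burn\<close> passes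
  to the point with the same value of K that is admissible at time t.\<close>

lemma alt_sol_states:
  assumes alt: "alt_sol v0 b w"
  shows "m0 (w (b j)) = gf v0 m (state b j) \<and> b j \<le> gel (state b j)"
    and "\<And>t. b j \<le> t \<Longrightarrow> t \<le> b (Suc j) \<Longrightarrow> m0 (w t) = gf v0 m (burn t (state b j))"
proof -
  have b: "burning_times b" and w0: "\<And>k. 1 \<le> k \<Longrightarrow> w 0 k = v0 k" 
    and N: "\<And>t. 0 \<le> t \<Longrightarrow> in_N (w t)"
    and wc: "\<And>k. 1 \<le> k \<Longrightarrow> continuous_on {0..} (\<lambda>t. w t k)"
    and dw: "\<And>k t. 1 \<le> k \<Longrightarrow> 0 < t \<Longrightarrow> t \<notin> range b \<Longrightarrow>
        ((\<lambda>s. w s k) has_real_derivative (coag (w t) k - real k * w t k * m0 (w (b (Mc b t))))) (at t)"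
    using alt by (auto simp: alt_sol_def)
  define \<mu> where "\<mu> i = m0 (w (b i))" for i
  \<comment> \<open>The integral of the loss rate, written as a sum over the first n cycles; it is
    used only at times up to \<open>b n\<close>, where no later cycle contributes.\<close>
  define A where "A n t = (\<Sum>i<n. \<mu> i * (min t (b (Suc i)) - min t (b i)))" for n t
  have A0: "A n 0 = 0" for n using burning_timesD(5)[OF b] by (simp add: A_def min_absorb1)
  have A_cont: "continuous_on S (A n)" for n S unfolding A_def by (intro continuous_intros)
  have dA: "(A n has_real_derivative \<mu> (Mc b t)) (at t)" if t: "0 < t" "t < b n" "t \<notin> b ` {..n}" for n t
  proof -
    let ?j = "Mc b t"
    note B = Mc_bounds[OF b t(1)]
    have j: "?j < n"
    proof (rule ccontr)
      assume "\<not> ?j < n" then have "b n \<le> b ?j" by (intro burning_timesD(4)[OF b]) auto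
      then show False using B t by linarith
    qed
    then have B2: "t < b (Suc ?j)" using B t(3) by (cases "t = b (Suc ?j)") auto
    have "(A n has_real_derivative (\<Sum>i<n. \<mu> i * ((if t < b (Suc i) then 1 else 0) - (if t < b i then 1 else 0)))) (at t)"
      unfolding A_def
    proof (intro DERIV_sum DERIV_cmult DERIV_diff DERIV_min_left)
      fix i assume "i \<in> {..<n}"
      then show "t \<noteq> b (Suc i)" "t \<noteq> b i" using t(3) by auto
    qed
    also have "(\<Sum>i<n. \<mu> i * ((if t < b (Suc i) then 1 else 0) - (if t < b i then 1 else 0))) = (\<Sum>i<n. if i = ?j then \<mu> i else 0)"
    proof (rule sum.cong)
      fix i
      consider "i < ?j" | "i = ?j" | "?j < i" by linarith
      then show "\<mu> i * ((if t < b (Suc i) then 1 else 0) - (if t < b i then 1 else 0)) = (if i = ?j then \<mu> i else 0)"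
      proof cases
        case 1 then show ?thesis using burning_timesD(4)[OF b, of "Suc i" ?j] burning_timesD(4)[OF b, of i ?j] B by auto
      next
        case 2 then show ?thesis using B B2 by auto
      next
        case 3 then show ?thesis using burning_timesD(4)[OF b, of "Suc ?j" i] burning_timesD(3)[OF b, of i "Suc i"] B2 by auto
      qed
    qed simp
    also have "\<dots> = \<mu> ?j" using j by simp
    finally show ?thesis .
  qed
  have A_step: "A n t = A n (b j) + \<mu> j * (t - b j)" if "j < n" "b j \<le> t" "t \<le> b (Suc j)" for n j t
  proof -
    have "A n t - A n (b j) = (\<Sum>i<n. \<mu> i * ((min t (b (Suc i)) - min t (b i)) - (min (b j) (b (Suc i)) - min (b j) (b i))))"
      unfolding A_def by (simp add: sum_subtractf[symmetric] right_diff_distrib)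
    also have "\<dots> = (\<Sum>i<n. if i = j then \<mu> i * (t - b j) else 0)"
    proof (rule sum.cong)
      fix i
      consider "i < j" | "i = j" | "j < i" by linarith
      then show "\<mu> i * ((min t (b (Suc i)) - min t (b i)) - (min (b j) (b (Suc i)) - min (b j) (b i))) = (if i = j then \<mu> i * (t - b j) else 0)"
      proof cases
        case 1 then show ?thesis using burning_timesD(4)[OF b, of "Suc i" j] burning_timesD(4)[OF b, of i j] that by (auto simp: min_def)
      next
        case 2 then show ?thesis using burning_timesD(3)[OF b, of j "Suc j"] that by (auto simp: min_def)
      next
        case 3 then show ?thesis using burning_timesD(4)[OF b, of "Suc j" i] burning_timesD(3)[OF b, of i "Suc i"]
           burning_timesD(3)[OF b, of j "Suc j"] that by (auto simp: min_def)
      qed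
    qed simp
    also have "\<dots> = \<mu> j * (t - b j)" using that(1) by simp
    finally show ?thesis by simp
  qed
  have mass: "m0 (w t) = gf v0 m x" if t: "0 \<le> t" "t \<le> b n" and x: "t \<le> gel x" and A: "A n t = K t x" for n t x
  proof -
    have "(\<lambda>k. w t (Suc k) * exp (real (Suc k) * (A n t - (x + t * gf v0 m x)))) sums gf v0 m x"
    proof (rule mass_on_characteristic[OF t(1), of "b ` {..n}"])
      show "continuous_on {0..t} (\<lambda>t. w t k)" if "1 \<le> k" for k
        by (rule continuous_on_subset[OF wc[OF that]]) auto
      show "(A n has_real_derivative \<mu> (Mc b s)) (at s)" if "s \<in> {0<..<t} - b ` {..n}" for s
        using that t by (intro dA) auto
      show "((\<lambda>s. w s k) has_real_derivative coag (w s) k - real k * w s k * \<mu> (Mc b s)) (at s)" 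
        if k: "1 \<le> k" and s: "s \<in> {0<..<t} - b ` {..n}" for k s
        unfolding \<mu>_def
      proof (rule dw[OF k])
        show "s \<notin> range b"
        proof
          assume "s \<in> range b"
          then obtain i where i: "s = b i" by auto
          then have "b i < b n" using s t by auto
          then have "i < n" using strict_mono_less[OF burning_timesD(2)[OF b]] by simp
          then show False using s i by auto
        qed
      qed (use s in auto)
      show "0 \<le> w s k" if "1 \<le> k" "0 \<le> s" for k s using N[OF that(2)] that(1) by (simp add: in_N_def)
      show "t * gf1 v0 m x \<le> 1" using x by (simp add: M1_gel)
    qed (fact w0 v0_supp A_cont A0 M1_pos M1_strict | assumption | simp)+
    then show ?thesis using A by (simp add: K_def m0_def sums_iff)
  qed
  have inv: "A n (b j) = K (b j) (state b j) \<and> b j \<le> gel (state b j) \<and> \<mu> j = gf v0 m (state b j)" if "j \<le> n" for n j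
    using that
  proof (induction j)
    case 0
    show ?case using burning_timesD(1)[OF b] A0 gel_pos[of 0] m0_initial[OF w0] by (simp add: K_def \<mu>_def less_imp_le)
  next
    case (Suc j)
    have IH: "A n (b j) = K (b j) (state b j)" "\<mu> j = gf v0 m (state b j)" using Suc by auto
    have 1: "A n (b (Suc j)) = K (b (Suc j)) (state b j)"
      using A_step[of j n "b (Suc j)"] Suc.prems IH burning_timesD(4)[OF b, of j "Suc j"] by (simp add: K_def algebra_simps)
    then have 2: "A n (b (Suc j)) = K (b (Suc j)) (state b (Suc j))" by (simp add: burn_K)
    have 3: "b (Suc j) \<le> gel (state b (Suc j))" by (simp add: burn_gel)
    show ?case using 2 3 mass[OF _ _ 3 2] burning_timesD(4,5)[OF b] Suc.prems by (simp add: \<mu>_def)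
  qed
  show "m0 (w (b j)) = gf v0 m (state b j) \<and> b j \<le> gel (state b j)"
    using inv[of j j] by (simp add: \<mu>_def)
  fix t assume t: "b j \<le> t" "t \<le> b (Suc j)"
  have "A (Suc j) t = K t (state b j)"
    using A_step[of j "Suc j" t] t inv[of j "Suc j"] by (simp add: K_def algebra_simps)
  then have "A (Suc j) t = K t (burn t (state b j))" by (simp add: burn_K)
  then show "m0 (w t) = gf v0 m (burn t (state b j))"
    using t burning_timesD(5)[OF b, of j] by (intro mass[of t "Suc j"] burn_gel) auto
qed

lemma theta_eq_giant:
  assumes alt: "alt_sol v0 b w" and t: "0 < t"
  shows "theta b w t = giant (state b (Mc b t)) t"
proof -
  have b: "burning_times b" using alt by (simp add: alt_sol_def)
  show ?thesis
    using Mc_bounds[OF b t] alt_sol_states[OF alt, of "Mc b t"] by (simp add: theta_def giant_def)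
qed

text \<open>\<open>mass_conserved\<close> applies with a = 1 / gel 0, the initial first moment. The
  monotonicity of the lost mass supplies the bound of the loss rate by the initial mass.\<close>

lemma crit_sol_before_gel:
  assumes crit: "crit_sol v0 u" and T: "0 \<le> T" "T < gel 0"
  shows "m0 (u T) = gf v0 m 0"
proof -
  have u0: "\<And>k. 1 \<le> k \<Longrightarrow> u 0 k = v0 k" and N: "\<And>t. 0 \<le> t \<Longrightarrow> in_N (u t)"
    and int: "\<And>k t. 1 \<le> k \<Longrightarrow> 0 \<le> t \<Longrightarrow> ((\<lambda>s. coag (u s) k - real k * u s k * m0 (u s)) has_integral (u t k - v0 k)) {0..t}"
    and mono: "mono_on {0..} (\<lambda>t. m0 (u 0) - m0 (u t))"
    using crit by (auto simp: crit_sol_def)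
  have "(\<lambda>k. u T (Suc k)) sums gf v0 m 0"
  proof (rule mass_conserved[where q=u and \<mu>="\<lambda>s. m0 (u s)" and m=m and a="gf1 v0 m 0"])
    show "psum (u t) n \<le> m0 (u t)" if "t \<in> {0..T}" for n t
    proof -
      have "psum (u t) n = (\<Sum>k<n. u t (Suc k))"
        unfolding psum_def by (rule sum.reindex_bij_witness[of _ Suc "\<lambda>k. k - 1"]) auto
      also have "\<dots> \<le> m0 (u t)" unfolding m0_def
        using N[of t] that by (intro sum_le_suminf) (auto simp: in_N_def)
      finally show ?thesis .
    qed
    show "m0 (u t) \<le> gf v0 m 0" if "t \<in> {0..T}" for t
      using mono_onD[OF mono, of 0 t] that m0_initial[OF u0] by auto
    show "psum (u 0) m = gf v0 m 0" by (auto simp: psum_def gf_def u0)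
    show "pmom (u 0) m \<le> gf1 v0 m 0" by (auto simp: pmom_def gf1_def u0)
    show "T * gf1 v0 m 0 < 1" using T(2) M1_pos[of 0] by (simp add: gel_def field_simps)
    show "u 0 k = 0" if "m < k" for k using that u0[of k] v0_supp[of k] by auto
    show "0 \<le> u s k" if "1 \<le> k" "s \<in> {0..T}" for k s using N[of s] that by (simp add: in_N_def)
    show "((\<lambda>s. coag (u s) k - real k * u s k * m0 (u s)) has_integral u t k - u 0 k) {0..t}" 
      if "1 \<le> k" "t \<in> {0..T}" for k t
      using int[of k t] that u0[OF that(1)] by simp
  qed (use T M1_pos in auto)
  then show ?thesis by (simp add: m0_def sums_iff)
qed

text \<open>At time \<open>gel x\<close> the series of \<open>mass_on_characteristic\<close> carries
  the weights exp (k D x). A nonpositive D makes the mass at least G x, a nonnegative one at most G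
  x. Since D' is a positive multiple of mass minus G, D is pushed back to its initial value 0, so
  all weights are 1. Differentiating the mass then identifies \<phi>.\<close>

lemma crit_sol_mass_and_rate:
  assumes crit: "crit_sol v0 u"
    and phi_cont: "continuous_on {gel 0..} \<phi>"
    and phi_int: "\<And>s. gel 0 \<le> s \<Longrightarrow> m0 (u 0) - m0 (u s) = integral {gel 0..s} \<phi>"
    and x: "0 \<le> x"
  shows "m0 (u (gel x)) = gf v0 m x" "\<phi> (gel x) = rate x"
proof -
  have u0: "\<And>k. 1 \<le> k \<Longrightarrow> u 0 k = v0 k" and N: "\<And>t. 0 \<le> t \<Longrightarrow> in_N (u t)"
    and int: "\<And>k t. 1 \<le> k \<Longrightarrow> 0 \<le> t \<Longrightarrow> ((\<lambda>s. coag (u s) k - real k * u s k * m0 (u s)) has_integral (u t k - v0 k)) {0..t}"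
    using crit by (auto simp: crit_sol_def)
  define \<mu> where "\<mu> s = m0 (u s)" for s
  have mu0: "m0 (u 0) = gf v0 m 0" by (rule m0_initial[OF u0])
  have mu_before: "\<mu> s = gf v0 m 0" if "0 \<le> s" "s \<le> gel 0" for s
    using crit_sol_before_gel[OF crit, of s] phi_int[of s] that mu0 by (cases "s = gel 0") (auto simp: \<mu>_def)
  \<comment> \<open>The maximum joins the conservative phase before \<open>gel 0\<close> and the
    integral formula after it into one expression, whose continuity is immediate.\<close>
  have mu_eq: "\<mu> s = gf v0 m 0 - integral {gel 0..max s (gel 0)} \<phi>" if "0 \<le> s" for s
    using mu_before[of s] phi_int[of s] that mu0 by (cases "s \<le> gel 0") (auto simp: \<mu>_def max_def)
  have Ic: "continuous_on {gel 0..R} (\<lambda>s. integral {gel 0..s} \<phi>)" for R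
    by (intro indefinite_integral_continuous_1 integrable_continuous_real continuous_on_subset[OF phi_cont]) auto
  have mu_cont: "continuous_on {0..R} \<mu>" for R
  proof -
    have "continuous_on {0..R} (\<lambda>s. gf v0 m 0 - integral {gel 0..max s (gel 0)} \<phi>)"
      by (intro continuous_intros continuous_on_compose2[OF Ic[of "max R (gel 0)"]]) auto
    then show ?thesis by (rule continuous_on_eq) (auto simp: mu_eq)
  qed
  have uc: "continuous_on {0..R} (\<lambda>t. u t k)" if "1 \<le> k" "0 \<le> R" for k R
  proof -
    have "continuous_on {0..R} (\<lambda>t. v0 k + integral {0..t} (\<lambda>s. coag (u s) k - real k * u s k * m0 (u s)))"
      using int[OF that] by (intro continuous_intros indefinite_integral_continuous_1) (auto simp: integrable_on_def)
    then show ?thesis by (rule continuous_on_eq) (use integral_unique[OF int] that in auto)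
  qed
  have du: "((\<lambda>s. u s k) has_real_derivative coag (u t) k - real k * u t k * \<mu> t) (at t)" if k: "1 \<le> k" and t: "0 < t" for k t
  proof -
    have cc: "continuous_on {0..t+1} (\<lambda>s. coag (u s) k - real k * u s k * m0 (u s))"
      unfolding coag_def using mu_cont[of "t+1"] t k by (intro continuous_intros uc) (auto simp: \<mu>_def[abs_def])
    have "((\<lambda>t. integral {0..t} (\<lambda>s. coag (u s) k - real k * u s k * m0 (u s))) has_real_derivative 
        coag (u t) k - real k * u t k * \<mu> t) (at t within {0..t+1})"
      unfolding \<mu>_def using t by (intro integral_has_real_derivative[OF cc]) auto
    then have "((\<lambda>t. integral {0..t} (\<lambda>s. coag (u s) k - real k * u s k * m0 (u s))) has_real_derivative 
        coag (u t) k - real k * u t k * \<mu> t) (at t)"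
      using at_within_Icc_at[of 0 t "t+1"] t by simp
    from DERIV_add[OF DERIV_const[of "v0 k"] this]
    have "((\<lambda>t. v0 k + integral {0..t} (\<lambda>s. coag (u s) k - real k * u s k * m0 (u s))) has_real_derivative 
        coag (u t) k - real k * u t k * \<mu> t) (at t)" by simp
    then show ?thesis
      by (rule has_field_derivative_transform_within_open[of _ _ _ "{0<..}"]) (use t integral_unique[OF int[OF k]] in auto)
  qed
  define A where "A t = integral {0..t} \<mu>" for t
  have A_cont: "continuous_on {0..R} A" for R
    unfolding A_def by (intro indefinite_integral_continuous_1 integrable_continuous_real mu_cont)
  have dA: "(A has_real_derivative \<mu> t) (at t)" if t: "0 < t" for t
  proof -
    have "(A has_real_derivative \<mu> t) (at t within {0..t+1})"
      unfolding A_def[abs_def] using t by (intro integral_has_real_derivative[OF mu_cont]) auto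
    then show ?thesis using at_within_Icc_at[of 0 t "t+1"] t by simp
  qed
  define D where "D x = A (gel x) - K (gel x) x" for x
  have sums: "(\<lambda>k. u (gel x) (Suc k) * exp (real (Suc k) * D x)) sums gf v0 m x" for x
  proof -
    have nn: "\<And>k s. 1 \<le> k \<Longrightarrow> 0 \<le> s \<Longrightarrow> 0 \<le> u s k"
      using N by (simp add: in_N_def)
    have c: "continuous_on {0..gel x} (\<lambda>t. u t k)" if "1 \<le> k" for k
      using that gel_pos[of x] by (intro uc) auto
    have dA': "(A has_real_derivative \<mu> t) (at t)" if "t \<in> {0<..<gel x} - {}" for t
      using that by (intro dA) simp
    have du': "((\<lambda>s. u s k) has_real_derivative coag (u t) k - real k * u t k * \<mu> t) (at t)"
      if "1 \<le> k" "t \<in> {0<..<gel x} - {}" for k t using that by (intro du) simp_all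
    have A0: "A 0 = 0" by (simp add: A_def)
    have g: "gel x * gf1 v0 m x \<le> 1" by (simp add: M1_gel)
    show ?thesis
      unfolding D_def K_def
      by (rule mass_on_characteristic[where F="{}" and w=u and A=A and T="gel x" and \<mu>=\<mu> and v=v0 and m=m,
        OF less_imp_le[OF gel_pos] finite.emptyI u0 v0_supp nn c A_cont A0 dA' du' M1_pos M1_strict g])
  qed
  have Ngel: "in_N (u (gel x))" for x by (rule N[OF less_imp_le[OF gel_pos]])
  have summ: "summable (\<lambda>k. u (gel x) (Suc k))" for x
    using Ngel[of x] unfolding in_N_def by blast
  have upos: "0 \<le> u (gel x) (Suc k)" for x k
    using Ngel[of x] unfolding in_N_def by simp
  have le: "gf v0 m x \<le> \<mu> (gel x)" if D: "D x \<le> 0" for x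
  proof -
    have "u (gel x) (Suc k) * exp (real (Suc k) * D x) \<le> u (gel x) (Suc k)" for k
    proof (rule mult_right_le_one_le[OF upos])
      have "real (Suc k) * D x \<le> 0" using D by (intro mult_nonneg_nonpos) simp_all
      then show "exp (real (Suc k) * D x) \<le> 1" by simp
    qed simp
    from suminf_le[OF this sums_summable[OF sums] summ] show ?thesis
      unfolding \<mu>_def m0_def sums_unique[OF sums[of x]] .
  qed
  have ge: "\<mu> (gel x) \<le> gf v0 m x" if D: "0 \<le> D x" for x
  proof -
    have "u (gel x) (Suc k) * 1 \<le> u (gel x) (Suc k) * exp (real (Suc k) * D x)" for k
    proof (rule mult_left_mono[OF _ upos])
      have "0 \<le> real (Suc k) * D x" using D by (intro mult_nonneg_nonneg) simp_all
      then show "1 \<le> exp (real (Suc k) * D x)" by (simp only: one_le_exp_iff)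
    qed
    then have "u (gel x) (Suc k) \<le> u (gel x) (Suc k) * exp (real (Suc k) * D x)" for k
      by (simp only: mult_1_right)
    from suminf_le[OF this summ sums_summable[OF sums]] show ?thesis
      unfolding \<mu>_def m0_def sums_unique[OF sums[of x]] .
  qed
  have dD: "(D has_real_derivative M2' * (\<mu> (gel y) - gf v0 m y)) (at y)" if "M2' = gf2 v0 m y / (gf1 v0 m y)\<^sup>2" for y M2'
  proof -
    have gM: "gel y * gf1 v0 m y = 1" using M1_pos[of y] by (simp add: gel_def)
    have "((\<lambda>y. A (gel y)) has_real_derivative \<mu> (gel y) * M2') (at y)"
      unfolding that by (rule DERIV_chain2[OF dA[OF gel_pos] DERIV_gel])
    moreover have "((\<lambda>y. K (gel y) y) has_real_derivative 1 + (M2' * gf v0 m y + gel y * (- gf1 v0 m y))) (at y)"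
      unfolding K_def that by (auto intro!: derivative_eq_intros DERIV_gel DERIV_G simp: algebra_simps)
    ultimately have "(D has_real_derivative \<mu> (gel y) * M2' - (1 + (M2' * gf v0 m y + gel y * (- gf1 v0 m y)))) (at y)"
      unfolding D_def by (rule DERIV_diff)
    then show ?thesis using gM by (simp add: algebra_simps)
  qed
  have D0: "D 0 = 0"
  proof -
    have "A (gel 0) = integral {0..gel 0} (\<lambda>s. gf v0 m 0)"
      unfolding A_def by (rule integral_cong) (auto simp: mu_before)
    then show ?thesis using gel_pos[of 0] by (simp add: D_def K_def mult.commute)
  qed
  \<comment> \<open>D^2 serves as a Lyapunov function: its derivative is a nonnegative multiple of D
    (\<mu> - G), and these two factors never have the same sign.\<close>
  have Dx: "D y = 0" if y: "0 \<le> y" for y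
  proof -
    have "(D y)\<^sup>2 \<le> (D 0)\<^sup>2"
    proof (rule DERIV_nonpos_imp_nonincreasing[OF y, of "\<lambda>y. (D y)\<^sup>2"])
      fix s assume "0 \<le> s" "s \<le> y"
      define c where "c = gf2 v0 m s / (gf1 v0 m s)\<^sup>2"
      have c: "0 \<le> c" unfolding c_def by (intro divide_nonneg_nonneg less_imp_le[OF M2_pos]) simp
      have "D s * (\<mu> (gel s) - gf v0 m s) \<le> 0"
      proof (cases "D s \<le> 0")
        case True
        then show ?thesis using le[OF True] by (intro mult_nonpos_nonneg) simp_all
      next
        case False
        then have "0 \<le> D s" by simp
        then show ?thesis using ge by (intro mult_nonneg_nonpos) simp_all
      qed
      with c have "c * (D s * (\<mu> (gel s) - gf v0 m s)) \<le> 0"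
        by (rule mult_nonneg_nonpos)
      moreover have "((\<lambda>y. (D y)\<^sup>2) has_real_derivative 2 * (c * (D s * (\<mu> (gel s) - gf v0 m s)))) (at s)"
        by (auto intro!: derivative_eq_intros dD[OF c_def] simp: algebra_simps)
      ultimately show "\<exists>d. ((\<lambda>y. (D y)\<^sup>2) has_real_derivative d) (at s) \<and> d \<le> 0"
        by (intro exI[of _ "2 * (c * (D s * (\<mu> (gel s) - gf v0 m s)))"] conjI) auto
    qed
    then show ?thesis by (simp add: D0)
  qed
  have mass: "m0 (u (gel y)) = gf v0 m y" if "0 \<le> y" for y
    using le[of y] ge[of y] Dx[OF that] by (simp add: \<mu>_def)
  then show "m0 (u (gel x)) = gf v0 m x" using x by simp
  have rate_eq: "\<phi> (gel y) = rate y" if y: "0 < y" for y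
  proof -
    have g: "gel 0 < gel y" using gel_less_iff y by simp
    have "((\<lambda>s. integral {gel 0..s} \<phi>) has_real_derivative \<phi> (gel y)) (at (gel y) within {gel 0..gel y + 1})"
      using g by (intro integral_has_real_derivative continuous_on_subset[OF phi_cont]) auto
    then have "((\<lambda>s. integral {gel 0..s} \<phi>) has_real_derivative \<phi> (gel y)) (at (gel y))"
      using at_within_Icc_at[of "gel 0" "gel y" "gel y+1"] g by simp
    from DERIV_chain2[OF this DERIV_gel]
    have "((\<lambda>y. integral {gel 0..gel y} \<phi>) has_real_derivative \<phi> (gel y) * (gf2 v0 m y / (gf1 v0 m y)\<^sup>2)) (at y)" .
    moreover have "((\<lambda>y. integral {gel 0..gel y} \<phi>) has_real_derivative gf1 v0 m y) (at y)"
    proof (rule has_field_derivative_transform_within_open[of "\<lambda>y. gf v0 m 0 - gf v0 m y" _ _ "{0<..}"])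
      show "((\<lambda>y. gf v0 m 0 - gf v0 m y) has_real_derivative gf1 v0 m y) (at y)"
        by (auto intro!: derivative_eq_intros DERIV_G)
      fix z :: real assume "z \<in> {0<..}"
      then show "gf v0 m 0 - gf v0 m z = integral {gel 0..gel z} \<phi>"
        using phi_int[of "gel z"] mass[of z] gel_le_iff[of 0 z] mu0 by simp
    qed (use y in auto)
    ultimately have "\<phi> (gel y) * (gf2 v0 m y / (gf1 v0 m y)\<^sup>2) = gf1 v0 m y" by (rule DERIV_unique)
    then show ?thesis using M1_pos[of y] M2_pos[of y] by (simp add: rate_def field_simps power2_eq_square power3_eq_cube)
  qed
  show "\<phi> (gel x) = rate x"
  proof (cases "x = 0")
    \<comment> \<open>At x = 0 the mass is known in terms of \<phi> only on one side, so the
      identity is carried over from x > 0 by continuity.\<close>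
    case True
    have c1: "continuous_on {0..} (\<lambda>y. \<phi> (gel y))"
      by (rule continuous_on_compose2[OF phi_cont continuous_on_gel]) (auto simp: gel_le_iff)
    have "((\<lambda>y. \<phi> (gel y)) \<longlongrightarrow> \<phi> (gel 0)) (at 0 within {0..})" using c1 by (auto simp: continuous_on)
    then have l1: "((\<lambda>y. \<phi> (gel y)) \<longlongrightarrow> \<phi> (gel 0)) (at_right 0)" by (rule tendsto_within_subset) auto
    have "(rate \<longlongrightarrow> rate 0) (at 0 within {0..})" using continuous_on_rate[of "{0..}"] by (auto simp: continuous_on)
    then have "(rate \<longlongrightarrow> rate 0) (at_right 0)" by (rule tendsto_within_subset) auto
    moreover have "\<forall>\<^sub>F y in at_right 0. rate y = \<phi> (gel y)"
      by (rule eventually_at_rightI[of 0 1]) (auto simp: rate_eq)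
    ultimately have "((\<lambda>y. \<phi> (gel y)) \<longlongrightarrow> rate 0) (at_right 0)" by (rule Lim_transform_eventually)
    then show ?thesis using l1 tendsto_unique[of "at_right (0::real)"] True by auto
  qed (use rate_eq x in auto)
qed

end

section \<open>Hazard accumulated between burning times\<close>

text \<open>The integrated form of S' = - S. Continuity of S is drawn from the equation itself,
  after which S exp is constant.\<close>

lemma exponential_decay:
  fixes S :: "real \<Rightarrow> real"
  assumes int: "\<And>t. 0 \<le> t \<Longrightarrow> (S has_integral (c - S t)) {0..t}" and t: "0 \<le> t"
  shows "S t = c * exp (- t)"
proof -
  have S_eq: "S s = c - integral {0..s} S" if "0 \<le> s" for s
    using integral_unique[OF int[OF that]] by simp
  have cont: "continuous_on {0..R} S" if R: "0 \<le> R" for R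
  proof -
    have "continuous_on {0..R} (\<lambda>s. c - integral {0..s} S)"
      using int[OF R] by (intro continuous_intros indefinite_integral_continuous_1 has_integral_integrable)
    then show ?thesis by (rule continuous_on_eq) (simp add: S_eq)
  qed
  define f where "f s = (c - integral {0..s} S) * exp s" for s
  have c1: "continuous_on {0..t} f" 
    unfolding f_def using int[OF t]
    by (intro continuous_intros indefinite_integral_continuous_1 has_integral_integrable)
  have d: "(f has_real_derivative 0) (at s)" if s: "0 < s" "s < t" for s
  proof -
    have "((\<lambda>s. integral {0..s} S) has_real_derivative S s) (at s within {0..t})"
      using s by (intro integral_has_real_derivative cont) auto
    then have d: "((\<lambda>s. integral {0..s} S) has_real_derivative S s) (at s)"
      using at_within_Icc_at[of 0 s t] s by simp
    have "(f has_real_derivative (0 - S s) * exp s + exp s * (c - integral {0..s} S)) (at s)"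
      unfolding f_def by (rule DERIV_mult DERIV_diff DERIV_const d DERIV_exp)+
    moreover have "c - integral {0..s} S = S s" using S_eq[of s] s by simp
    then have "(0 - S s) * exp s + exp s * (c - integral {0..s} S) = 0"
      by (simp only:) simp
    ultimately show ?thesis by simp
  qed
  have "f t = f 0"
  proof (cases "t = 0")
    case False
    then show ?thesis using DERIV_isconst2[of 0 t f t] c1 d t by auto
  qed simp
  then have "(c - integral {0..t} S) * exp t = c" by (simp add: f_def)
  then have "S t * exp t = c" using S_eq[OF t] by simp
  then show ?thesis by (simp add: exp_minus field_simps)
qed

text \<open>The hazard is continuous and nondecreasing, so the times at which it is at most \<kappa>
  form an initial interval ending at some R with the capped value. Cutting at c loses nothing, the
  giant being zero up to \<open>gel x\<close>.\<close>

lemma (in mass_profile) capped_hazard: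
  assumes lam: "0 < lam" and \<kappa>: "0 \<le> \<kappa>" and c: "c \<le> gel x" and T: "0 \<le> T"
  shows "(\<integral>\<^sup>+r. indicator {r. c < r \<and> r \<le> T \<and> lam * haz x r \<le> \<kappa>} r * ennreal (lam * giant x r) \<partial>lborel)
    = ennreal (min \<kappa> (lam * haz x T))"
proof -
  obtain R where R: "0 \<le> R" "R \<le> T" "\<And>r. 0 \<le> r \<Longrightarrow> r \<le> T \<Longrightarrow> lam * haz x r \<le> \<kappa> \<longleftrightarrow> r \<le> R"
    "lam * haz x R = min \<kappa> (lam * haz x T)"
  proof (cases "lam * haz x T \<le> \<kappa>")
    case True
    have "lam * haz x r \<le> \<kappa>" if "r \<le> T" for r
      using mult_left_mono[OF haz_mono[OF that, of x], of lam] lam True by linarith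
    then show ?thesis using that[of T] T True by (auto simp: min_def)
  next
    case False
    \<comment> \<open>A continuous nondecreasing hazard may attain the level \<kappa> on a whole
      interval, for instance at \<kappa> = 0 before gelation; the supremum picks the last such
      time.\<close>
    define Z where "Z = {r\<in>{0..T}. lam * haz x r \<le> \<kappa>}"
    have cont: "continuous_on {0..T} (\<lambda>r. lam * haz x r)"
      by (intro continuous_intros continuous_on_subset[OF continuous_on_haz]) auto
    have h0: "haz x 0 = 0" using gel_pos[of x] by (intro haz_zero) simp
    obtain r0 where r0: "0 \<le> r0" "r0 \<le> T" "lam * haz x r0 = \<kappa>"
      using IVT'[of "\<lambda>r. lam * haz x r" 0 \<kappa> T] cont T False h0 \<kappa> by auto
    have "closed Z" unfolding Z_def
      using continuous_closed_preimage[OF cont, of "{..\<kappa>}"] by (simp add: vimage_def Int_def conj_commute)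
    moreover have ne: "r0 \<in> Z" using r0 by (simp add: Z_def)
    moreover have bdd: "bdd_above Z" by (rule bdd_aboveI[of _ T]) (auto simp: Z_def)
    ultimately have RZ: "Sup Z \<in> Z" by (intro closed_contains_Sup) auto
    have "r0 \<le> Sup Z" using ne bdd by (rule cSup_upper)
    then have "\<kappa> \<le> lam * haz x (Sup Z)"
      using mult_left_mono[OF haz_mono[of r0 "Sup Z" x], of lam] lam r0 by simp
    then have eq: "lam * haz x (Sup Z) = \<kappa>" using RZ by (simp add: Z_def)
    show ?thesis
    proof (rule that[of "Sup Z"])
      fix r assume r: "0 \<le> r" "r \<le> T"
      show "lam * haz x r \<le> \<kappa> \<longleftrightarrow> r \<le> Sup Z"
      proof
        assume "lam * haz x r \<le> \<kappa>"
        then show "r \<le> Sup Z" using r bdd by (intro cSup_upper) (auto simp: Z_def)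
      next
        assume "r \<le> Sup Z"
        then show "lam * haz x r \<le> \<kappa>" using mult_left_mono[OF haz_mono, of r "Sup Z" lam x] lam eq by simp
      qed
    qed (use RZ eq False in \<open>auto simp: Z_def\<close>)
  qed
  have "(\<integral>\<^sup>+r. indicator {r. c < r \<and> r \<le> T \<and> lam * haz x r \<le> \<kappa>} r * ennreal (lam * giant x r) \<partial>lborel)
    = (\<integral>\<^sup>+r. ennreal (lam * (indicator {0..R} r *\<^sub>R giant x r)) \<partial>lborel)"
  proof (rule nn_integral_cong)
    fix r :: real
    show "indicator {r. c < r \<and> r \<le> T \<and> lam * haz x r \<le> \<kappa>} r * ennreal (lam * giant x r)
      = ennreal (lam * (indicator {0..R} r *\<^sub>R giant x r))"
    proof (cases "r \<le> gel x")
      case True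
      then show ?thesis by (simp add: giant_zero)
    next
      case False
      then have "c < r" "0 \<le> r" using c gel_pos[of x] by auto
      then show ?thesis using R(2) R(3)[of r] by (cases "r \<le> T") (auto simp: indicator_def)
    qed
  qed
  also have "\<dots> = ennreal (\<integral>r. lam * (indicator {0..R} r *\<^sub>R giant x r) \<partial>lborel)"
    using lam by (intro nn_integral_eq_integral integrable_mult_right giant_integrable) (auto simp: giant_nonneg)
  also have "(\<integral>r. lam * (indicator {0..R} r *\<^sub>R giant x r) \<partial>lborel) = lam * haz x R"
    unfolding haz_def by (rule integral_mult_right_zero)
  finally show ?thesis using R(4) by simp
qed

section \<open>Random burning times, their history and their intensity\<close>

locale random_burning = finite_data +
  fixes \<Omega> :: "'a measure" and lam :: real and b :: "nat \<Rightarrow> 'a \<Rightarrow> real" and w :: "real \<Rightarrow> 'a \<Rightarrow> nat \<Rightarrow> real"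
  assumes lam_pos: "0 < lam" and ras: "random_alt_sol \<Omega> lam v0 b w"
begin

sublocale prob_space \<Omega> using ras by (simp add: random_alt_sol_def)

lemma b_measurable[measurable]: "b i \<in> borel_measurable \<Omega>"
  using ras by (simp add: random_alt_sol_def)

definition S :: "nat \<Rightarrow> 'a \<Rightarrow> real" where "S j \<omega> = state (\<lambda>i. b i \<omega>) j"
definition N :: "real \<Rightarrow> 'a \<Rightarrow> nat" where "N s \<omega> = Mc (\<lambda>i. b i \<omega>) s"
definition th :: "real \<Rightarrow> 'a \<Rightarrow> real" where "th r \<omega> = theta (\<lambda>i. b i \<omega>) (\<lambda>t. w t \<omega>) r"
text \<open>Indexed by the state in which the cycle starts: the cycle j is ended by the burning
  \<open>Suc j\<close>.\<close>

definition hz :: "nat \<Rightarrow> 'a \<Rightarrow> real" where "hz j \<omega> = lam * haz (S j \<omega>) (b (Suc j) \<omega>)"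

text \<open>The history of the first j burnings. The index 0 is left out because that time is the
  constant 0, so \<open>past 0\<close> is trivial.\<close>

definition past :: "nat \<Rightarrow> 'a measure" where
  "past j = sigma (space \<Omega>) {b i -` B \<inter> space \<Omega> | i B. 1 \<le> i \<and> i \<le> j \<and> B \<in> sets borel}"

lemma alt: "\<omega> \<in> space \<Omega> \<Longrightarrow> alt_sol v0 (\<lambda>i. b i \<omega>) (\<lambda>t. w t \<omega>)"
  using ras by (simp add: random_alt_sol_def)

lemma bt: "\<omega> \<in> space \<Omega> \<Longrightarrow> burning_times (\<lambda>i. b i \<omega>)"
  using alt by (simp add: alt_sol_def)

lemma S_0: "S 0 \<omega> = 0" and S_Suc: "S (Suc j) \<omega> = burn (b (Suc j) \<omega>) (S j \<omega>)"
  by (simp_all add: S_def)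

lemma S_mono: "i \<le> j \<Longrightarrow> S i \<omega> \<le> S j \<omega>"
  by (simp add: S_def state_mono)

lemma S_nonneg: "0 \<le> S j \<omega>"
  using S_mono[of 0 j] by (simp add: S_0)

lemma b_le_gel: "\<omega> \<in> space \<Omega> \<Longrightarrow> b j \<omega> \<le> gel (S j \<omega>)"
  using alt_sol_states(1)[OF alt, of \<omega> j] by (simp add: S_def)

lemma m0_b: "\<omega> \<in> space \<Omega> \<Longrightarrow> m0 (w (b j \<omega>) \<omega>) = gf v0 m (S j \<omega>)"
  using alt_sol_states(1)[OF alt, of \<omega> j] by (simp add: S_def)

lemma th_eq: "\<omega> \<in> space \<Omega> \<Longrightarrow> 0 < r \<Longrightarrow> th r \<omega> = giant (S (N r \<omega>) \<omega>) r"
  using theta_eq_giant[OF alt] by (simp add: th_def S_def N_def)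

lemma S_measurable[measurable]: "S j \<in> borel_measurable \<Omega>"
  by (induction j) (simp_all add: S_0 S_Suc[abs_def] burn_measurable cong: measurable_cong)

lemma N_measurable[measurable]: "N s \<in> measurable \<Omega> (count_space UNIV)"
proof (rule measurable_count_space_eq2_countable[THEN iffD2])
  show "N s \<in> space \<Omega> \<rightarrow> UNIV \<and> (\<forall>k\<in>UNIV. N s -` {k} \<inter> space \<Omega> \<in> sets \<Omega>)"
  proof (intro conjI ballI)
    fix k
    have ge: "{\<omega>\<in>space \<Omega>. k \<le> N s \<omega>} \<in> sets \<Omega>" for k
    proof (cases "k = 0")
      case False
      then have "{\<omega>\<in>space \<Omega>. k \<le> N s \<omega>} = {\<omega>\<in>space \<Omega>. b k \<omega> < s}"
        using Mc_ge_iff[OF bt, of _ k s] by (auto simp: N_def)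
      then show ?thesis by simp
    qed simp
    have "N s -` {k} \<inter> space \<Omega> = {\<omega>\<in>space \<Omega>. k \<le> N s \<omega>} - {\<omega>\<in>space \<Omega>. Suc k \<le> N s \<omega>}"
      by auto
    then show "N s -` {k} \<inter> space \<Omega> \<in> sets \<Omega>" using ge by auto
  qed auto
qed

lemma past_sets: "sets (past j) = sigma_sets (space \<Omega>) {b i -` B \<inter> space \<Omega> | i B. 1 \<le> i \<and> i \<le> j \<and> B \<in> sets borel}"
  unfolding past_def by (rule sets_measure_of) auto

lemma space_past[simp]: "space (past j) = space \<Omega>"
  unfolding past_def by (rule space_measure_of) auto

lemma past_mono: "i \<le> j \<Longrightarrow> sets (past i) \<subseteq> sets (past j)"
  unfolding past_sets by (rule sigma_sets_mono') force

lemma past_subset: "sets (past j) \<subseteq> sets \<Omega>"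
  unfolding past_sets by (rule sets.sigma_sets_subset) auto

lemma b_past: "1 \<le> i \<Longrightarrow> i \<le> j \<Longrightarrow> b i \<in> borel_measurable (past j)"
  by (rule measurableI) (auto simp: past_sets intro!: sigma_sets.Basic)

lemma S_past: "i \<le> j \<Longrightarrow> S i \<in> borel_measurable (past j)"
proof (induction i)
  case 0
  then show ?case by (simp add: S_0 cong: measurable_cong)
next
  case (Suc i)
  then have "(\<lambda>\<omega>. burn (b (Suc i) \<omega>) (S i \<omega>)) \<in> borel_measurable (past j)"
    by (intro burn_measurable b_past) auto
  then show ?case by (simp add: S_Suc[abs_def])
qed

lemma hz_past: "Suc i \<le> j \<Longrightarrow> hz i \<in> borel_measurable (past j)"
  unfolding hz_def[abs_def]
  by (intro borel_measurable_times borel_measurable_const haz_measurable S_past b_past) auto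

lemma hz_measurable[measurable]: "hz i \<in> borel_measurable \<Omega>"
  by (rule measurable_mono[THEN subsetD, OF _ _ _ _ hz_past[OF order_refl]]) (use past_subset in auto)

lemma filt_sets: "sets (nat_filt \<Omega> b w s) = sigma_sets (space \<Omega>)
     ((\<Union>i. {(\<lambda>\<omega>. min (b i \<omega>) s) -` B \<inter> space \<Omega> | B. B \<in> sets borel}) \<union>
      (\<Union>r\<in>{0..s}. \<Union>k. {(\<lambda>\<omega>. w r \<omega> k) -` B \<inter> space \<Omega> | B. B \<in> sets borel}))"
  unfolding nat_filt_def by (rule sets_measure_of) auto

lemma space_filt[simp]: "space (nat_filt \<Omega> b w s) = space \<Omega>"
  unfolding nat_filt_def by (rule space_measure_of) auto

lemma min_filt: "(\<lambda>\<omega>. min (b i \<omega>) s) \<in> borel_measurable (nat_filt \<Omega> b w s)"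
  by (rule measurableI) (auto simp: filt_sets intro!: sigma_sets.Basic)

text \<open>On the event b j < s the first j burning times coincide with their truncations at s, and
  the truncations are what the filtration at time s records.\<close>

lemma past_before_filt:
  assumes B: "B \<in> sets (past j)"
  shows "{\<omega>\<in>B. b j \<omega> < s} \<in> sets (nat_filt \<Omega> b w s)"
proof -
  let ?F = "nat_filt \<Omega> b w s"
  have A: "{\<omega>\<in>space \<Omega>. b j \<omega> < s} \<in> sets ?F"
  proof -
    have "{\<omega>\<in>space ?F. min (b j \<omega>) s < s} \<in> sets ?F" using min_filt by measurable
    then show ?thesis by (simp add: min_less_iff_disj)
  qed
  from B show ?thesis unfolding past_sets
  proof (induction rule: sigma_sets.induct)
    case (Basic X)
    then obtain i C where X: "X = b i -` C \<inter> space \<Omega>" "1 \<le> i" "i \<le> j" "C \<in> sets borel" by auto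
    have "{\<omega>\<in>X. b j \<omega> < s} = ((\<lambda>\<omega>. min (b i \<omega>) s) -` C \<inter> space ?F) \<inter> {\<omega>\<in>space \<Omega>. b j \<omega> < s}"
    proof (intro set_eqI)
      fix \<omega>
      have "b j \<omega> < s \<Longrightarrow> \<omega> \<in> space \<Omega> \<Longrightarrow> min (b i \<omega>) s = b i \<omega>"
        using burning_timesD(4)[OF bt, of \<omega> i j] X(3) by (intro min_absorb1) linarith
      then show "\<omega> \<in> {\<omega>\<in>X. b j \<omega> < s} \<longleftrightarrow> \<omega> \<in> ((\<lambda>\<omega>. min (b i \<omega>) s) -` C \<inter> space ?F) \<inter> {\<omega>\<in>space \<Omega>. b j \<omega> < s}"
        by (auto simp: X)
    qed
    then show ?case using measurable_sets[OF min_filt X(4), of i s] A by auto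
  next
    case Empty
    then show ?case by simp
  next
    case (Compl X)
    have "{\<omega>\<in>space \<Omega> - X. b j \<omega> < s} = {\<omega>\<in>space \<Omega>. b j \<omega> < s} - {\<omega>\<in>X. b j \<omega> < s}" by auto
    then show ?case using A Compl by auto
  next
    case (Union X)
    have "{\<omega>\<in>\<Union>(range X). b j \<omega> < s} = (\<Union>i. {\<omega>\<in>X i. b j \<omega> < s})" by auto
    then show ?case using Union by auto
  qed
qed

text \<open>A version of \<theta> built from burning times only and therefore jointly measurable in
  \<omega> and r. It agrees with \<open>th\<close> at positive times.\<close>

definition thp :: "'a \<Rightarrow> real \<Rightarrow> real" where
  "thp \<omega> r = (if 0 < r then giant (S (N r \<omega>) \<omega>) r else 0)"

lemma thp_bounds: "0 \<le> thp \<omega> r" "thp \<omega> r \<le> gf v0 m 0"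
proof -
  show "0 \<le> thp \<omega> r" by (simp add: thp_def giant_nonneg)
  have "giant (S (N r \<omega>) \<omega>) r \<le> gf v0 m 0"
    using giant_le[of "S (N r \<omega>) \<omega>" r] S_nonneg[of "N r \<omega>" \<omega>] G_le_iff[of "S (N r \<omega>) \<omega>" 0] by linarith
  then show "thp \<omega> r \<le> gf v0 m 0" using G_pos[of 0] by (simp add: thp_def)
qed

lemma N_pair_measurable: "(\<lambda>p. N (snd p) (fst p)) \<in> measurable (\<Omega> \<Otimes>\<^sub>M lborel) (count_space UNIV)"
proof (rule measurable_count_space_eq2_countable[THEN iffD2])
  let ?P = "\<Omega> \<Otimes>\<^sub>M lborel"
  show "(\<lambda>p. N (snd p) (fst p)) \<in> space ?P \<rightarrow> UNIV \<and> (\<forall>k\<in>UNIV. (\<lambda>p. N (snd p) (fst p)) -` {k} \<inter> space ?P \<in> sets ?P)"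
  proof (intro conjI ballI)
    fix k
    have ge: "{p\<in>space ?P. k \<le> N (snd p) (fst p)} \<in> sets ?P" for k
    proof (cases "k = 0")
      case False
      then have "{p\<in>space ?P. k \<le> N (snd p) (fst p)} = {p\<in>space ?P. b k (fst p) < snd p}"
        using Mc_ge_iff[OF bt, of _ k] by (auto simp: N_def space_pair_measure)
      also have "\<dots> \<in> sets ?P" by measurable
      finally show ?thesis .
    next
      case True
      then show ?thesis using sets.top[of ?P] by simp
    qed
    have "(\<lambda>p. N (snd p) (fst p)) -` {k} \<inter> space ?P = {p\<in>space ?P. k \<le> N (snd p) (fst p)} - {p\<in>space ?P. Suc k \<le> N (snd p) (fst p)}"
      by auto
    then show "(\<lambda>p. N (snd p) (fst p)) -` {k} \<inter> space ?P \<in> sets ?P" using ge by auto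
  qed auto
qed

lemma thp_measurable: "(\<lambda>p. thp (fst p) (snd p)) \<in> borel_measurable (\<Omega> \<Otimes>\<^sub>M lborel)"
proof -
  have "(\<lambda>p. S (N (snd p) (fst p)) (fst p)) \<in> borel_measurable (\<Omega> \<Otimes>\<^sub>M lborel)"
    by (rule measurable_compose_countable[OF _ N_pair_measurable]) measurable
  then have "(\<lambda>p. giant (S (N (snd p) (fst p)) (fst p)) (snd p)) \<in> borel_measurable (\<Omega> \<Otimes>\<^sub>M lborel)"
    by (intro giant_measurable) auto
  then show ?thesis unfolding thp_def by measurable
qed

lemma thp_measurable1: "\<omega> \<in> space \<Omega> \<Longrightarrow> thp \<omega> \<in> borel_measurable borel"
  using measurable_compose[OF measurable_Pair1' thp_measurable, of \<omega>] by simp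

text \<open>Passes from the gauge integral to a Lebesgue integral over half-open intervals, which
  tile a time horizon without overlap.\<close>

lemma integral_theta:
  assumes \<omega>: "\<omega> \<in> space \<Omega>" and s: "0 \<le> s" "s \<le> t"
  shows "ennreal (integral {s..t} (\<lambda>r. lam * th r \<omega>)) = (\<integral>\<^sup>+r. indicator {s..<t} r * ennreal (lam * thp \<omega> r) \<partial>lborel)"
proof -
  have m: "(\<lambda>r. lam * thp \<omega> r) \<in> borel_measurable lborel" using thp_measurable1[OF \<omega>] by simp
  have int: "set_integrable lborel {s..t} (\<lambda>r. lam * thp \<omega> r)"
    unfolding set_integrable_def
  proof (rule integrableI_bounded_set_indicator[where B="lam * gf v0 m 0"])
    show "AE r in lborel. r \<in> {s..t} \<longrightarrow> norm (lam * thp \<omega> r) \<le> lam * gf v0 m 0"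
      using thp_bounds[of \<omega>] lam_pos by (auto simp: abs_mult)
  qed (use s m in auto)
  have "integral {s..t} (\<lambda>r. lam * th r \<omega>) = integral {s..t} (\<lambda>r. lam * thp \<omega> r)"
    by (rule integral_spike[of "{0}"]) (use \<omega> s th_eq in \<open>auto simp: thp_def\<close>)
  also have "\<dots> = (LINT r:{s..t}|lborel. lam * thp \<omega> r)"
    by (rule set_borel_integral_eq_integral(2)[OF int, symmetric])
  finally have "ennreal (integral {s..t} (\<lambda>r. lam * th r \<omega>)) = ennreal (\<integral>r. indicator {s..t} r *\<^sub>R (lam * thp \<omega> r) \<partial>lborel)"
    by (simp only: set_lebesgue_integral_def)
  also have "\<dots> = (\<integral>\<^sup>+r. ennreal (indicator {s..t} r *\<^sub>R (lam * thp \<omega> r)) \<partial>lborel)"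
    using int[unfolded set_integrable_def] lam_pos thp_bounds[of \<omega>]
    by (intro nn_integral_eq_integral[symmetric]) auto
  also have "\<dots> = (\<integral>\<^sup>+r. indicator {s..<t} r * ennreal (lam * thp \<omega> r) \<partial>lborel)"
  proof (rule nn_integral_cong_AE)
    have "AE r in lborel. r \<noteq> t" by (rule AE_lborel_singleton)
    then show "AE r in lborel. ennreal (indicator {s..t} r *\<^sub>R (lam * thp \<omega> r)) = indicator {s..<t} r * ennreal (lam * thp \<omega> r)"
      by eventually_elim (auto simp: indicator_def)
  qed
  finally show ?thesis .
qed

lemma intensity:
  assumes "0 \<le> s" "s \<le> t" "A \<in> sets (nat_filt \<Omega> b w s)"
  shows "(\<integral>\<^sup>+\<omega>. indicator A \<omega> * ennreal (real (N t \<omega>) - real (N s \<omega>)) \<partial>\<Omega>) =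
    (\<integral>\<^sup>+\<omega>. indicator A \<omega> * (\<integral>\<^sup>+r. indicator {s..<t} r * ennreal (lam * thp \<omega> r) \<partial>lborel) \<partial>\<Omega>)"
proof -
  have "(\<integral>\<^sup>+\<omega>. indicator A \<omega> * ennreal (real (N t \<omega>) - real (N s \<omega>)) \<partial>\<Omega>) =
    (\<integral>\<^sup>+\<omega>. indicator A \<omega> * ennreal (integral {s..t} (\<lambda>r. lam * th r \<omega>)) \<partial>\<Omega>)"
    using ras assms unfolding random_alt_sol_def N_def th_def by blast
  also have "\<dots> = (\<integral>\<^sup>+\<omega>. indicator A \<omega> * (\<integral>\<^sup>+r. indicator {s..<t} r * ennreal (lam * thp \<omega> r) \<partial>lborel) \<partial>\<Omega>)"
    by (rule nn_integral_cong) (simp only: integral_theta[OF _ assms(1,2)])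
  finally show ?thesis .
qed

lemma filt_subset: "0 \<le> s \<Longrightarrow> sets (nat_filt \<Omega> b w s) \<subseteq> sets \<Omega>"
  unfolding filt_sets
proof (rule sets.sigma_sets_subset, rule Un_least)
  have "(\<lambda>\<omega>. w r \<omega> k) \<in> borel_measurable \<Omega>" for r k using ras by (simp add: random_alt_sol_def)
  from measurable_sets[OF this]
  show "(\<Union>r\<in>{0..s}. \<Union>k. {(\<lambda>\<omega>. w r \<omega> k) -` B \<inter> space \<Omega> |B. B \<in> sets borel}) \<subseteq> events" by auto
  have "(\<lambda>\<omega>. min (b i \<omega>) s) \<in> borel_measurable \<Omega>" for i by measurable
  from measurable_sets[OF this]
  show "(\<Union>i. {(\<lambda>\<omega>. min (b i \<omega>) s) -` B \<inter> space \<Omega> |B. B \<in> sets borel}) \<subseteq> events" by auto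
qed

end

section \<open>The compensator formula for predictable events\<close>

context random_burning
begin

text \<open>Extends the defining identity of the intensity from events fixed at one time to events
  moving with time. On a grid the identity holds cell by cell with Q frozen at the left end of the
  cell. Left-continuity of membership in Q lets the mesh tend to 0 under dominated
  convergence.\<close>

lemma compensation:
  fixes Q :: "real \<Rightarrow> 'a set"
  assumes Qf: "\<And>s. 0 \<le> s \<Longrightarrow> Q s \<in> sets (nat_filt \<Omega> b w s)"
    and Qm: "(\<lambda>p. indicator (Q (snd p)) (fst p) :: ennreal) \<in> borel_measurable (\<Omega> \<Otimes>\<^sub>M lborel)"
    and left: "\<And>\<omega> s. \<omega> \<in> space \<Omega> \<Longrightarrow> 0 < s \<Longrightarrow> \<exists>d>0. \<forall>s'. s - d < s' \<and> s' \<le> s \<and> 0 \<le> s' \<longrightarrow> (\<omega> \<in> Q s' \<longleftrightarrow> \<omega> \<in> Q s)"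
    and T: "0 < T"
  shows "(\<integral>\<^sup>+\<omega>. (\<Sum>i=1..N T \<omega>. indicator (Q (b i \<omega>)) \<omega>) \<partial>\<Omega>) =
    (\<integral>\<^sup>+p. indicator {0..<T} (snd p) * indicator (Q (snd p)) (fst p) * ennreal (lam * thp (fst p) (snd p)) \<partial>(\<Omega> \<Otimes>\<^sub>M lborel))"
proof -
  let ?P = "\<Omega> \<Otimes>\<^sub>M lborel"
  define sk where "sk n k = T * real k / real (Suc n)" for n k
  \<comment> \<open>The largest grid point not exceeding s. Rounding down makes Q known at the start
    of the cell, and the half-open cells fit \<open>N\<close>, which counts burnings strictly before
    a time.\<close>
  define fl where "fl n s = T * real_of_int \<lfloor>s * real (Suc n) / T\<rfloor> / real (Suc n)" for n s
  have sk_mono: "sk n k \<le> sk n (Suc k)" and sk_nonneg: "0 \<le> sk n k" and sk_le: "k < Suc n \<Longrightarrow> sk n (Suc k) \<le> T" for n k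
    using T by (auto simp: sk_def divide_simps)
  have flk: "fl n s = sk n k \<longleftrightarrow> sk n k \<le> s \<and> s < sk n (Suc k)" for n s k
  proof -
    have "fl n s = sk n k \<longleftrightarrow> \<lfloor>s * real (Suc n) / T\<rfloor> = int k"
    proof -
      have "real_of_int z = real k \<longleftrightarrow> z = int k" for z by (metis of_int_eq_iff of_int_of_nat_eq)
      then show ?thesis using T by (simp add: fl_def sk_def)
    qed
    also have "\<dots> \<longleftrightarrow> real k \<le> s * real (Suc n) / T \<and> s * real (Suc n) / T < real k + 1"
      by (simp add: floor_eq_iff)
    also have "\<dots> \<longleftrightarrow> sk n k \<le> s \<and> s < sk n (Suc k)"
      using T by (simp add: sk_def field_simps)
    finally show ?thesis .
  qed
  have fl_ex: "\<exists>k<Suc n. fl n s = sk n k" if "0 \<le> s" "s < T" for n s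
  proof (intro exI conjI)
    let ?k = "nat \<lfloor>s * real (Suc n) / T\<rfloor>"
    have nn: "0 \<le> \<lfloor>s * real (Suc n) / T\<rfloor>" using that T by simp
    show "fl n s = sk n ?k" using nn by (simp add: fl_def sk_def)
    have "s * real (Suc n) < T * real (Suc n)" using that by (intro mult_strict_right_mono) auto
    then have "s * real (Suc n) / T < real (Suc n)" using T by (simp add: pos_divide_less_eq mult.commute)
    then have "\<lfloor>s * real (Suc n) / T\<rfloor> < int (Suc n)" by (simp only: floor_less_iff of_int_of_nat_eq)
    then show "?k < Suc n" using nn by linarith
  qed
  have fl_le: "fl n s \<le> s" and fl_gt: "s - T / real (Suc n) < fl n s" for n s
  proof -
    define z where "z = s * real (Suc n) / T"
    have s: "s = T * z / real (Suc n)" using T by (simp add: z_def del: of_nat_Suc)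
    have f: "fl n s = T * real_of_int \<lfloor>z\<rfloor> / real (Suc n)" by (simp only: fl_def z_def)
    show "fl n s \<le> s" unfolding f by (subst s) (use T in \<open>intro divide_right_mono mult_left_mono, auto\<close>)
    have "T * (z - 1) / real (Suc n) < T * real_of_int \<lfloor>z\<rfloor> / real (Suc n)"
      using T by (intro divide_strict_right_mono mult_strict_left_mono) linarith+
    moreover have "T * (z - 1) / real (Suc n) = s - T / real (Suc n)"
      by (subst s) (simp add: right_diff_distrib diff_divide_distrib)
    ultimately show "s - T / real (Suc n) < fl n s" unfolding f by simp
  qed
  have fl_nonneg: "0 \<le> s \<Longrightarrow> 0 \<le> fl n s" for n s using T by (simp add: fl_def)
  have fl_lim: "eventually (\<lambda>n. \<omega> \<in> Q (fl n s) \<longleftrightarrow> \<omega> \<in> Q s) sequentially" if \<omega>: "\<omega> \<in> space \<Omega>" and s: "0 \<le> s" for \<omega> s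
  proof (cases "s = 0")
    case True
    then show ?thesis by (simp add: fl_def)
  next
    case False
    then obtain d where d: "0 < d" "\<And>s'. s - d < s' \<Longrightarrow> s' \<le> s \<Longrightarrow> 0 \<le> s' \<Longrightarrow> (\<omega> \<in> Q s' \<longleftrightarrow> \<omega> \<in> Q s)"
      using left[OF \<omega>, of s] s by auto
    have "(\<lambda>n. T / real (Suc n)) \<longlonglongrightarrow> 0" using LIMSEQ_Suc[OF lim_const_over_n[of T]] by simp
    then have "eventually (\<lambda>n. T / real (Suc n) < d) sequentially" using d(1) by (rule order_tendstoD)
    then show ?thesis
    proof eventually_elim
      case (elim n)
      show ?case by (rule d(2)[OF _ fl_le fl_nonneg[OF s]]) (use fl_gt[of s n] elim in linarith)
    qed
  qed
  define L where "L n \<omega> = (\<Sum>i=1..N T \<omega>. indicator (Q (fl n (b i \<omega>))) \<omega> :: ennreal)" for n \<omega>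
  define R where "R n p = indicator {0..<T} (snd p) * indicator (Q (fl n (snd p))) (fst p) * ennreal (lam * thp (fst p) (snd p))" for n p
  have bi: "0 \<le> b i \<omega>" "1 \<le> i \<Longrightarrow> i \<le> N T \<omega> \<Longrightarrow> b i \<omega> < T" if "\<omega> \<in> space \<Omega>" for i \<omega>
    using burning_timesD(5)[OF bt[OF that]] Mc_ge_iff[OF bt[OF that], of i T] by (auto simp: N_def)
  have Ncount: "real (N s \<omega>) = (\<Sum>i=1..N T \<omega>. if b i \<omega> < s then 1 else 0)" if \<omega>: "\<omega> \<in> space \<Omega>" and s: "s \<le> T" for s \<omega>
  proof -
    have le: "N s \<omega> \<le> N T \<omega>"
    proof (cases "N s \<omega> = 0")
      case False
      then have "b (N s \<omega>) \<omega> < s" using Mc_ge_iff[OF bt[OF \<omega>], of "N s \<omega>" s] by (simp add: N_def)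
      then show ?thesis using Mc_ge_iff[OF bt[OF \<omega>], of "N s \<omega>" T] False s by (simp add: N_def)
    qed simp
    have "(\<Sum>i=1..N T \<omega>. if b i \<omega> < s then 1 else 0) = (\<Sum>i=1..N T \<omega>. if i \<in> {1..N s \<omega>} then 1 else (0::real))"
      using Mc_ge_iff[OF bt[OF \<omega>], of _ s] by (intro sum.cong) (auto simp: N_def)
    also have "\<dots> = real (card {1..N s \<omega>})"
      using le by (subst sum.inter_restrict[symmetric]) (auto simp: Int_absorb2 Int_commute)
    finally show ?thesis by simp
  qed
  have L_eq: "L n \<omega> = (\<Sum>k<Suc n. indicator (Q (sk n k)) \<omega> * ennreal (real (N (sk n (Suc k)) \<omega>) - real (N (sk n k) \<omega>)))"
    if \<omega>: "\<omega> \<in> space \<Omega>" for n \<omega>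
  proof -
    have d: "ennreal (real (N (sk n (Suc k)) \<omega>) - real (N (sk n k) \<omega>)) = (\<Sum>i=1..N T \<omega>. if fl n (b i \<omega>) = sk n k then 1 else 0)"
      if k: "k < Suc n" for k
    proof -
      have "real (N (sk n (Suc k)) \<omega>) - real (N (sk n k) \<omega>) = (\<Sum>i=1..N T \<omega>. if fl n (b i \<omega>) = sk n k then 1 else 0)"
        using sk_mono[of n k] sk_le[OF k]
        by (subst (1 2) Ncount[OF \<omega>]) (auto simp: sum_subtractf[symmetric] flk intro!: sum.cong)
      also have "ennreal \<dots> = (\<Sum>i=1..N T \<omega>. ennreal (if fl n (b i \<omega>) = sk n k then 1 else 0))"
        by (rule sum_ennreal[symmetric]) simp
      finally show ?thesis by (simp add: if_distrib[of ennreal] cong: if_cong)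
    qed
    have "(\<Sum>k<Suc n. indicator (Q (sk n k)) \<omega> * ennreal (real (N (sk n (Suc k)) \<omega>) - real (N (sk n k) \<omega>)))
      = (\<Sum>k<Suc n. \<Sum>i=1..N T \<omega>. indicator (Q (sk n k)) \<omega> * (if fl n (b i \<omega>) = sk n k then 1 else 0))"
      by (rule sum.cong) (simp_all add: d sum_distrib_left)
    also have "\<dots> = (\<Sum>i=1..N T \<omega>. \<Sum>k<Suc n. indicator (Q (sk n k)) \<omega> * (if fl n (b i \<omega>) = sk n k then 1 else 0))"
      by (rule sum.swap)
    also have "\<dots> = L n \<omega>" unfolding L_def
    proof (rule sum.cong)
      fix i assume i: "i \<in> {1..N T \<omega>}"
      obtain k where k: "k < Suc n" "fl n (b i \<omega>) = sk n k" using fl_ex[of "b i \<omega>" n] bi[OF \<omega>] i by auto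
      have inj: "sk n k = sk n k' \<longleftrightarrow> k = k'" for k' using T by (simp add: sk_def)
      have "(\<Sum>k'<Suc n. indicator (Q (sk n k')) \<omega> * (if fl n (b i \<omega>) = sk n k' then 1 else 0)) = (\<Sum>k'<Suc n. if k' = k then indicator (Q (sk n k)) \<omega> else (0::ennreal))"
        by (rule sum.cong) (auto simp: k(2) inj)
      then show "(\<Sum>k'<Suc n. indicator (Q (sk n k')) \<omega> * (if fl n (b i \<omega>) = sk n k' then 1 else 0)) = (indicator (Q (fl n (b i \<omega>))) \<omega> :: ennreal)"
        using k by simp
    qed simp
    finally show ?thesis by simp
  qed
  have R_eq: "R n p = (\<Sum>k<Suc n. indicator (Q (sk n k)) (fst p) * (indicator {sk n k..<sk n (Suc k)} (snd p) * ennreal (lam * thp (fst p) (snd p))))" for n p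
  proof (cases "0 \<le> snd p \<and> snd p < T")
    case True
    then obtain k where k: "k < Suc n" "fl n (snd p) = sk n k" using fl_ex by blast
    have inj: "sk n k = sk n k' \<longleftrightarrow> k = k'" for k' using T by (simp add: sk_def)
    have ind: "indicator {sk n k'..<sk n (Suc k')} (snd p) = (if k' = k then 1 else 0 :: ennreal)" for k'
      using flk[of n "snd p" k'] k(2) inj[of k'] by (auto simp: indicator_def)
    show ?thesis unfolding R_def ind using True k by (simp add: if_distrib[of "\<lambda>x. _ * (x * _)"] cong: if_cong) 
  next
    case False
    have "indicator {sk n k..<sk n (Suc k)} (snd p) = (0::ennreal)" if "k < Suc n" for k
      using False sk_nonneg[of n k] sk_le[OF that] by (auto simp: indicator_def)
    then show ?thesis using False by (auto simp: R_def)
  qed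
  have Qev[measurable]: "Q (sk n k) \<in> sets \<Omega>" for n k
    using Qf[OF sk_nonneg] filt_subset[OF sk_nonneg] by blast
  note [measurable] = thp_measurable
  have N_real[measurable]: "(\<lambda>\<omega>. real (N s \<omega>)) \<in> borel_measurable \<Omega>" for s by measurable
  have Rm: "(\<lambda>p. indicator (Q (sk n k)) (fst p) * (indicator {sk n k..<sk n (Suc k)} (snd p) * ennreal (lam * thp (fst p) (snd p)))) \<in> borel_measurable ?P" for n k
    by measurable
  have LR: "(\<integral>\<^sup>+\<omega>. L n \<omega> \<partial>\<Omega>) = (\<integral>\<^sup>+p. R n p \<partial>?P)" for n
  proof -
    have "(\<integral>\<^sup>+\<omega>. L n \<omega> \<partial>\<Omega>) = (\<integral>\<^sup>+\<omega>. (\<Sum>k<Suc n. indicator (Q (sk n k)) \<omega> * ennreal (real (N (sk n (Suc k)) \<omega>) - real (N (sk n k) \<omega>))) \<partial>\<Omega>)"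
      by (rule nn_integral_cong) (rule L_eq)
    also have "\<dots> = (\<Sum>k<Suc n. \<integral>\<^sup>+\<omega>. indicator (Q (sk n k)) \<omega> * ennreal (real (N (sk n (Suc k)) \<omega>) - real (N (sk n k) \<omega>)) \<partial>\<Omega>)"
      by (rule nn_integral_sum) measurable
    also have "\<dots> = (\<Sum>k<Suc n. \<integral>\<^sup>+p. indicator (Q (sk n k)) (fst p) * (indicator {sk n k..<sk n (Suc k)} (snd p) * ennreal (lam * thp (fst p) (snd p))) \<partial>?P)"
    proof (rule sum.cong)
      fix k
      have "(\<integral>\<^sup>+\<omega>. indicator (Q (sk n k)) \<omega> * ennreal (real (N (sk n (Suc k)) \<omega>) - real (N (sk n k) \<omega>)) \<partial>\<Omega>)
        = (\<integral>\<^sup>+\<omega>. indicator (Q (sk n k)) \<omega> * (\<integral>\<^sup>+r. indicator {sk n k..<sk n (Suc k)} r * ennreal (lam * thp \<omega> r) \<partial>lborel) \<partial>\<Omega>)"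
        by (rule intensity[OF sk_nonneg sk_mono Qf[OF sk_nonneg]])
      also have "\<dots> = (\<integral>\<^sup>+\<omega>. \<integral>\<^sup>+r. indicator (Q (sk n k)) \<omega> * (indicator {sk n k..<sk n (Suc k)} r * ennreal (lam * thp \<omega> r)) \<partial>lborel \<partial>\<Omega>)"
      proof (rule nn_integral_cong)
        fix \<omega> assume "\<omega> \<in> space \<Omega>"
        note [measurable] = thp_measurable1[OF this]
        show "indicator (Q (sk n k)) \<omega> * (\<integral>\<^sup>+r. indicator {sk n k..<sk n (Suc k)} r * ennreal (lam * thp \<omega> r) \<partial>lborel) =
          (\<integral>\<^sup>+r. indicator (Q (sk n k)) \<omega> * (indicator {sk n k..<sk n (Suc k)} r * ennreal (lam * thp \<omega> r)) \<partial>lborel)"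
          by (rule nn_integral_cmult[symmetric]) measurable
      qed
      also have "\<dots> = (\<integral>\<^sup>+p. indicator (Q (sk n k)) (fst p) * (indicator {sk n k..<sk n (Suc k)} (snd p) * ennreal (lam * thp (fst p) (snd p))) \<partial>?P)"
        using lborel.nn_integral_fst[OF Rm[of n k]] by simp
      finally show "(\<integral>\<^sup>+\<omega>. indicator (Q (sk n k)) \<omega> * ennreal (real (N (sk n (Suc k)) \<omega>) - real (N (sk n k) \<omega>)) \<partial>\<Omega>) = \<dots>" .
    qed simp
    also have "\<dots> = (\<integral>\<^sup>+p. (\<Sum>k<Suc n. indicator (Q (sk n k)) (fst p) * (indicator {sk n k..<sk n (Suc k)} (snd p) * ennreal (lam * thp (fst p) (snd p)))) \<partial>?P)"
      by (rule nn_integral_sum[symmetric]) (rule Rm)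
    finally show ?thesis by (simp only: R_eq[symmetric])
  qed
  have Lm: "L n \<in> borel_measurable \<Omega>" for n
    by (subst measurable_cong[OF L_eq]) measurable
  have Rnm: "R n \<in> borel_measurable ?P" for n
    unfolding R_eq[abs_def] by (intro borel_measurable_sum Rm)
  define L' where "L' \<omega> = (\<Sum>i=1..N T \<omega>. indicator (Q (b i \<omega>)) \<omega> :: ennreal)" for \<omega>
  define R' where "R' p = indicator {0..<T} (snd p) * indicator (Q (snd p)) (fst p) * ennreal (lam * thp (fst p) (snd p))" for p
  have R'm: "R' \<in> borel_measurable ?P"
    unfolding R'_def using Qm by measurable
  have L_lim: "(\<lambda>n. L n \<omega>) \<longlonglongrightarrow> L' \<omega>" if \<omega>: "\<omega> \<in> space \<Omega>" for \<omega>
  proof -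
    have "eventually (\<lambda>n. \<forall>i\<in>{1..N T \<omega>}. \<omega> \<in> Q (fl n (b i \<omega>)) \<longleftrightarrow> \<omega> \<in> Q (b i \<omega>)) sequentially"
      by (intro eventually_ball_finite ballI fl_lim \<omega> bi) auto
    then have "eventually (\<lambda>n. L n \<omega> = L' \<omega>) sequentially"
      by eventually_elim (auto simp: L_def L'_def indicator_def intro!: sum.cong)
    then show ?thesis by (rule tendsto_eventually)
  qed
  have L'm: "L' \<in> borel_measurable \<Omega>"
    by (rule borel_measurable_LIMSEQ_order[OF L_lim Lm])
  have R_lim: "(\<lambda>n. R n p) \<longlonglongrightarrow> R' p" if p: "p \<in> space ?P" for p
  proof (cases "0 \<le> snd p")
    case True
    have "eventually (\<lambda>n. fst p \<in> Q (fl n (snd p)) \<longleftrightarrow> fst p \<in> Q (snd p)) sequentially"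
      using p True by (intro fl_lim) (auto simp: space_pair_measure)
    then have "eventually (\<lambda>n. R n p = R' p) sequentially"
      by eventually_elim (auto simp: R_def R'_def indicator_def)
    then show ?thesis by (rule tendsto_eventually)
  qed (simp add: R_def R'_def)
  \<comment> \<open>The intensity is at most lam times the initial mass, so the number of burnings
    before T is integrable; it dominates the discretised sums.\<close>
  have bound: "(\<integral>\<^sup>+\<omega>. ennreal (real (N T \<omega>)) \<partial>\<Omega>) < \<infinity>"
  proof -
    have sp: "space \<Omega> \<in> sets (nat_filt \<Omega> b w 0)" using sets.top[of "nat_filt \<Omega> b w 0"] by simp
    have "(\<integral>\<^sup>+\<omega>. ennreal (real (N T \<omega>)) \<partial>\<Omega>) = (\<integral>\<^sup>+\<omega>. indicator (space \<Omega>) \<omega> * ennreal (real (N T \<omega>) - real (N 0 \<omega>)) \<partial>\<Omega>)"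
      by (rule nn_integral_cong) (auto simp: N_def Mc_0[OF bt])
    also have "\<dots> = (\<integral>\<^sup>+\<omega>. indicator (space \<Omega>) \<omega> * (\<integral>\<^sup>+r. indicator {0..<T} r * ennreal (lam * thp \<omega> r) \<partial>lborel) \<partial>\<Omega>)"
      using T by (intro intensity sp) auto
    also have "\<dots> \<le> (\<integral>\<^sup>+\<omega>. ennreal (lam * gf v0 m 0 * T) \<partial>\<Omega>)"
    proof (rule nn_integral_mono)
      fix \<omega>
      have "(\<integral>\<^sup>+r. indicator {0..<T} r * ennreal (lam * thp \<omega> r) \<partial>lborel) \<le> (\<integral>\<^sup>+r. ennreal (lam * gf v0 m 0) * indicator {0..<T} r \<partial>lborel)"
        using thp_bounds(2)[of \<omega>] lam_pos by (intro nn_integral_mono) (auto simp: indicator_def intro!: ennreal_leI)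
      also have "\<dots> = ennreal (lam * gf v0 m 0 * T)"
        using T lam_pos G_pos[of 0] by (subst nn_integral_cmult_indicator) (auto simp: ennreal_mult[symmetric])
      finally show "indicator (space \<Omega>) \<omega> * (\<integral>\<^sup>+r. indicator {0..<T} r * ennreal (lam * thp \<omega> r) \<partial>lborel) \<le> ennreal (lam * gf v0 m 0 * T)"
        by (auto simp: indicator_def)
    qed
    also have "\<dots> < \<infinity>" by (simp add: emeasure_space_1)
    finally show ?thesis .
  qed
  have 1: "(\<lambda>n. \<integral>\<^sup>+\<omega>. L n \<omega> \<partial>\<Omega>) \<longlonglongrightarrow> (\<integral>\<^sup>+\<omega>. L' \<omega> \<partial>\<Omega>)"
  proof (rule nn_integral_dominated_convergence[where w="\<lambda>\<omega>. ennreal (real (N T \<omega>))"])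
    show "AE \<omega> in \<Omega>. L j \<omega> \<le> ennreal (real (N T \<omega>))" for j
    proof (rule AE_I2)
      fix \<omega>
      have "L j \<omega> \<le> (\<Sum>i=1..N T \<omega>. 1)" unfolding L_def by (intro sum_mono) (auto simp: indicator_def)
      then show "L j \<omega> \<le> ennreal (real (N T \<omega>))" by (simp add: ennreal_of_nat_eq_real_of_nat)
    qed
  qed (use Lm L'm bound L_lim in auto)
  have 2: "(\<lambda>n. \<integral>\<^sup>+p. R n p \<partial>?P) \<longlonglongrightarrow> (\<integral>\<^sup>+p. R' p \<partial>?P)"
  proof (rule nn_integral_dominated_convergence[where w="\<lambda>p. ennreal (lam * gf v0 m 0) * indicator {0..<T} (snd p)"])
    show "AE p in ?P. R j p \<le> ennreal (lam * gf v0 m 0) * indicator {0..<T} (snd p)" for j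
      using thp_bounds(2) lam_pos by (intro AE_I2) (auto simp: R_def indicator_def intro!: ennreal_leI)
    have wm: "(\<lambda>p. ennreal (lam * gf v0 m 0) * indicator {0..<T} (snd p)) \<in> borel_measurable ?P" by measurable
    then show "(\<lambda>p. ennreal (lam * gf v0 m 0) * indicator {0..<T} (snd p)) \<in> borel_measurable ?P" .
    have "(\<integral>\<^sup>+p. ennreal (lam * gf v0 m 0) * indicator {0..<T} (snd p) \<partial>?P) = (\<integral>\<^sup>+\<omega>. \<integral>\<^sup>+r. ennreal (lam * gf v0 m 0) * indicator {0..<T} r \<partial>lborel \<partial>\<Omega>)"
      using lborel.nn_integral_fst[OF wm] by simp
    also have "\<dots> < \<infinity>"
      using T by (subst nn_integral_cmult_indicator) (auto simp: emeasure_space_1 ennreal_mult_less_top)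
    finally show "(\<integral>\<^sup>+p. ennreal (lam * gf v0 m 0) * indicator {0..<T} (snd p) \<partial>?P) < \<infinity>" .
  qed (use Rnm R'm R_lim in auto)
  have "(\<integral>\<^sup>+\<omega>. L' \<omega> \<partial>\<Omega>) = (\<integral>\<^sup>+p. R' p \<partial>?P)"
    using LIMSEQ_unique[OF 1[unfolded LR] 2] .
  then show ?thesis by (simp only: L'_def R'_def)
qed

end

section \<open>The law of the hazard of a cycle given its past\<close>

context random_burning
begin

text \<open>The compensator formula for the part of cycle j on which the hazard has not exceeded
  \<kappa>. Only the burning \<open>Suc j\<close> can fall into it, while the intensity integrates
  to the hazard capped at \<kappa>.\<close>

lemma hazard_truncated_horizon:
  assumes B: "B \<in> sets (past j)" and \<kappa>: "0 \<le> \<kappa>" and T: "0 < T"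
  shows "(\<integral>\<^sup>+\<omega>. indicator {\<omega>\<in>B. b (Suc j) \<omega> < T \<and> hz j \<omega> \<le> \<kappa>} \<omega> \<partial>\<Omega>) =
    (\<integral>\<^sup>+\<omega>. indicator B \<omega> * ennreal (min \<kappa> (lam * haz (S j \<omega>) (min T (b (Suc j) \<omega>)))) \<partial>\<Omega>)"
proof -
  let ?P = "\<Omega> \<Otimes>\<^sub>M lborel"
  define Q where "Q s = {\<omega>\<in>B. b j \<omega> < s \<and> s \<le> b (Suc j) \<omega> \<and> lam * haz (S j \<omega>) s \<le> \<kappa>}" for s
  have Bev[measurable]: "B \<in> sets \<Omega>" using B past_subset by blast
  have Bsp: "B \<subseteq> space \<Omega>" using Bev sets.sets_into_space by blast
  have only: "b i \<omega> \<le> b (Suc j) \<omega> \<and> b j \<omega> < b i \<omega> \<longleftrightarrow> i = Suc j" if "\<omega> \<in> space \<Omega>" for i \<omega>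
  proof -
    note s = burning_timesD(2)[OF bt[OF that]]
    show ?thesis using strict_mono_less_eq[OF s, of i "Suc j"] strict_mono_less[OF s, of j i] by auto
  qed
  have "(\<integral>\<^sup>+\<omega>. (\<Sum>i=1..N T \<omega>. indicator (Q (b i \<omega>)) \<omega>) \<partial>\<Omega>) =
    (\<integral>\<^sup>+p. indicator {0..<T} (snd p) * indicator (Q (snd p)) (fst p) * ennreal (lam * thp (fst p) (snd p)) \<partial>?P)"
  proof (rule compensation[OF _ _ _ T])
    fix s :: real
    let ?F = "nat_filt \<Omega> b w s"
    have h: "(\<lambda>\<omega>. lam * haz (S j \<omega>) s) \<in> borel_measurable (past j)"
      by (intro borel_measurable_times borel_measurable_const haz_measurable S_past) simp
    have "{\<omega>\<in>space (past j). lam * haz (S j \<omega>) s \<le> \<kappa>} \<in> sets (past j)"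
      using h by measurable
    then have B': "B \<inter> {\<omega>\<in>space (past j). lam * haz (S j \<omega>) s \<le> \<kappa>} \<in> sets (past j)"
      by (rule sets.Int[OF B])
    have "{\<omega>\<in>space ?F. s \<le> min (b (Suc j) \<omega>) s} \<in> sets ?F" using min_filt[of "Suc j" s] by measurable
    moreover have "Q s = {\<omega>\<in>B \<inter> {\<omega>\<in>space (past j). lam * haz (S j \<omega>) s \<le> \<kappa>}. b j \<omega> < s} \<inter> {\<omega>\<in>space ?F. s \<le> min (b (Suc j) \<omega>) s}"
      using Bsp by (auto simp: Q_def)
    ultimately show "Q s \<in> sets ?F" using past_before_filt[OF B'] by simp
  next
    have "{p\<in>space ?P. fst p \<in> B \<and> b j (fst p) < snd p \<and> snd p \<le> b (Suc j) (fst p) \<and> lam * haz (S j (fst p)) (snd p) \<le> \<kappa>} \<in> sets ?P"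
    proof -
      have [measurable]: "(\<lambda>p. haz (S j (fst p)) (snd p)) \<in> borel_measurable ?P" by (intro haz_measurable) measurable
      show ?thesis by measurable
    qed
    then have "indicator {p\<in>space ?P. fst p \<in> B \<and> b j (fst p) < snd p \<and> snd p \<le> b (Suc j) (fst p) \<and> lam * haz (S j (fst p)) (snd p) \<le> \<kappa>} \<in> borel_measurable ?P"
      by (rule borel_measurable_indicator)
    then show "(\<lambda>p. indicator (Q (snd p)) (fst p) :: ennreal) \<in> borel_measurable ?P"
      by (rule measurable_cong[THEN iffD1, rotated]) (auto simp: Q_def indicator_def space_pair_measure)
  next
    fix \<omega> s assume \<omega>: "\<omega> \<in> space \<Omega>" and s: "0 < (s::real)"
    let ?x = "S j \<omega>"
    consider "\<omega> \<notin> B \<or> s \<le> b j \<omega>" | "\<omega> \<in> B" "b j \<omega> < s" "b (Suc j) \<omega> < s"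
      | "\<omega> \<in> B" "b j \<omega> < s" "s \<le> b (Suc j) \<omega>" "lam * haz ?x s \<le> \<kappa>"
      | "\<omega> \<in> B" "b j \<omega> < s" "s \<le> b (Suc j) \<omega>" "\<kappa> < lam * haz ?x s" by linarith
    then show "\<exists>d>0. \<forall>s'. s - d < s' \<and> s' \<le> s \<and> 0 \<le> s' \<longrightarrow> (\<omega> \<in> Q s' \<longleftrightarrow> \<omega> \<in> Q s)"
    proof cases
      case 1
      then show ?thesis by (intro exI[of _ 1]) (auto simp: Q_def)
    next
      case 2
      then show ?thesis by (intro exI[of _ "s - b (Suc j) \<omega>"]) (auto simp: Q_def)
    next
      case 3
      have "lam * haz ?x s' \<le> \<kappa>" if "s' \<le> s" for s'
        using mult_left_mono[OF haz_mono[OF that, of ?x], of lam] lam_pos 3(4) by linarith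
      then show ?thesis using 3 by (intro exI[of _ "s - b j \<omega>"]) (auto simp: Q_def)
    next
      case 4
      \<comment> \<open>The hazard grows at most at speed G, so to the left of s it stays above
        \<kappa> for at least this long.\<close>
      let ?d = "(lam * haz ?x s - \<kappa>) / (lam * gf v0 m ?x)"
      have d: "0 < ?d" using 4 lam_pos G_pos[of ?x] by simp
      have "\<kappa> < lam * haz ?x s'" if s': "s - ?d < s'" "s' \<le> s" "0 \<le> s'" for s'
      proof -
        have "haz ?x s - haz ?x s' \<le> giant ?x s * (s - s')" by (rule haz_increment_bounds(2)[OF s'(3,2)])
        also have "\<dots> \<le> gf v0 m ?x * (s - s')" using s' by (intro mult_right_mono giant_le) auto
        finally have "lam * (haz ?x s - haz ?x s') \<le> lam * (gf v0 m ?x * (s - s'))"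
          using lam_pos by (intro mult_left_mono) auto
        moreover have "(lam * gf v0 m ?x) * (s - s') < (lam * gf v0 m ?x) * ?d"
          using s' lam_pos G_pos[of ?x] by (intro mult_strict_left_mono) auto
        moreover have "(lam * gf v0 m ?x) * ?d = lam * haz ?x s - \<kappa>"
          using lam_pos G_pos[of ?x] by simp
        ultimately show ?thesis by (simp add: algebra_simps)
      qed
      then have "\<omega> \<notin> Q s'" if "s - ?d < s'" "s' \<le> s" "0 \<le> s'" for s'
        using that by (force simp: Q_def)
      moreover have "\<omega> \<notin> Q s" using 4 by (simp add: Q_def)
      ultimately show ?thesis using d by blast
    qed
  qed
  moreover have "(\<integral>\<^sup>+\<omega>. (\<Sum>i=1..N T \<omega>. indicator (Q (b i \<omega>)) \<omega>) \<partial>\<Omega>) = (\<integral>\<^sup>+\<omega>. indicator {\<omega>\<in>B. b (Suc j) \<omega> < T \<and> hz j \<omega> \<le> \<kappa>} \<omega> \<partial>\<Omega>)"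
  proof (rule nn_integral_cong)
    fix \<omega> assume \<omega>: "\<omega> \<in> space \<Omega>"
    have "(\<Sum>i=1..N T \<omega>. indicator (Q (b i \<omega>)) \<omega> :: ennreal) = (\<Sum>i=1..N T \<omega>. if i = Suc j then indicator {\<omega>\<in>B. hz j \<omega> \<le> \<kappa>} \<omega> else 0)"
    proof (rule sum.cong)
      fix i
      show "(indicator (Q (b i \<omega>)) \<omega> :: ennreal) = (if i = Suc j then indicator {\<omega>\<in>B. hz j \<omega> \<le> \<kappa>} \<omega> else 0)"
        using only[OF \<omega>, of i] by (auto simp: Q_def hz_def indicator_def)
    qed simp
    also have "\<dots> = (if Suc j \<in> {1..N T \<omega>} then indicator {\<omega>\<in>B. hz j \<omega> \<le> \<kappa>} \<omega> else 0)" by (rule sum.delta) simp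
    also have "\<dots> = indicator {\<omega>\<in>B. b (Suc j) \<omega> < T \<and> hz j \<omega> \<le> \<kappa>} \<omega>"
      using Mc_ge_iff[OF bt[OF \<omega>], of "Suc j" T] by (auto simp: N_def indicator_def)
    finally show "(\<Sum>i=1..N T \<omega>. indicator (Q (b i \<omega>)) \<omega> :: ennreal) = \<dots>" .
  qed
  moreover have "(\<integral>\<^sup>+p. indicator {0..<T} (snd p) * indicator (Q (snd p)) (fst p) * ennreal (lam * thp (fst p) (snd p)) \<partial>?P) =
     (\<integral>\<^sup>+\<omega>. indicator B \<omega> * ennreal (min \<kappa> (lam * haz (S j \<omega>) (min T (b (Suc j) \<omega>)))) \<partial>\<Omega>)"
  proof -
    let ?f = "\<lambda>p. indicator {0..<T} (snd p) * indicator (Q (snd p)) (fst p) * ennreal (lam * thp (fst p) (snd p))"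
    have [measurable]: "(\<lambda>p. haz (S j (fst p)) (snd p)) \<in> borel_measurable ?P" by (intro haz_measurable) measurable
    have m: "{p\<in>space ?P. fst p \<in> B \<and> b j (fst p) < snd p \<and> snd p \<le> b (Suc j) (fst p) \<and> lam * haz (S j (fst p)) (snd p) \<le> \<kappa>} \<in> sets ?P"
      by measurable
    have "(\<lambda>p. indicator (Q (snd p)) (fst p) :: ennreal) \<in> borel_measurable ?P"
      using borel_measurable_indicator[OF m]
      by (rule measurable_cong[THEN iffD1, rotated]) (auto simp: Q_def indicator_def space_pair_measure)
    then have fm: "?f \<in> borel_measurable ?P" using thp_measurable by measurable
    have "(\<integral>\<^sup>+p. ?f p \<partial>?P) = (\<integral>\<^sup>+\<omega>. \<integral>\<^sup>+r. ?f (\<omega>, r) \<partial>lborel \<partial>\<Omega>)"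
      by (rule lborel.nn_integral_fst[OF fm, symmetric])
    also have "\<dots> = (\<integral>\<^sup>+\<omega>. indicator B \<omega> * ennreal (min \<kappa> (lam * haz (S j \<omega>) (min T (b (Suc j) \<omega>)))) \<partial>\<Omega>)"
    proof (rule nn_integral_cong)
      fix \<omega> assume \<omega>: "\<omega> \<in> space \<Omega>"
      let ?x = "S j \<omega>" and ?T = "min T (b (Suc j) \<omega>)"
      have b0: "0 \<le> b i \<omega>" for i by (rule burning_timesD(5)[OF bt[OF \<omega>]])
      have "(\<integral>\<^sup>+r. ?f (\<omega>, r) \<partial>lborel) = (\<integral>\<^sup>+r. indicator B \<omega> * (indicator {r. b j \<omega> < r \<and> r \<le> ?T \<and> lam * haz ?x r \<le> \<kappa>} r * ennreal (lam * giant ?x r)) \<partial>lborel)"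
      proof (rule nn_integral_cong_AE)
        have "AE r in lborel. r \<noteq> T" by (rule AE_lborel_singleton)
        then show "AE r in lborel. ?f (\<omega>, r) = indicator B \<omega> * (indicator {r. b j \<omega> < r \<and> r \<le> ?T \<and> lam * haz ?x r \<le> \<kappa>} r * ennreal (lam * giant ?x r))"
        proof eventually_elim
          case (elim r)
          have "b j \<omega> < r \<Longrightarrow> r \<le> b (Suc j) \<omega> \<Longrightarrow> N r \<omega> = j"
            unfolding N_def by (rule Mc_eqI[OF bt[OF \<omega>]])
          then show ?case using elim b0[of j] by (auto simp: Q_def indicator_def thp_def)
        qed
      qed
      also have "\<dots> = indicator B \<omega> * (\<integral>\<^sup>+r. indicator {r. b j \<omega> < r \<and> r \<le> ?T \<and> lam * haz ?x r \<le> \<kappa>} r * ennreal (lam * giant ?x r) \<partial>lborel)"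
      proof (rule nn_integral_cmult)
        have [measurable]: "(\<lambda>r. haz ?x r) \<in> borel_measurable borel" "(\<lambda>r. giant ?x r) \<in> borel_measurable borel"
          by (intro haz_measurable giant_measurable borel_measurable_const measurable_ident_sets refl)+
        show "(\<lambda>r. indicator {r. b j \<omega> < r \<and> r \<le> ?T \<and> lam * haz ?x r \<le> \<kappa>} r * ennreal (lam * giant ?x r)) \<in> borel_measurable lborel"
          by measurable
      qed
      also have "(\<integral>\<^sup>+r. indicator {r. b j \<omega> < r \<and> r \<le> ?T \<and> lam * haz ?x r \<le> \<kappa>} r * ennreal (lam * giant ?x r) \<partial>lborel) = ennreal (min \<kappa> (lam * haz ?x ?T))"
        using b0[of "Suc j"] T by (intro capped_hazard lam_pos \<kappa> b_le_gel \<omega>) simp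
      finally show "(\<integral>\<^sup>+r. ?f (\<omega>, r) \<partial>lborel) = indicator B \<omega> * ennreal (min \<kappa> (lam * haz ?x ?T))" .
    qed
    finally show ?thesis .
  qed
  ultimately show ?thesis by simp
qed

lemma hz_nonneg: "0 \<le> hz j \<omega>"
  using lam_pos haz_nonneg by (simp add: hz_def)

text \<open>The horizon T tends to infinity along the integers: for each outcome the next burning is
  eventually before T.\<close>

lemma hazard_truncated_mean:
  assumes B: "B \<in> sets (past j)" and \<kappa>: "0 \<le> \<kappa>"
  shows "(\<integral>\<^sup>+\<omega>. indicator {\<omega>\<in>B. hz j \<omega> \<le> \<kappa>} \<omega> \<partial>\<Omega>) = (\<integral>\<^sup>+\<omega>. indicator B \<omega> * ennreal (min \<kappa> (hz j \<omega>)) \<partial>\<Omega>)"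
proof -
  have Bev[measurable]: "B \<in> sets \<Omega>" using B past_subset by blast
  have ev: "eventually (\<lambda>n. b (Suc j) \<omega> < real (Suc n)) sequentially" for \<omega>
    using filterlim_compose[OF filterlim_real_sequentially filterlim_Suc] by (simp add: filterlim_at_top_dense)
  have "(\<lambda>n. \<integral>\<^sup>+\<omega>. indicator {\<omega>\<in>B. b (Suc j) \<omega> < real (Suc n) \<and> hz j \<omega> \<le> \<kappa>} \<omega> \<partial>\<Omega>) \<longlonglongrightarrow> (\<integral>\<^sup>+\<omega>. indicator {\<omega>\<in>B. hz j \<omega> \<le> \<kappa>} \<omega> \<partial>\<Omega>)"
  proof (rule nn_integral_dominated_convergence[where w="\<lambda>_. 1"])
    show "AE \<omega> in \<Omega>. (\<lambda>n. indicator {\<omega>\<in>B. b (Suc j) \<omega> < real (Suc n) \<and> hz j \<omega> \<le> \<kappa>} \<omega> :: ennreal) \<longlonglongrightarrow> indicator {\<omega>\<in>B. hz j \<omega> \<le> \<kappa>} \<omega>"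
    proof (rule AE_I2)
      fix \<omega>
      show "(\<lambda>n. indicator {\<omega>\<in>B. b (Suc j) \<omega> < real (Suc n) \<and> hz j \<omega> \<le> \<kappa>} \<omega> :: ennreal) \<longlonglongrightarrow> indicator {\<omega>\<in>B. hz j \<omega> \<le> \<kappa>} \<omega>"
        by (rule tendsto_eventually, rule eventually_mono[OF ev[of \<omega>]]) (auto simp: indicator_def)
    qed
    show "(\<lambda>\<omega>. indicator {\<omega>\<in>B. hz j \<omega> \<le> \<kappa>} \<omega> :: ennreal) \<in> borel_measurable \<Omega>" by measurable
    show "(\<lambda>\<omega>. indicator {\<omega>\<in>B. b (Suc j) \<omega> < real (Suc n) \<and> hz j \<omega> \<le> \<kappa>} \<omega> :: ennreal) \<in> borel_measurable \<Omega>" for n by measurable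
  qed (auto simp: indicator_def emeasure_space_1)
  moreover have "(\<lambda>n. \<integral>\<^sup>+\<omega>. indicator B \<omega> * ennreal (min \<kappa> (lam * haz (S j \<omega>) (min (real (Suc n)) (b (Suc j) \<omega>)))) \<partial>\<Omega>)
     \<longlonglongrightarrow> (\<integral>\<^sup>+\<omega>. indicator B \<omega> * ennreal (min \<kappa> (hz j \<omega>)) \<partial>\<Omega>)"
  proof (rule nn_integral_dominated_convergence[where w="\<lambda>_. ennreal \<kappa>"])
    show "AE \<omega> in \<Omega>. (\<lambda>n. indicator B \<omega> * ennreal (min \<kappa> (lam * haz (S j \<omega>) (min (real (Suc n)) (b (Suc j) \<omega>))))) \<longlonglongrightarrow> indicator B \<omega> * ennreal (min \<kappa> (hz j \<omega>))"
    proof (rule AE_I2)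
      fix \<omega>
      show "(\<lambda>n. indicator B \<omega> * ennreal (min \<kappa> (lam * haz (S j \<omega>) (min (real (Suc n)) (b (Suc j) \<omega>))))) \<longlonglongrightarrow> indicator B \<omega> * ennreal (min \<kappa> (hz j \<omega>))"
        by (rule tendsto_eventually, rule eventually_mono[OF ev[of \<omega>]]) (simp add: hz_def min_absorb2 del: of_nat_Suc)
    qed
    show "AE \<omega> in \<Omega>. indicator B \<omega> * ennreal (min \<kappa> (lam * haz (S j \<omega>) (min (real (Suc n)) (b (Suc j) \<omega>)))) \<le> ennreal \<kappa>" for n
      by (rule AE_I2) (auto simp: indicator_def intro!: ennreal_leI)
    have [measurable]: "(\<lambda>\<omega>. haz (S j \<omega>) (min (real (Suc n)) (b (Suc j) \<omega>))) \<in> borel_measurable \<Omega>" for n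
      by (intro haz_measurable) measurable
    show "(\<lambda>\<omega>. indicator B \<omega> * ennreal (min \<kappa> (lam * haz (S j \<omega>) (min (real (Suc n)) (b (Suc j) \<omega>))))) \<in> borel_measurable \<Omega>" for n
      by measurable
    show "(\<lambda>\<omega>. indicator B \<omega> * ennreal (min \<kappa> (hz j \<omega>))) \<in> borel_measurable \<Omega>" by measurable
    show "(\<integral>\<^sup>+\<omega>. ennreal \<kappa> \<partial>\<Omega>) < \<infinity>" by (subst nn_integral_const) (simp add: emeasure_space_1)
  qed simp
  ultimately show ?thesis
    using hazard_truncated_horizon[OF B \<kappa>, of "real (Suc n)" for n] by (intro LIMSEQ_unique) (simp_all del: of_nat_Suc)
qed

text \<open>By Fubini the capped mean is the integral of the survival function over {0..\<kappa>}.
  So the survival function is P(B) minus its own integral and decays exponentially. As B ranges over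
  all of \<open>past j\<close>, this contains independence as well.\<close>

lemma hazard_law:
  assumes B: "B \<in> sets (past j)" and \<kappa>: "0 \<le> \<kappa>"
  shows "prob {\<omega>\<in>B. \<kappa> < hz j \<omega>} = prob B * exp (- \<kappa>)"
proof -
  have Bev[measurable]: "B \<in> sets \<Omega>" using B past_subset by blast
  have Bsp: "B \<subseteq> space \<Omega>" using Bev sets.sets_into_space by blast
  have ev[measurable]: "{\<omega>\<in>B. u < hz j \<omega>} \<in> sets \<Omega>" "{\<omega>\<in>B. hz j \<omega> \<le> u} \<in> sets \<Omega>" for u 
  proof -
    have "{\<omega>\<in>B. u < hz j \<omega>} = B \<inter> {\<omega>\<in>space \<Omega>. u < hz j \<omega>}" "{\<omega>\<in>B. hz j \<omega> \<le> u} = B \<inter> {\<omega>\<in>space \<Omega>. hz j \<omega> \<le> u}"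
      using Bsp by auto
    then show "{\<omega>\<in>B. u < hz j \<omega>} \<in> sets \<Omega>" "{\<omega>\<in>B. hz j \<omega> \<le> u} \<in> sets \<Omega>" by auto
  qed
  define Sv where "Sv u = prob {\<omega>\<in>B. u < hz j \<omega>}" for u
  have Sv01: "0 \<le> Sv u" "Sv u \<le> 1" for u by (auto simp: Sv_def)
  have anti: "antimono Sv"
    unfolding Sv_def by (intro antimonoI finite_measure_mono) auto
  have Sm[measurable]: "Sv \<in> borel_measurable borel"
  proof -
    have "(\<lambda>u. - Sv u) \<in> borel_measurable borel"
      using anti by (intro borel_measurable_mono) (auto simp: mono_def antimono_def)
    then show ?thesis using borel_measurable_uminus_eq by blast
  qed
  have "(Sv has_integral (prob B - Sv t)) {0..t}" if t: "0 \<le> t" for t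
  proof -
    have "ennreal (prob B - Sv t) = (\<integral>\<^sup>+\<omega>. indicator {\<omega>\<in>B. hz j \<omega> \<le> t} \<omega> \<partial>\<Omega>)"
    proof -
      have "{\<omega>\<in>B. hz j \<omega> \<le> t} = B - {\<omega>\<in>B. t < hz j \<omega>}" by auto
      then have "prob {\<omega>\<in>B. hz j \<omega> \<le> t} = prob B - Sv t"
        unfolding Sv_def by (simp only:) (rule finite_measure_Diff, auto)
      then show ?thesis by (simp add: emeasure_eq_measure)
    qed
    also have "\<dots> = (\<integral>\<^sup>+\<omega>. indicator B \<omega> * ennreal (min t (hz j \<omega>)) \<partial>\<Omega>)"
      by (rule hazard_truncated_mean[OF B t])
    also have "\<dots> = (\<integral>\<^sup>+\<omega>. \<integral>\<^sup>+u. indicator {0..<t} u * indicator {\<omega>\<in>B. u < hz j \<omega>} \<omega> \<partial>lborel \<partial>\<Omega>)"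
    proof (rule nn_integral_cong)
      fix \<omega>
      have "(\<integral>\<^sup>+u. indicator {0..<t} u * indicator {\<omega>\<in>B. u < hz j \<omega>} \<omega> \<partial>lborel) = (\<integral>\<^sup>+u. indicator B \<omega> * indicator {0..<min t (hz j \<omega>)} u \<partial>lborel)"
        by (rule nn_integral_cong) (auto simp: indicator_def)
      also have "\<dots> = indicator B \<omega> * ennreal (min t (hz j \<omega>))"
        using t hz_nonneg[of j \<omega>] by (subst nn_integral_cmult_indicator) auto
      finally show "indicator B \<omega> * ennreal (min t (hz j \<omega>)) = (\<integral>\<^sup>+u. indicator {0..<t} u * indicator {\<omega>\<in>B. u < hz j \<omega>} \<omega> \<partial>lborel)" by simp
    qed
    also have "\<dots> = (\<integral>\<^sup>+u. \<integral>\<^sup>+\<omega>. indicator {0..<t} u * indicator {\<omega>\<in>B. u < hz j \<omega>} \<omega> \<partial>\<Omega> \<partial>lborel)"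
    proof (rule pair_sigma_finite.Fubini')
      show "pair_sigma_finite lborel \<Omega>" by unfold_locales
      have "{p\<in>space (lborel \<Otimes>\<^sub>M \<Omega>). snd p \<in> B \<and> fst p < hz j (snd p)} \<in> sets (lborel \<Otimes>\<^sub>M \<Omega>)" by measurable
      from borel_measurable_indicator[OF this]
      have "(\<lambda>p. indicator {0..<t} (fst p) * indicator {p\<in>space (lborel \<Otimes>\<^sub>M \<Omega>). snd p \<in> B \<and> fst p < hz j (snd p)} p :: ennreal) \<in> borel_measurable (lborel \<Otimes>\<^sub>M \<Omega>)"
        by measurable
      then show "(\<lambda>(u, \<omega>). indicator {0..<t} u * indicator {\<omega>\<in>B. u < hz j \<omega>} \<omega> :: ennreal) \<in> borel_measurable (lborel \<Otimes>\<^sub>M \<Omega>)"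
        by (rule measurable_cong[THEN iffD1, rotated]) (auto simp: indicator_def space_pair_measure)
    qed
    also have "\<dots> = (\<integral>\<^sup>+u. ennreal (indicator {0..t} u * Sv u) \<partial>lborel)"
    proof (rule nn_integral_cong_AE)
      have "AE u in lborel. u \<noteq> t" by (rule AE_lborel_singleton)
      then show "AE u in lborel. (\<integral>\<^sup>+\<omega>. indicator {0..<t} u * indicator {\<omega>\<in>B. u < hz j \<omega>} \<omega> \<partial>\<Omega>) = ennreal (indicator {0..t} u * Sv u)"
      proof eventually_elim
        case (elim u)
        have "(\<integral>\<^sup>+\<omega>. indicator {0..<t} u * indicator {\<omega>\<in>B. u < hz j \<omega>} \<omega> \<partial>\<Omega>) = indicator {0..<t} u * ennreal (Sv u)"
          by (subst nn_integral_cmult_indicator) (auto simp: Sv_def emeasure_eq_measure)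
        then show ?case using elim by (auto simp: indicator_def)
      qed
    qed
    finally have eq: "(\<integral>\<^sup>+u. ennreal (indicator {0..t} u * Sv u) \<partial>lborel) = ennreal (prob B - Sv t)" by simp
    have "Sv t \<le> prob B" unfolding Sv_def by (intro finite_measure_mono) auto
    then have "((\<lambda>u. indicator {0..t} u * Sv u) has_integral (prob B - Sv t)) UNIV"
      using eq Sv01 by (intro nn_integral_has_integral) auto
    moreover have "(\<lambda>u. indicator {0..t} u * Sv u) = (\<lambda>u. if u \<in> {0..t} then Sv u else 0)" by (auto simp: indicator_def)
    ultimately show ?thesis by (simp only: has_integral_restrict_UNIV)
  qed
  from exponential_decay[OF this \<kappa>] show ?thesis by (simp add: Sv_def)
qed

end

section \<open>Independent exponential hazards\<close>

text \<open>The limit in the theorem as a function of the cut-off: the tail of a Maxwell density,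
  which is the size-biased law of the square root of an exponential variable.\<close>

definition tail_mass :: "real \<Rightarrow> real" where
  "tail_mass y = integral {y..} (\<lambda>u. 4 / sqrt pi * u\<^sup>2 * exp (- (u\<^sup>2)))"

lemma tail_density_integrable: "0 \<le> y \<Longrightarrow> set_integrable lborel {y..} (\<lambda>u. 4 / sqrt pi * u\<^sup>2 * exp (- (u\<^sup>2)))"
  and tail_mass_lborel: "0 \<le> y \<Longrightarrow> tail_mass y = (LINT u|lborel. indicator {y..} u * (4 / sqrt pi * u\<^sup>2 * exp (- (u\<^sup>2))))"
  and tail_mass_0: "tail_mass 0 = 1"
proof -
  let ?f = "\<lambda>u::real. 4 / sqrt pi * u\<^sup>2 * exp (- (u\<^sup>2))"
  have "has_bochner_integral lborel (\<lambda>u::real. indicator {0..} u *\<^sub>R (exp (-u\<^sup>2) * u^(2 * 1)))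
       ((sqrt pi / 2) * (fact (2 * 1) / (2 ^ (2 * 1) * fact 1)))" by (rule gaussian_moment_even_pos)
  then have "has_bochner_integral lborel (\<lambda>u::real. (4 / sqrt pi) * (indicator {0..} u *\<^sub>R (exp (-u\<^sup>2) * u^(2 * 1))))
       ((4 / sqrt pi) * ((sqrt pi / 2) * (fact (2 * 1) / (2 ^ (2 * 1) * fact 1))))"
    by (intro has_bochner_integral_mult_right) simp
  moreover have "(\<lambda>u::real. (4 / sqrt pi) * (indicator {0..} u *\<^sub>R (exp (-u\<^sup>2) * u^(2 * 1)))) = (\<lambda>u. indicator {0..} u *\<^sub>R ?f u)"
    by (auto simp: mult_ac)
  moreover have "(4 / sqrt pi) * ((sqrt pi / 2) * (fact (2 * 1) / (2 ^ (2 * 1) * fact 1))) = (1::real)"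
    by (simp add: fact_numeral)
  ultimately have hb: "has_bochner_integral lborel (\<lambda>u. indicator {0..} u *\<^sub>R ?f u) 1" by simp
  then have int0: "set_integrable lborel {0..} ?f"
    unfolding set_integrable_def by (rule integrable.intros)
  show int: "set_integrable lborel {y..} ?f" if "0 \<le> y" for y
    by (rule set_integrable_subset[OF int0]) (use that in auto)
  show eq: "tail_mass y = (LINT u|lborel. indicator {y..} u * ?f u)" if "0 \<le> y" for y
    using set_borel_integral_eq_integral(2)[OF int[OF that]] by (simp add: tail_mass_def set_lebesgue_integral_def)
  show "tail_mass 0 = 1"
    using eq[OF order_refl] has_bochner_integral_integral_eq[OF hb] by (simp only: real_scaleR_def)
qed

lemma tail_mass_bounds:
  assumes "0 \<le> y"
  shows "0 \<le> tail_mass y" "tail_mass y \<le> 1"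
proof -
  let ?f = "\<lambda>u::real. 4 / sqrt pi * u\<^sup>2 * exp (- (u\<^sup>2))"
  have nn: "0 \<le> ?f u" for u by simp
  show "0 \<le> tail_mass y" unfolding tail_mass_lborel[OF assms]
    by (intro integral_nonneg_AE AE_I2 mult_nonneg_nonneg nn) simp
  have "tail_mass y \<le> tail_mass 0" unfolding tail_mass_lborel[OF assms] tail_mass_lborel[OF order_refl]
  proof (rule integral_mono)
    show "integrable lborel (\<lambda>u. indicator {y..} u * ?f u)" "integrable lborel (\<lambda>u. indicator {0..} u * ?f u)"
      using tail_density_integrable[OF assms] tail_density_integrable[OF order_refl] by (simp_all add: set_integrable_def)
    show "indicator {y..} u * ?f u \<le> indicator {0..} u * ?f u" for u
      by (intro mult_right_mono nn) (use assms in \<open>auto simp: indicator_def\<close>)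
  qed
  then show "tail_mass y \<le> 1" by (simp add: tail_mass_0)
qed

lemma continuous_on_tail_mass: "continuous_on {0..} tail_mass"
proof -
  let ?f = "\<lambda>u::real. 4 / sqrt pi * u\<^sup>2 * exp (- (u\<^sup>2))"
  have fc: "continuous_on S ?f" for S by (intro continuous_intros)
  have eq: "tail_mass y = 1 - integral {0..y} ?f" if y: "0 \<le> y" for y
  proof -
    have i0: "(?f has_integral tail_mass y) {y..}"
      unfolding tail_mass_def
      by (rule integrable_integral[OF set_borel_integral_eq_integral(1)[OF tail_density_integrable[OF y]]])
    have i1: "(?f has_integral integral {0..y} ?f) {0..y}"
      by (intro integrable_integral integrable_continuous_real fc)
    have "{0..y} \<inter> {y..} = {y}" using y by auto
    then have "negligible ({0..y} \<inter> {y..})" by simp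
    then have "(?f has_integral integral {0..y} ?f + tail_mass y) ({0..y} \<union> {y..})"
      by (rule has_integral_Un[OF i1 i0])
    moreover have "{0..y} \<union> {y..} = {0..}" using y by auto
    ultimately have "(?f has_integral integral {0..y} ?f + tail_mass y) {0..}" by (simp only:)
    then have "tail_mass 0 = integral {0..y} ?f + tail_mass y"
      unfolding tail_mass_def[of 0] by (rule integral_unique)
    then show ?thesis by (simp add: tail_mass_0)
  qed
  have "continuous_on {0..R} tail_mass" for R
  proof -
    have "continuous_on {0..R} (\<lambda>y. 1 - integral {0..y} ?f)"
      by (intro continuous_intros indefinite_integral_continuous_1 integrable_continuous_real fc)
    then show ?thesis by (rule continuous_on_eq) (simp add: eq)
  qed
  then show ?thesis
    unfolding continuous_on_eq_continuous_within
  proof (intro ballI)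
    fix y :: real assume c: "\<And>R. \<forall>x\<in>{0..R}. continuous (at x within {0..R}) tail_mass" and y: "y \<in> {0..}"
    have "continuous (at y within {0..y+1}) tail_mass" using c y by auto
    moreover have "at y within {0..y+1} = at y within {0..}"
      by (rule at_within_nhd[of _ "{..<y+1}"]) auto
    ultimately show "continuous (at y within {0..}) tail_mass" by (simp add: continuous_within)
  qed
qed

text \<open>The inverse of the probability that an exponential variable exceeds c / (4 a^2), where a
  and c are lower and upper bounds of the rate. A cycle that stays in a block of width 1 / sqrt lam
  cannot gather more hazard than that.\<close>

definition visit_bound :: "real \<Rightarrow> real \<Rightarrow> real" where "visit_bound a c = exp (c / (4 * a\<^sup>2))"

lemma visit_bound_pos: "0 < visit_bound a c" by (simp add: visit_bound_def)

context random_burning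
begin

text \<open>The events on which \<open>hz j\<close> exceeds a level are stable under intersection
  and generate its sigma-algebra. On them \<open>hazard_law\<close> is the product formula.\<close>

lemma hz_independent:
  assumes Z: "Z \<in> borel_measurable (past j)"
  shows "indep_var borel Z borel (hz j)"
proof -
  let ?B = "range (\<lambda>\<kappa>::real. {\<omega>\<in>space \<Omega>. \<kappa> < hz j \<omega>})"
  have sp: "space \<Omega> \<in> sets (past j)" using sets.top[of "past j"] by simp
  have tailp: "prob (a \<inter> {\<omega>\<in>space \<Omega>. \<kappa> < hz j \<omega>}) = prob a * prob {\<omega>\<in>space \<Omega>. \<kappa> < hz j \<omega>}" if a: "a \<in> sets (past j)" for a \<kappa>
  proof (cases "0 \<le> \<kappa>")
    case True
    have "a \<subseteq> space \<Omega>" using sets.sets_into_space[OF a] by simp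
    then have "a \<inter> {\<omega>\<in>space \<Omega>. \<kappa> < hz j \<omega>} = {\<omega>\<in>a. \<kappa> < hz j \<omega>}" by auto
    then show ?thesis using hazard_law[OF a True] hazard_law[OF sp True] by (simp add: prob_space)
  next
    case False
    then have "{\<omega>\<in>space \<Omega>. \<kappa> < hz j \<omega>} = space \<Omega>" using hz_nonneg[of j] by (auto simp: not_le intro: less_le_trans)
    moreover have "a \<inter> space \<Omega> = a" using sets.sets_into_space[OF a] by auto
    ultimately show ?thesis by (simp add: prob_space)
  qed
  have "indep_set (sets (past j)) ?B"
    by (rule indep_setI) (use past_subset tailp in auto)
  moreover have "Int_stable ?B"
  proof (rule Int_stableI)
    fix c d assume "c \<in> ?B" "d \<in> ?B"
    then obtain r s where "c = {\<omega>\<in>space \<Omega>. r < hz j \<omega>}" "d = {\<omega>\<in>space \<Omega>. s < hz j \<omega>}" by auto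
    then have "c \<inter> d = {\<omega>\<in>space \<Omega>. max r s < hz j \<omega>}" by auto
    then show "c \<inter> d \<in> ?B" by (rule image_eqI) simp
  qed
  ultimately have "indep_set (sigma_sets (space \<Omega>) (sets (past j))) (sigma_sets (space \<Omega>) ?B)"
    by (intro indep_set_sigma_sets sets.Int_stable)
  then have I: "indep_sets (case_bool (sigma_sets (space \<Omega>) (sets (past j))) (sigma_sets (space \<Omega>) ?B)) UNIV"
    unfolding indep_set_def .
  have hzB: "hz j \<in> borel_measurable (sigma (space \<Omega>) ?B)"
    unfolding borel_measurable_iff_greater
  proof (intro allI)
    fix a
    have "{\<omega>\<in>space \<Omega>. a < hz j \<omega>} \<in> sigma_sets (space \<Omega>) ?B" by (rule sigma_sets.Basic) auto
    then show "{\<omega>\<in>space (sigma (space \<Omega>) ?B). a < hz j \<omega>} \<in> sets (sigma (space \<Omega>) ?B)"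
      by (subst sets_measure_of) (auto simp: space_measure_of_conv)
  qed
  have "indep_set (sigma_sets (space \<Omega>) {Z -` A \<inter> space \<Omega> | A. A \<in> sets borel})
      (sigma_sets (space \<Omega>) {hz j -` A \<inter> space \<Omega> | A. A \<in> sets borel})"
    unfolding indep_set_def
  proof (rule indep_sets_mono_sets[OF I])
    fix i :: bool
    have 1: "sigma_sets (space \<Omega>) {Z -` A \<inter> space \<Omega> | A. A \<in> sets borel} \<subseteq> sigma_sets (space \<Omega>) (sets (past j))"
      using measurable_sets[OF Z] by (intro sigma_sets_mono') auto
    have hzs: "hz j -` A \<inter> space \<Omega> \<in> sigma_sets (space \<Omega>) ?B" if "A \<in> sets borel" for A
    proof -
      have "hz j -` A \<inter> space (sigma (space \<Omega>) ?B) \<in> sets (sigma (space \<Omega>) ?B)"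
        by (rule measurable_sets[OF hzB that])
      then show ?thesis by (subst (asm) sets_measure_of) (auto simp: space_measure_of_conv)
    qed
    have 2: "sigma_sets (space \<Omega>) {hz j -` A \<inter> space \<Omega> | A. A \<in> sets borel} \<subseteq> sigma_sets (space \<Omega>) ?B"
      using hzs by (intro sigma_sets_mono) auto
    show "(case i of True \<Rightarrow> sigma_sets (space \<Omega>) {Z -` A \<inter> space \<Omega> | A. A \<in> sets borel}
           | False \<Rightarrow> sigma_sets (space \<Omega>) {hz j -` A \<inter> space \<Omega> | A. A \<in> sets borel})
       \<subseteq> (case i of True \<Rightarrow> sigma_sets (space \<Omega>) (sets (past j)) | False \<Rightarrow> sigma_sets (space \<Omega>) ?B)"
      using 1 2 by (cases i) auto
  qed
  moreover have "Z \<in> borel_measurable \<Omega>"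
    by (rule measurable_mono[THEN subsetD, OF _ _ _ _ Z]) (use past_subset in auto)
  ultimately show ?thesis unfolding indep_var_eq using hz_measurable by blast
qed

lemma hz_tail: "0 \<le> \<kappa> \<Longrightarrow> prob {\<omega>\<in>space \<Omega>. \<kappa> < hz j \<omega>} = exp (- \<kappa>)"
  using hazard_law[of "space \<Omega>" j \<kappa>] sets.top[of "past j"] by (simp add: prob_space)

lemma hz_cdf: "0 \<le> \<kappa> \<Longrightarrow> prob {\<omega>\<in>space \<Omega>. hz j \<omega> \<le> \<kappa>} = 1 - exp (- \<kappa>)"
proof -
  assume k: "0 \<le> \<kappa>"
  have "{\<omega>\<in>space \<Omega>. hz j \<omega> \<le> \<kappa>} = space \<Omega> - {\<omega>\<in>space \<Omega>. \<kappa> < hz j \<omega>}" by auto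
  then show ?thesis using prob_compl[of "{\<omega>\<in>space \<Omega>. \<kappa> < hz j \<omega>}"] hz_tail[OF k, of j] by simp
qed

lemma hz_exponential: "distributed \<Omega> lborel (hz j) (exponential_density 1)"
  by (subst exponential_distributed_iff) (auto simp: hz_cdf)

lemma hz_mean: "expectation (hz j) = 1" "integrable \<Omega> (hz j)"
proof -
  show 1: "expectation (hz j) = 1" using exponential_distributed_expectation[OF _ hz_exponential[of j]] by simp
  show "integrable \<Omega> (hz j)" using 1 not_integrable_integral_eq by fastforce
qed

section \<open>Square roots of hazards and their centred truncations\<close>

definition Y :: "nat \<Rightarrow> 'a \<Rightarrow> real" where "Y j \<omega> = sqrt (hz j \<omega>)"

lemma Y_measurable[measurable]: "Y j \<in> borel_measurable \<Omega>"
  unfolding Y_def[abs_def] by measurable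

lemma Y_nonneg: "0 \<le> Y j \<omega>" by (simp add: Y_def hz_nonneg)
lemma Y_square: "(Y j \<omega>)\<^sup>2 = hz j \<omega>" by (simp add: Y_def hz_nonneg)

lemma Y_integrable: "integrable \<Omega> (Y j)"
  by (rule square_integrable_imp_integrable) (auto simp: Y_square hz_mean)

lemma Y_distributed: "distributed \<Omega> lborel (Y j) (\<lambda>u. if u < 0 then 0 else 2 * u * exp (- (u\<^sup>2)))"
proof (rule distributedI_borel_atMost[where g="\<lambda>a. if a < 0 then 0 else 1 - exp (- (a\<^sup>2))"])
  fix a :: real
  let ?h = "\<lambda>u::real. if u < 0 then 0 else 2 * u * exp (- (u\<^sup>2))"
  show "(\<integral>\<^sup>+u. ennreal (?h u * indicator {..a} u) \<partial>lborel) = ennreal (if a < 0 then 0 else 1 - exp (- (a\<^sup>2)))"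
  proof (cases "a < 0")
    case True
    have "(\<integral>\<^sup>+u. ennreal (?h u * indicator {..a} u) \<partial>lborel) = (\<integral>\<^sup>+u. 0 \<partial>(lborel::real measure))"
      by (rule nn_integral_cong) (use True in \<open>auto simp: indicator_def\<close>)
    then show ?thesis using True by simp
  next
    case False
    have "(\<integral>\<^sup>+u. ennreal (?h u * indicator {..a} u) \<partial>lborel) = (\<integral>\<^sup>+u. ennreal (2 * u * exp (- (u\<^sup>2))) * indicator {0..a} u \<partial>lborel)"
      by (rule nn_integral_cong) (auto simp: indicator_def)
    also have "\<dots> = (- exp (- (a\<^sup>2))) - (- exp (- (0\<^sup>2)))"
      by (rule nn_integral_FTC_Icc) (use False in \<open>auto intro!: derivative_eq_intros\<close>)
    finally show ?thesis using False by simp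
  qed
  show "emeasure \<Omega> {\<omega>\<in>space \<Omega>. Y j \<omega> \<le> a} = ennreal (if a < 0 then 0 else 1 - exp (- (a\<^sup>2)))"
  proof (cases "a < 0")
    case True
    then have "{\<omega>\<in>space \<Omega>. Y j \<omega> \<le> a} = {}" using Y_nonneg[of j] by (auto simp: not_le intro: less_le_trans)
    then show ?thesis using True by (simp only: if_True emeasure_empty ennreal_0)
  next
    case False
    then have "{\<omega>\<in>space \<Omega>. Y j \<omega> \<le> a} = {\<omega>\<in>space \<Omega>. hz j \<omega> \<le> a\<^sup>2}"
      by (auto simp: Y_def real_sqrt_le_iff intro: real_le_lsqrt hz_nonneg dest: sqrt_le_D)
    then show ?thesis using hz_cdf[of "a\<^sup>2" j] False by (simp add: emeasure_eq_measure)
  qed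
qed auto

text \<open>Weighting the density 2 u exp (- u^2) by u gives sqrt pi / 2 times the density in
  \<open>tail_mass\<close>; this is the source of the limit law.\<close>

lemma Y_truncated_mean:
  assumes y: "0 \<le> y"
  shows "expectation (\<lambda>\<omega>. Y j \<omega> * of_bool (y < Y j \<omega>)) = sqrt pi / 2 * tail_mass y"
proof -
  let ?h = "\<lambda>u::real. if u < 0 then 0 else 2 * u * exp (- (u\<^sup>2))"
  have m: "(\<lambda>u. u * of_bool (y < u)) \<in> borel_measurable lborel" by measurable
  have "expectation (\<lambda>\<omega>. Y j \<omega> * of_bool (y < Y j \<omega>)) = (LINT u|lborel. ?h u * (u * of_bool (y < u)))"
    by (rule distributed_integral[OF Y_distributed m, symmetric]) auto
  also have "\<dots> = (LINT u|lborel. sqrt pi / 2 * (indicator {y..} u * (4 / sqrt pi * u\<^sup>2 * exp (- (u\<^sup>2)))))"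
  proof (rule integral_cong_AE)
    have "AE u in lborel. u \<noteq> y" by (rule AE_lborel_singleton)
    then show "AE u in lborel. ?h u * (u * of_bool (y < u)) = sqrt pi / 2 * (indicator {y..} u * (4 / sqrt pi * u\<^sup>2 * exp (- (u\<^sup>2))))"
      by eventually_elim (use y in \<open>auto simp: indicator_def power2_eq_square\<close>)
  qed measurable
  also have "\<dots> = sqrt pi / 2 * tail_mass y" unfolding tail_mass_lborel[OF y] by (rule integral_mult_right_zero)
  finally show ?thesis .
qed

lemma Y_mean: "expectation (Y j) = sqrt pi / 2"
proof -
  have "expectation (Y j) = expectation (\<lambda>\<omega>. Y j \<omega> * of_bool (0 < Y j \<omega>))"
    using Y_nonneg[of j] by (intro Bochner_Integration.integral_cong) (auto simp: order_less_le)
  then show ?thesis using Y_truncated_mean[of 0 j] by (simp add: tail_mass_0)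
qed

text \<open>The fluctuation of the truncated burnt mass around the fraction \<open>tail_mass y\<close> of the
  total burnt mass; this choice of the fraction makes it centred.\<close>
definition fluct :: "real \<Rightarrow> nat \<Rightarrow> 'a \<Rightarrow> real" where
  "fluct y j \<omega> = Y j \<omega> * (of_bool (y < Y j \<omega>) - tail_mass y)"

lemma fluct_measurable[measurable]: "fluct y j \<in> borel_measurable \<Omega>"
  unfolding fluct_def[abs_def] by measurable

lemma fluct_props:
  assumes y: "0 \<le> y"
  shows "(fluct y j \<omega>)\<^sup>2 \<le> hz j \<omega>" "integrable \<Omega> (fluct y j)" "expectation (fluct y j) = 0"
    "integrable \<Omega> (\<lambda>\<omega>. (fluct y j \<omega>)\<^sup>2)"
proof -
  have sq: "(fluct y j \<omega>)\<^sup>2 \<le> hz j \<omega>" for \<omega>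
  proof -
    have "\<bar>of_bool (y < Y j \<omega>) - tail_mass y\<bar> \<le> 1" using tail_mass_bounds[OF y] by auto
    then have "(of_bool (y < Y j \<omega>) - tail_mass y)\<^sup>2 \<le> 1" by (simp add: abs_square_le_1)
    then have "hz j \<omega> * (of_bool (y < Y j \<omega>) - tail_mass y)\<^sup>2 \<le> hz j \<omega> * 1"
      by (intro mult_left_mono hz_nonneg)
    then show ?thesis by (simp add: fluct_def power_mult_distrib Y_square)
  qed
  then show "(fluct y j \<omega>)\<^sup>2 \<le> hz j \<omega>" .
  show sqi: "integrable \<Omega> (\<lambda>\<omega>. (fluct y j \<omega>)\<^sup>2)"
    by (rule Bochner_Integration.integrable_bound[OF hz_mean(2)]) (use sq hz_nonneg in auto)
  show "integrable \<Omega> (fluct y j)" by (rule square_integrable_imp_integrable[OF _ sqi]) measurable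
  have i1: "integrable \<Omega> (\<lambda>\<omega>. Y j \<omega> * of_bool (y < Y j \<omega>))"
    by (rule Bochner_Integration.integrable_bound[OF Y_integrable]) (auto simp: abs_mult)
  have i2: "integrable \<Omega> (\<lambda>\<omega>. Y j \<omega> * tail_mass y)" using Y_integrable by simp
  have "expectation (fluct y j) = expectation (\<lambda>\<omega>. Y j \<omega> * of_bool (y < Y j \<omega>) - Y j \<omega> * tail_mass y)"
    by (simp add: fluct_def[abs_def] right_diff_distrib)
  also have "\<dots> = expectation (\<lambda>\<omega>. Y j \<omega> * of_bool (y < Y j \<omega>)) - expectation (\<lambda>\<omega>. Y j \<omega> * tail_mass y)"
    by (rule Bochner_Integration.integral_diff[OF i1 i2])
  also have "\<dots> = 0" by (simp only: integral_mult_left_zero Y_truncated_mean[OF y] Y_mean diff_self)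
  finally show "expectation (fluct y j) = 0" .
qed

lemma fluct_past: "i < j \<Longrightarrow> fluct y i \<in> borel_measurable (past j)"
proof -
  assume "i < j"
  then have [measurable]: "hz i \<in> borel_measurable (past j)" by (intro hz_past) simp
  show ?thesis unfolding fluct_def[abs_def] Y_def by measurable
qed

text \<open>The partial sum times the next indicator is measurable in \<open>past n\<close>, hence
  independent of the centred \<open>fluct y n\<close>, and the cross term vanishes. Each square is
  dominated by a hazard of mean 1 that is independent of the indicator.\<close>

lemma predictable_sum_second_moment:
  assumes W: "\<And>j. W j \<in> sets (past j)" and y: "0 \<le> y"
  shows "integrable \<Omega> (\<lambda>\<omega>. (\<Sum>j<n. indicator (W j) \<omega> * fluct y j \<omega>)\<^sup>2) \<and>
    expectation (\<lambda>\<omega>. (\<Sum>j<n. indicator (W j) \<omega> * fluct y j \<omega>)\<^sup>2) \<le> (\<Sum>j<n. prob (W j))"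
proof (induction n)
  case (Suc n)
  have Wev[measurable]: "W j \<in> sets \<Omega>" for j using W past_subset by blast
  let ?Z = "\<lambda>\<omega>. \<Sum>j<n. indicator (W j) \<omega> * fluct y j \<omega>"
  let ?I = "\<lambda>\<omega>. indicator (W n) \<omega> :: real"
  have Zp: "?Z \<in> borel_measurable (past n)"
  proof (intro borel_measurable_sum borel_measurable_times fluct_past)
    fix j assume j: "j \<in> {..<n}"
    then have "W j \<in> sets (past n)" using W past_mono[of j n] by auto
    then show "indicator (W j) \<in> borel_measurable (past n)" by (rule borel_measurable_indicator)
  qed auto
  have Ip: "?I \<in> borel_measurable (past n)" using W by (intro borel_measurable_indicator)
  have Zm[measurable]: "?Z \<in> borel_measurable \<Omega>" by measurable
  have Z2: "integrable \<Omega> (\<lambda>\<omega>. (?Z \<omega>)\<^sup>2)" using Suc by simp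
  have Zi: "integrable \<Omega> ?Z" by (rule square_integrable_imp_integrable[OF Zm Z2])
  have ZIi: "integrable \<Omega> (\<lambda>\<omega>. ?Z \<omega> * ?I \<omega>)"
    by (rule Bochner_Integration.integrable_bound[OF Zi], measurable, rule AE_I2, simp add: indicator_def)
  have Ii: "integrable \<Omega> ?I" by (rule integrable_const_bound[of _ 1]) (auto simp: indicator_def)
  have ind1: "indep_var borel (\<lambda>\<omega>. ?Z \<omega> * ?I \<omega>) borel (hz n)"
    by (intro hz_independent borel_measurable_times Zp Ip)
  have gm: "(\<lambda>e. sqrt e * (of_bool (y < sqrt e) - tail_mass y)) \<in> borel_measurable borel" by measurable
  have "indep_var borel ((\<lambda>z. z) \<circ> (\<lambda>\<omega>. ?Z \<omega> * ?I \<omega>)) borel ((\<lambda>e. sqrt e * (of_bool (y < sqrt e) - tail_mass y)) \<circ> hz n)"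
    by (rule indep_var_compose[OF ind1 _ gm]) simp
  then have ind2: "indep_var borel (\<lambda>\<omega>. ?Z \<omega> * ?I \<omega>) borel (fluct y n)"
    by (simp add: comp_def fluct_def[abs_def] Y_def)
  have cross: "integrable \<Omega> (\<lambda>\<omega>. (?Z \<omega> * ?I \<omega>) * fluct y n \<omega>)" "expectation (\<lambda>\<omega>. (?Z \<omega> * ?I \<omega>) * fluct y n \<omega>) = 0"
    using indep_var_integrable[OF ind2 ZIi fluct_props(2)[OF y]] indep_var_lebesgue_integral[OF ind2 ZIi fluct_props(2)[OF y]]
    by (simp_all add: fluct_props(3)[OF y])
  have ind3: "indep_var borel ?I borel (hz n)" by (rule hz_independent[OF Ip])
  have Ih: "integrable \<Omega> (\<lambda>\<omega>. ?I \<omega> * hz n \<omega>)" "expectation (\<lambda>\<omega>. ?I \<omega> * hz n \<omega>) = prob (W n)"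
    using indep_var_integrable[OF ind3 Ii hz_mean(2)] indep_var_lebesgue_integral[OF ind3 Ii hz_mean(2)]
    by (simp_all add: hz_mean(1))
  have sqi: "integrable \<Omega> (\<lambda>\<omega>. ?I \<omega> * (fluct y n \<omega>)\<^sup>2)"
    by (rule Bochner_Integration.integrable_bound[OF fluct_props(4)[OF y]]) (auto simp: indicator_def)
  have sql: "expectation (\<lambda>\<omega>. ?I \<omega> * (fluct y n \<omega>)\<^sup>2) \<le> prob (W n)"
    unfolding Ih(2)[symmetric] by (rule integral_mono[OF sqi Ih(1)]) (auto simp: indicator_def fluct_props[OF y])
  have eq: "(\<Sum>j<Suc n. indicator (W j) \<omega> * fluct y j \<omega>)\<^sup>2 = (?Z \<omega>)\<^sup>2 + 2 * ((?Z \<omega> * ?I \<omega>) * fluct y n \<omega>) + ?I \<omega> * (fluct y n \<omega>)\<^sup>2" for \<omega>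
    by (auto simp: indicator_def power2_eq_square algebra_simps)
  have i2: "integrable \<Omega> (\<lambda>\<omega>. 2 * ((?Z \<omega> * ?I \<omega>) * fluct y n \<omega>))" using cross(1) by (rule integrable_mult_right)
  have "expectation (\<lambda>\<omega>. (?Z \<omega>)\<^sup>2 + 2 * ((?Z \<omega> * ?I \<omega>) * fluct y n \<omega>) + ?I \<omega> * (fluct y n \<omega>)\<^sup>2)
     = expectation (\<lambda>\<omega>. (?Z \<omega>)\<^sup>2) + expectation (\<lambda>\<omega>. 2 * ((?Z \<omega> * ?I \<omega>) * fluct y n \<omega>)) + expectation (\<lambda>\<omega>. ?I \<omega> * (fluct y n \<omega>)\<^sup>2)"
    by (subst Bochner_Integration.integral_add[OF Bochner_Integration.integrable_add[OF Z2 i2] sqi])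
       (subst Bochner_Integration.integral_add[OF Z2 i2], rule refl)
  also have "expectation (\<lambda>\<omega>. 2 * ((?Z \<omega> * ?I \<omega>) * fluct y n \<omega>)) = 0"
    by (subst integral_mult_right_zero) (simp only: cross(2) mult_zero_right)
  finally show ?case unfolding eq
    using Suc sql Bochner_Integration.integrable_add[OF Bochner_Integration.integrable_add[OF Z2 i2] sqi] by simp
qed simp

section \<open>The mass after each burning: visits to blocks and crossings of levels\<close>

definition g :: "nat \<Rightarrow> 'a \<Rightarrow> real" where "g j \<omega> = gf v0 m (S j \<omega>)"

lemma g_past: "i \<le> j \<Longrightarrow> g i \<in> borel_measurable (past j)"
  unfolding g_def[abs_def] by (rule measurable_compose[OF S_past borel_measurable_G])

lemma g_measurable[measurable]: "g i \<in> borel_measurable \<Omega>"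
  unfolding g_def[abs_def] by measurable

lemma g_antimono: "i \<le> j \<Longrightarrow> g j \<omega> \<le> g i \<omega>"
  using S_mono[of i j \<omega>] by (simp add: g_def G_le_iff)

lemma g_le_0: "g j \<omega> \<le> gf v0 m 0"
  using S_nonneg[of j \<omega>] by (simp add: g_def G_le_iff)

lemma g_diff: "g j \<omega> - g (Suc j) \<omega> = giant (S j \<omega>) (b (Suc j) \<omega>)"
  by (simp add: g_def giant_def S_Suc)

lemma past_event: "{\<omega>\<in>space \<Omega>. \<gamma> \<le> g j \<omega> \<and> g j \<omega> < \<Gamma>} \<in> sets (past j)"
proof -
  have [measurable]: "g j \<in> borel_measurable (past j)" by (rule g_past) simp
  have "{\<omega>\<in>space (past j). \<gamma> \<le> g j \<omega> \<and> g j \<omega> < \<Gamma>} \<in> sets (past j)" by measurable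
  then show ?thesis by simp
qed

text \<open>Each visit to a block of width \<open>1 / sqrt lam\<close> is the last one with probability bounded
  below, and the last visits are disjoint events.\<close>
lemma block_visits:
  assumes a: "0 < a" and range: "\<And>z. 0 \<le> z \<Longrightarrow> z \<le> xr \<Longrightarrow> a \<le> rate z \<and> rate z \<le> c"
    and \<gamma>: "gf v0 m xr \<le> \<gamma>" and xr: "0 \<le> xr"
  shows "(\<Sum>j<n. prob {\<omega>\<in>space \<Omega>. \<gamma> \<le> g j \<omega> \<and> g j \<omega> < \<gamma> + 1 / sqrt lam}) \<le> visit_bound a c"
proof -
  define I where "I j = {\<omega>\<in>space \<Omega>. \<gamma> \<le> g j \<omega> \<and> g j \<omega> < \<gamma> + 1 / sqrt lam}" for j
  define D where "D j = I j - I (Suc j)" for j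
  have Iev[measurable]: "I j \<in> sets \<Omega>" for j unfolding I_def by measurable
  \<comment> \<open>A cycle that starts and ends in the block burns less than 1 / sqrt lam, so by
    \<open>haz_upper\<close> its hazard is at most this number. A larger hazard forces the mass out
    of the block.\<close>
  let ?k = "c / (4 * a\<^sup>2)"
  have c: "0 < c" using range[of 0] xr a by auto
  have k: "0 \<le> ?k" using c by simp
  have sub: "{\<omega>\<in>I j. ?k < hz j \<omega>} \<subseteq> D j" for j
  proof
    fix \<omega> assume \<omega>: "\<omega> \<in> {\<omega>\<in>I j. ?k < hz j \<omega>}"
    have "\<omega> \<notin> I (Suc j)"
    proof
      assume I': "\<omega> \<in> I (Suc j)"
      let ?th = "giant (S j \<omega>) (b (Suc j) \<omega>)"
      have "g (Suc j) \<omega> \<ge> gf v0 m xr" using I' \<gamma> by (simp add: I_def)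
      then have Sxr: "S (Suc j) \<omega> \<le> xr" by (simp add: g_def G_le_iff)
      have th: "?th < 1 / sqrt lam" using \<omega> I' g_diff[of j \<omega>] by (simp add: I_def)
      have "haz (S j \<omega>) (b (Suc j) \<omega>) \<le> c * ?th\<^sup>2 / (4 * a\<^sup>2)"
      proof (rule haz_upper[OF a])
        fix z assume "S j \<omega> \<le> z" "z \<le> burn (b (Suc j) \<omega>) (S j \<omega>)"
        then show "a \<le> rate z \<and> rate z \<le> c" using Sxr S_nonneg[of j \<omega>] by (intro range) (auto simp: S_Suc)
      qed
      then have "hz j \<omega> \<le> lam * (c * ?th\<^sup>2 / (4 * a\<^sup>2))"
        unfolding hz_def using lam_pos by (intro mult_left_mono) auto
      also have "\<dots> \<le> lam * (c * (1 / sqrt lam)\<^sup>2 / (4 * a\<^sup>2))"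
        using th c lam_pos giant_nonneg by (intro mult_left_mono divide_right_mono power_mono) auto
      also have "\<dots> = ?k" using lam_pos by (simp add: power_divide)
      finally show False using \<omega> by simp
    qed
    then show "\<omega> \<in> D j" using \<omega> by (simp add: D_def)
  qed
  have "prob (I j) * exp (- ?k) \<le> prob (D j)" for j
  proof -
    have "prob {\<omega>\<in>I j. ?k < hz j \<omega>} = prob (I j) * exp (- ?k)"
      unfolding I_def by (rule hazard_law[OF past_event k])
    then show ?thesis using finite_measure_mono[OF sub[of j]] by (simp add: D_def)
  qed
  then have "(\<Sum>j<n. prob (I j) * exp (- ?k)) \<le> (\<Sum>j<n. prob (D j))" by (rule sum_mono)
  also have "\<dots> = prob (\<Union>j\<in>{..<n}. D j)"
  proof (rule finite_measure_finite_Union[symmetric])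
    have "D i \<inter> D j = {}" if ij: "i < j" for i j
    proof (rule ccontr)
      assume "D i \<inter> D j \<noteq> {}"
      then obtain \<omega> where "\<omega> \<in> D i" "\<omega> \<in> D j" by auto
      then have "\<omega> \<in> I i" "\<omega> \<notin> I (Suc i)" "\<omega> \<in> I j" by (auto simp: D_def)
      then show False using g_antimono[of "Suc i" j \<omega>] g_antimono[of i "Suc i" \<omega>] ij by (auto simp: I_def)
    qed
    then show "disjoint_family_on D {..<n}" by (auto simp: disjoint_family_on_def) (metis Int_commute disjoint_iff linorder_neq_iff)
  qed (auto simp: D_def)
  also have "\<dots> \<le> 1" by simp
  finally have "(\<Sum>j<n. prob (I j)) * exp (- ?k) \<le> 1" by (simp add: sum_distrib_right)
  then have "(\<Sum>j<n. prob (I j)) \<le> exp ?k" by (simp add: exp_minus field_simps)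
  then show ?thesis by (simp add: I_def visit_bound_def)
qed

text \<open>At most sqrt lam (\<Gamma> - \<gamma>) + 1 blocks of width 1 / sqrt lam are needed to
  cover the interval, and each has a bounded expected number of visits.\<close>

lemma interval_visits:
  assumes a: "0 < a" and range: "\<And>z. 0 \<le> z \<Longrightarrow> z \<le> xr \<Longrightarrow> a \<le> rate z \<and> rate z \<le> c"
    and \<gamma>: "gf v0 m xr \<le> \<gamma>" "\<gamma> \<le> \<Gamma>" and xr: "0 \<le> xr"
  shows "(\<Sum>j<n. prob {\<omega>\<in>space \<Omega>. \<gamma> \<le> g j \<omega> \<and> g j \<omega> \<le> \<Gamma>}) \<le> visit_bound a c * (sqrt lam * (\<Gamma> - \<gamma>) + 1)"
proof -
  let ?h = "1 / sqrt lam"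
  have h: "0 < ?h" using lam_pos by simp
  define k where "k = nat \<lfloor>sqrt lam * (\<Gamma> - \<gamma>)\<rfloor>"
  have kb: "real k \<le> sqrt lam * (\<Gamma> - \<gamma>)" "sqrt lam * (\<Gamma> - \<gamma>) < real k + 1"
    using \<gamma> lam_pos by (auto simp: k_def)
  define I where "I i j = {\<omega>\<in>space \<Omega>. \<gamma> + real i * ?h \<le> g j \<omega> \<and> g j \<omega> < (\<gamma> + real i * ?h) + ?h}" for i j
  have cover: "{\<omega>\<in>space \<Omega>. \<gamma> \<le> g j \<omega> \<and> g j \<omega> \<le> \<Gamma>} \<subseteq> (\<Union>i\<in>{..k}. I i j)" for j
  proof
    fix \<omega> assume \<omega>: "\<omega> \<in> {\<omega>\<in>space \<Omega>. \<gamma> \<le> g j \<omega> \<and> g j \<omega> \<le> \<Gamma>}"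
    define i where "i = nat \<lfloor>sqrt lam * (g j \<omega> - \<gamma>)\<rfloor>"
    have ib: "real i \<le> sqrt lam * (g j \<omega> - \<gamma>)" "sqrt lam * (g j \<omega> - \<gamma>) < real i + 1"
      using \<omega> lam_pos by (auto simp: i_def)
    have "i \<le> k" unfolding i_def k_def using \<omega> lam_pos by (intro nat_mono floor_mono mult_left_mono) auto
    moreover have "\<omega> \<in> I i j" using \<omega> ib lam_pos by (auto simp: I_def field_simps)
    ultimately show "\<omega> \<in> (\<Union>i\<in>{..k}. I i j)" by auto
  qed
  have "(\<Sum>j<n. prob {\<omega>\<in>space \<Omega>. \<gamma> \<le> g j \<omega> \<and> g j \<omega> \<le> \<Gamma>}) \<le> (\<Sum>j<n. \<Sum>i\<le>k. prob (I i j))"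
  proof (rule sum_mono)
    fix j
    have "prob {\<omega>\<in>space \<Omega>. \<gamma> \<le> g j \<omega> \<and> g j \<omega> \<le> \<Gamma>} \<le> prob (\<Union>i\<in>{..k}. I i j)"
      by (rule finite_measure_mono[OF cover]) (auto simp: I_def)
    also have "\<dots> \<le> (\<Sum>i\<le>k. prob (I i j))"
      by (rule finite_measure_subadditive_finite) (auto simp: I_def)
    finally show "prob {\<omega>\<in>space \<Omega>. \<gamma> \<le> g j \<omega> \<and> g j \<omega> \<le> \<Gamma>} \<le> (\<Sum>i\<le>k. prob (I i j))" .
  qed
  also have "\<dots> = (\<Sum>i\<le>k. \<Sum>j<n. prob (I i j))" by (rule sum.swap)
  also have "\<dots> \<le> (\<Sum>i\<le>k. visit_bound a c)"
  proof (rule sum_mono)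
    fix i
    have "0 \<le> real i * ?h" using h by (intro mult_nonneg_nonneg) auto
    then have "gf v0 m xr \<le> \<gamma> + real i * ?h" using \<gamma>(1) by linarith
    from block_visits[OF a range this xr] show "(\<Sum>j<n. prob (I i j)) \<le> visit_bound a c" by (simp add: I_def)
  qed
  also have "\<dots> = visit_bound a c * (real k + 1)" by simp
  also have "\<dots> \<le> visit_bound a c * (sqrt lam * (\<Gamma> - \<gamma>) + 1)" using kb visit_bound_pos[of a c] by (intro mult_left_mono) auto
  finally show ?thesis .
qed

text \<open>The event that spoils the comparison at an end of the window. Both inequalities at the
  level are weak, so cycles that start or end exactly there are included.\<close>

definition straddle :: "real \<Rightarrow> real \<Rightarrow> nat \<Rightarrow> 'a set" where
  "straddle \<gamma> d j = {\<omega>\<in>space \<Omega>. g (Suc j) \<omega> \<le> \<gamma> \<and> \<gamma> \<le> g j \<omega> \<and> d < g j \<omega> - g (Suc j) \<omega>}"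

lemma straddle_event[measurable]: "straddle \<gamma> d j \<in> sets \<Omega>"
  unfolding straddle_def by measurable

text \<open>Straddling cycles are sorted by the number i of blocks between \<gamma> and their start.
  Such a cycle burns at least max d (i / sqrt lam), so its hazard exceeds q (lam d^2 + i). Given the
  past this has probability exp (- q lam d^2) exp (- q i); the number of starts in a block is
  bounded in mean, and the sum over i is geometric.\<close>

lemma straddle_prob:
  assumes a: "0 < a" and range: "\<And>z. 0 \<le> z \<Longrightarrow> z \<le> xr \<Longrightarrow> a \<le> rate z \<and> rate z \<le> c"
    and d: "0 < d" and \<gamma>: "gf v0 m xr \<le> \<gamma> - d" and \<gamma>0: "\<gamma> \<le> gf v0 m 0" and xr: "0 \<le> xr"
  defines "q \<equiv> a / (16 * c\<^sup>2)"
  shows "prob (\<Union>j\<in>{..<n}. straddle \<gamma> d j) \<le> visit_bound a c * exp (- (q * lam * d\<^sup>2)) / (1 - exp (- q))"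
proof -
  let ?h = "1 / sqrt lam"
  have h: "0 < ?h" using lam_pos by simp
  have c: "0 < c" using range[of 0] xr a by auto
  have q: "0 < q" using a c by (simp add: q_def)
  define k where "k = nat \<lfloor>sqrt lam * (gf v0 m 0 - \<gamma>)\<rfloor>"
  define I where "I i j = {\<omega>\<in>space \<Omega>. \<gamma> + real i * ?h \<le> g j \<omega> \<and> g j \<omega> < (\<gamma> + real i * ?h) + ?h}" for i j
  define \<kappa> where "\<kappa> i = q * (lam * d\<^sup>2 + real i)" for i
  have \<kappa>: "0 \<le> \<kappa> i" for i using q lam_pos by (simp add: \<kappa>_def)
  have Iev[measurable]: "I i j \<in> sets \<Omega>" for i j unfolding I_def by measurable
  have cover: "straddle \<gamma> d j \<subseteq> (\<Union>i\<in>{..k}. {\<omega>\<in>I i j. \<kappa> i < hz j \<omega>})" for j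
  proof
    fix \<omega> assume \<omega>: "\<omega> \<in> straddle \<gamma> d j"
    define i where "i = nat \<lfloor>sqrt lam * (g j \<omega> - \<gamma>)\<rfloor>"
    have g0: "0 \<le> g j \<omega> - \<gamma>" using \<omega> by (simp add: straddle_def)
    have ib: "real i \<le> sqrt lam * (g j \<omega> - \<gamma>)" "sqrt lam * (g j \<omega> - \<gamma>) < real i + 1"
      using g0 lam_pos by (auto simp: i_def)
    have "i \<le> k" unfolding i_def k_def using g_le_0[of j \<omega>] lam_pos by (intro nat_mono floor_mono mult_left_mono) auto
    moreover have Ii: "\<omega> \<in> I i j" using \<omega> ib lam_pos by (auto simp: I_def straddle_def field_simps)
    moreover have "\<kappa> i < hz j \<omega>"
    proof -
      \<comment> \<open>Only this portion of the burnt mass is used. The point z with mass g j - D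
        still lies left of xr, where the rate bounds hold, whereas the cycle itself may end
        beyond.\<close>
      define D where "D = max d (real i * ?h)"
      have Dle: "D \<le> g j \<omega> - g (Suc j) \<omega>" using \<omega> Ii by (auto simp: D_def straddle_def I_def)
      have D0: "0 < D" using d by (simp add: D_def)
      have "gf v0 m xr \<le> g j \<omega> - D" using \<gamma> d g0 Ii by (auto simp: D_def I_def)
      moreover have "g j \<omega> - D \<le> gf v0 m (S j \<omega>)" using D0 by (simp add: g_def)
      ultimately obtain z where z: "gf v0 m z = g j \<omega> - D" "S j \<omega> \<le> z" "z \<le> xr"
      proof -
        assume le: "gf v0 m xr \<le> g j \<omega> - D" "g j \<omega> - D \<le> gf v0 m (S j \<omega>)"
        then have Sx: "S j \<omega> \<le> xr" using G_le_iff[of xr "S j \<omega>"] by linarith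
        show ?thesis
          using IVT2'[of "gf v0 m" xr "g j \<omega> - D" "S j \<omega>"] le Sx continuous_on_G that by auto
      qed
      have zS: "z \<le> burn (b (Suc j) \<omega>) (S j \<omega>)"
        using Dle z(1) G_le_iff[of "S (Suc j) \<omega>" z] by (simp add: g_def S_Suc)
      have "a * (gf v0 m (S j \<omega>) - gf v0 m z)\<^sup>2 / (4 * c\<^sup>2) \<le> haz (S j \<omega>) (b (Suc j) \<omega>)"
        using z S_nonneg[of j \<omega>] by (intro haz_lower[OF a _ z(2) zS] range) auto
      then have "a * D\<^sup>2 / (4 * c\<^sup>2) \<le> haz (S j \<omega>) (b (Suc j) \<omega>)" by (simp add: z(1) g_def)
      then have "lam * (a * D\<^sup>2 / (4 * c\<^sup>2)) \<le> hz j \<omega>"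
        unfolding hz_def using lam_pos by (intro mult_left_mono) auto
      moreover have "lam * (a * D\<^sup>2 / (4 * c\<^sup>2)) = 4 * q * (lam * D\<^sup>2)"
        using c by (simp add: q_def field_simps)
      \<comment> \<open>Both lam d^2 and i are at most lam D^2, the latter because i is at most i^2.
        The 16 in q against the 4 in \<open>haz_lower\<close> leaves room for a strict
        inequality.\<close>
      moreover have "\<kappa> i < 4 * q * (lam * D\<^sup>2)"
      proof -
        have 1: "lam * d\<^sup>2 \<le> lam * D\<^sup>2" using d lam_pos by (intro mult_left_mono power_mono) (auto simp: D_def)
        have "real i * ?h \<le> D" "0 \<le> real i * ?h" using h by (auto simp: D_def)
        then have "(real i * ?h)\<^sup>2 \<le> D\<^sup>2" by (intro power_mono)
        then have "lam * (real i * ?h)\<^sup>2 \<le> lam * D\<^sup>2" using lam_pos by (intro mult_left_mono) auto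
        moreover have "lam * (real i * ?h)\<^sup>2 = (real i)\<^sup>2" using lam_pos by (simp add: power_mult_distrib power_divide)
        moreover have "real i \<le> (real i)\<^sup>2" by (cases i) (auto simp: power2_eq_square)
        ultimately have 2: "real i \<le> lam * D\<^sup>2" by linarith
        have 3: "0 < lam * D\<^sup>2" using lam_pos D0 by simp
        have "lam * d\<^sup>2 + real i < 4 * (lam * D\<^sup>2)" using 1 2 3 by linarith
        then have "q * (lam * d\<^sup>2 + real i) < q * (4 * (lam * D\<^sup>2))" using q by (intro mult_strict_left_mono)
        then show ?thesis by (simp add: \<kappa>_def mult_ac)
      qed
      ultimately show ?thesis by linarith
    qed
    ultimately show "\<omega> \<in> (\<Union>i\<in>{..k}. {\<omega>\<in>I i j. \<kappa> i < hz j \<omega>})" by auto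
  qed
  have ev[measurable]: "{\<omega>\<in>I i j. \<kappa> i < hz j \<omega>} \<in> sets \<Omega>" for i j
  proof -
    have "{\<omega>\<in>I i j. \<kappa> i < hz j \<omega>} = I i j \<inter> {\<omega>\<in>space \<Omega>. \<kappa> i < hz j \<omega>}" by (auto simp: I_def)
    then show ?thesis by simp
  qed
  have "prob (\<Union>j\<in>{..<n}. straddle \<gamma> d j) \<le> (\<Sum>j<n. prob (straddle \<gamma> d j))"
    by (rule finite_measure_subadditive_finite) auto
  also have "\<dots> \<le> (\<Sum>j<n. \<Sum>i\<le>k. prob (I i j) * exp (- \<kappa> i))"
  proof (rule sum_mono)
    fix j
    have "prob (straddle \<gamma> d j) \<le> prob (\<Union>i\<in>{..k}. {\<omega>\<in>I i j. \<kappa> i < hz j \<omega>})"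
      by (rule finite_measure_mono[OF cover]) auto
    also have "\<dots> \<le> (\<Sum>i\<le>k. prob {\<omega>\<in>I i j. \<kappa> i < hz j \<omega>})"
      by (rule finite_measure_subadditive_finite) auto
    also have "\<dots> = (\<Sum>i\<le>k. prob (I i j) * exp (- \<kappa> i))"
      unfolding I_def by (intro sum.cong refl hazard_law past_event \<kappa>)
    finally show "prob (straddle \<gamma> d j) \<le> (\<Sum>i\<le>k. prob (I i j) * exp (- \<kappa> i))" .
  qed
  also have "\<dots> = (\<Sum>i\<le>k. (\<Sum>j<n. prob (I i j)) * exp (- \<kappa> i))"
    by (subst sum.swap) (simp add: sum_distrib_right)
  also have "\<dots> \<le> (\<Sum>i\<le>k. visit_bound a c * exp (- \<kappa> i))"
  proof (intro sum_mono mult_right_mono)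
    fix i
    have "0 \<le> real i * ?h" using h by (intro mult_nonneg_nonneg) auto
    then have "gf v0 m xr \<le> \<gamma> + real i * ?h" using \<gamma> d by linarith
    from block_visits[OF a range this xr] show "(\<Sum>j<n. prob (I i j)) \<le> visit_bound a c" by (simp add: I_def)
  qed auto
  also have "\<dots> = visit_bound a c * exp (- (q * lam * d\<^sup>2)) * (\<Sum>i\<le>k. exp (- q) ^ i)"
  proof -
    have "exp (- \<kappa> i) = exp (- (q * lam * d\<^sup>2)) * exp (- q) ^ i" for i
      unfolding exp_of_nat_mult[symmetric] exp_add[symmetric] by (simp add: \<kappa>_def algebra_simps)
    then show ?thesis by (simp add: sum_distrib_left mult.assoc)
  qed
  also have "\<dots> \<le> visit_bound a c * exp (- (q * lam * d\<^sup>2)) * (1 / (1 - exp (- q)))"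
  proof (intro mult_left_mono)
    have "(\<Sum>i\<le>k. exp (- q) ^ i) \<le> (\<Sum>i. exp (- q) ^ i)"
      using q by (intro sum_le_suminf summable_geometric) auto
    also have "\<dots> = 1 / (1 - exp (- q))" using q by (intro suminf_geometric) auto
    finally show "(\<Sum>i\<le>k. exp (- q) ^ i) \<le> 1 / (1 - exp (- q))" .
  qed (use visit_bound_pos[of a c] in auto)
  finally show ?thesis by simp
qed

end

section \<open>The mass burnt in a short time window\<close>

context random_burning
begin

text \<open>Selection by the starting mass, so that membership is decided by \<open>past i\<close>.
  In terms of states the cycle starts in the interval from x1 inclusive to x2 exclusive.\<close>

definition window :: "real \<Rightarrow> real \<Rightarrow> nat \<Rightarrow> 'a set" where
  "window x1 x2 i = {\<omega>\<in>space \<Omega>. gf v0 m x2 < g i \<omega> \<and> g i \<omega> \<le> gf v0 m x1}"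

lemma window_past: "window x1 x2 i \<in> sets (past i)"
proof -
  have [measurable]: "g i \<in> borel_measurable (past i)" by (rule g_past) simp
  have "{\<omega>\<in>space (past i). gf v0 m x2 < g i \<omega> \<and> g i \<omega> \<le> gf v0 m x1} \<in> sets (past i)" by measurable
  then show ?thesis by (simp add: window_def)
qed

abbreviation burnt :: "real \<Rightarrow> real \<Rightarrow> 'a \<Rightarrow> real" where
  "burnt y T \<omega> \<equiv> Phi (\<lambda>i. b i \<omega>) (\<lambda>s. w s \<omega>) T y"

lemma burnt_eq:
  assumes \<omega>: "\<omega> \<in> space \<Omega>"
  shows "burnt y T \<omega> = (\<Sum>i<N T \<omega>. if y < g i \<omega> - g (Suc i) \<omega> then g i \<omega> - g (Suc i) \<omega> else 0)"
proof -
  have "burnt y T \<omega> = (\<Sum>j=1..N T \<omega>. if y < g (j - 1) \<omega> - g j \<omega> then g (j - 1) \<omega> - g j \<omega> else 0)"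
    by (simp add: Phi_def Let_def m0_b[OF \<omega>] g_def N_def cong: if_cong)
  also have "\<dots> = (\<Sum>i<N T \<omega>. if y < g i \<omega> - g (Suc i) \<omega> then g i \<omega> - g (Suc i) \<omega> else 0)"
    by (rule sum.reindex_bij_witness[of _ Suc "\<lambda>j. j - 1"]) auto
  finally show ?thesis .
qed

lemma N_le_iff: "\<omega> \<in> space \<Omega> \<Longrightarrow> N T \<omega> \<le> i \<longleftrightarrow> T \<le> b (Suc i) \<omega>"
proof -
  assume \<omega>: "\<omega> \<in> space \<Omega>"
  have "Suc i \<le> N T \<omega> \<longleftrightarrow> b (Suc i) \<omega> < T"
    unfolding N_def by (rule Mc_ge_iff[OF bt[OF \<omega>]]) simp
  then show ?thesis by linarith
qed

lemma sum_at_most_one: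
  fixes f :: "'b \<Rightarrow> real"
  assumes one: "\<And>i j. i \<in> A \<Longrightarrow> j \<in> A \<Longrightarrow> i = j" and le: "\<And>i. i \<in> A \<Longrightarrow> f i \<le> d" and d: "0 \<le> d"
  shows "sum f A \<le> d"
proof (cases "A = {}")
  case False
  then obtain i where "A = {i}" using one by blast
  then show ?thesis using le[of i] by simp
qed (use d in simp)

text \<open>V collects the cycles burnt in the time window, W those that start in the mass window. A
  cycle in V but not in W crosses the level of x1, one in W but not in V that of x2. Each level is
  crossed by at most one cycle, which burns at most d by assumption. The two errors have opposite
  signs, whence d and not 2 d.\<close>

lemma burnt_vs_window:
  fixes y :: real
  assumes \<omega>: "\<omega> \<in> space \<Omega>" and pos: "\<And>j. 0 < hz j \<omega>"
    and x12: "x1 \<le> x2" and d: "0 \<le> d"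
    and st1: "\<And>j. j < n \<Longrightarrow> \<omega> \<notin> straddle (gf v0 m x1) d j"
    and st2: "\<And>j. j < n \<Longrightarrow> \<omega> \<notin> straddle (gf v0 m x2) d j"
    and gn: "g n \<omega> < gf v0 m x2"
  defines "W \<equiv> {i. i < n \<and> \<omega> \<in> window x1 x2 i}"
    and "f \<equiv> \<lambda>i. if y < g i \<omega> - g (Suc i) \<omega> then g i \<omega> - g (Suc i) \<omega> else 0"
  shows "\<bar>(burnt y (gel x2) \<omega> - burnt y (gel x1) \<omega>) - sum f W\<bar> \<le> d"
proof -
  define V where "V = {N (gel x1) \<omega>..<N (gel x2) \<omega>}"
  have f_nonneg: "0 \<le> f i" and f_le: "f i \<le> g i \<omega> - g (Suc i) \<omega>" for i
    using g_antimono[of i "Suc i" \<omega>] by (auto simp: f_def)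
  have N12: "N (gel x1) \<omega> \<le> N (gel x2) \<omega>"
  proof -
    have "gel x1 \<le> gel x2" using x12 by (simp add: gel_le_iff)
    also have "gel x2 \<le> b (Suc (N (gel x2) \<omega>)) \<omega>" using N_le_iff[OF \<omega>, of "gel x2" "N (gel x2) \<omega>"] by simp
    finally show ?thesis using N_le_iff[OF \<omega>] by simp
  qed
  have diff: "burnt y (gel x2) \<omega> - burnt y (gel x1) \<omega> = sum f V"
  proof -
    have "sum f {..<N (gel x1) \<omega>} + sum f V = sum f {..<N (gel x2) \<omega>}"
      unfolding V_def lessThan_atLeast0 by (rule sum.atLeastLessThan_concat) (use N12 in auto)
    moreover have b: "burnt y T \<omega> = sum f {..<N T \<omega>}" for T
      unfolding f_def by (rule burnt_eq[OF \<omega>])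
    ultimately show ?thesis unfolding b by linarith
  qed
  \<comment> \<open>A positive hazard means that the burning came strictly after the gelation time
    of the state. With \<open>b_le_gel\<close> this encloses each burning time between the gelation
    times of successive states.\<close>
  have gelS: "gel (S i \<omega>) < b (Suc i) \<omega>" for i
  proof (rule ccontr)
    assume "\<not> gel (S i \<omega>) < b (Suc i) \<omega>"
    then have "hz i \<omega> = 0" by (simp add: hz_def haz_zero)
    then show False using pos[of i] by simp
  qed
  have V_iff: "i \<in> V \<longleftrightarrow> gel x1 \<le> b (Suc i) \<omega> \<and> b (Suc i) \<omega> < gel x2" for i
    using N_le_iff[OF \<omega>, of "gel x1" i] N_le_iff[OF \<omega>, of "gel x2" i] by (auto simp: V_def)
  have VmW: "i < n \<and> g (Suc i) \<omega> \<le> gf v0 m x1 \<and> gf v0 m x1 < g i \<omega>" if i: "i \<in> V - W" for i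
  proof -
    have bi: "gel x1 \<le> b (Suc i) \<omega>" "b (Suc i) \<omega> < gel x2" using i V_iff by auto
    have "gel (S i \<omega>) < gel x2" using gelS[of i] bi by linarith
    then have 1: "gf v0 m x2 < g i \<omega>" by (simp add: gel_less_iff g_def G_less_iff)
    have ln: "i < n"
    proof (rule ccontr)
      assume "\<not> i < n"
      then show False using g_antimono[of n i \<omega>] gn 1 by simp
    qed
    have "gel x1 \<le> gel (S (Suc i) \<omega>)" using bi b_le_gel[OF \<omega>, of "Suc i"] by linarith
    then have "g (Suc i) \<omega> \<le> gf v0 m x1" by (simp add: gel_le_iff g_def G_le_iff)
    moreover have "gf v0 m x1 < g i \<omega>" using i ln 1 \<omega> by (auto simp: W_def window_def)
    ultimately show ?thesis using ln by simp
  qed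
  have WmV: "i < n \<and> g (Suc i) \<omega> \<le> gf v0 m x2 \<and> gf v0 m x2 < g i \<omega>" if i: "i \<in> W - V" for i
  proof -
    have 1: "gf v0 m x2 < g i \<omega>" "g i \<omega> \<le> gf v0 m x1" "i < n" using i by (auto simp: W_def window_def)
    then have "gel x1 \<le> gel (S i \<omega>)" by (simp add: gel_le_iff g_def G_le_iff)
    then have "gel x1 \<le> b (Suc i) \<omega>" using gelS[of i] by linarith
    then have "gel x2 \<le> b (Suc i) \<omega>" using i V_iff[of i] by auto
    then have "gel x2 \<le> gel (S (Suc i) \<omega>)" using b_le_gel[OF \<omega>, of "Suc i"] by linarith
    then have "g (Suc i) \<omega> \<le> gf v0 m x2" by (simp add: gel_le_iff g_def G_le_iff)
    then show ?thesis using 1 by simp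
  qed
  have uniq: "i = j" if "g (Suc i) \<omega> \<le> \<gamma> \<and> \<gamma> < g i \<omega>" "g (Suc j) \<omega> \<le> \<gamma> \<and> \<gamma> < g j \<omega>" for i j \<gamma>
    using that g_antimono[of "Suc i" j \<omega>] g_antimono[of "Suc j" i \<omega>] by (cases i j rule: linorder_cases) auto
  have "sum f (V - W) \<le> d"
  proof (rule sum_at_most_one[OF _ _ d])
    fix i j assume ij: "i \<in> V - W" "j \<in> V - W"
    show "i = j" by (rule uniq[of i "gf v0 m x1" j]) (use VmW ij in auto)
  next
    fix i assume "i \<in> V - W"
    note i = VmW[OF this]
    have "g i \<omega> - g (Suc i) \<omega> \<le> d"
      using st1[of i] i \<omega> by (auto simp: straddle_def)
    then show "f i \<le> d" using f_le[of i] by simp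
  qed
  moreover have "sum f (W - V) \<le> d"
  proof (rule sum_at_most_one[OF _ _ d])
    fix i j assume ij: "i \<in> W - V" "j \<in> W - V"
    show "i = j" by (rule uniq[of i "gf v0 m x2" j]) (use WmV ij in auto)
  next
    fix i assume "i \<in> W - V"
    note i = WmV[OF this]
    have "g i \<omega> - g (Suc i) \<omega> \<le> d"
      using st2[of i] i \<omega> by (auto simp: straddle_def)
    then show "f i \<le> d" using f_le[of i] by simp
  qed
  moreover have "sum f V = sum f (V \<inter> W) + sum f (V - W)" "sum f W = sum f (V \<inter> W) + sum f (W - V)"
  proof -
    have fin: "finite V" "finite W" by (auto simp: V_def W_def)
    show "sum f V = sum f (V \<inter> W) + sum f (V - W)"
      using sum.Int_Diff[OF fin(1), of f W] .
    show "sum f W = sum f (V \<inter> W) + sum f (W - V)"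
      using sum.Int_Diff[OF fin(2), of f V] by (simp add: Int_commute)
  qed
  moreover have "0 \<le> sum f (V - W)" "0 \<le> sum f (W - V)" by (auto intro!: sum_nonneg f_nonneg)
  ultimately show ?thesis unfolding diff by linarith
qed

text \<open>The cycles in W are consecutive, so their masses telescope to g p - g q, where p and q
  are the first indices with mass at most that of x1 and of x2. Without long straddling cycles
  either mass undershoots its level by at most d.\<close>

lemma window_total:
  assumes \<omega>: "\<omega> \<in> space \<Omega>"
    and x1: "0 \<le> x1" and x12: "x1 \<le> x2" and d: "0 \<le> d"
    and st1: "\<And>j. j < n \<Longrightarrow> \<omega> \<notin> straddle (gf v0 m x1) d j"
    and st2: "\<And>j. j < n \<Longrightarrow> \<omega> \<notin> straddle (gf v0 m x2) d j"
    and gn: "g n \<omega> < gf v0 m x2"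
  defines "W \<equiv> {i. i < n \<and> \<omega> \<in> window x1 x2 i}"
  shows "(\<Sum>i\<in>W. g i \<omega> - g (Suc i) \<omega>) \<le> gf v0 m x1 - gf v0 m x2 + d"
    "gf v0 m x1 - gf v0 m x2 - d \<le> (\<Sum>i\<in>W. g i \<omega> - g (Suc i) \<omega>)"
proof -
  let ?c1 = "gf v0 m x1" and ?c2 = "gf v0 m x2"
  have c21: "?c2 \<le> ?c1" using x12 by (simp add: G_le_iff)
  have near: "\<exists>k\<le>n. (\<forall>i<k. c < g i \<omega>) \<and> g k \<omega> \<le> c \<and> c - d \<le> g k \<omega>"
    if st: "\<And>j. j < n \<Longrightarrow> \<omega> \<notin> straddle c d j" and c: "g n \<omega> \<le> c" "c \<le> gf v0 m 0" for c
  proof -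
    define k where "k = (LEAST i. g i \<omega> \<le> c)"
    have k1: "g k \<omega> \<le> c" unfolding k_def by (rule LeastI[of _ n]) (rule c)
    have kn: "k \<le> n" unfolding k_def by (rule Least_le) (rule c)
    have before: "c < g i \<omega>" if "i < k" for i using not_less_Least[of i "\<lambda>i. g i \<omega> \<le> c"] that by (simp add: k_def not_le)
    have "c - d \<le> g k \<omega>"
    proof (cases k)
      case 0
      then show ?thesis using c d by (simp add: g_def S_0)
    next
      case (Suc i)
      then show ?thesis using before[of i] k1 kn st[of i] \<omega> by (auto simp: straddle_def)
    qed
    then show ?thesis using k1 kn before by blast
  qed
  obtain p where p: "p \<le> n" "\<And>i. i < p \<Longrightarrow> ?c1 < g i \<omega>" "g p \<omega> \<le> ?c1" "?c1 - d \<le> g p \<omega>"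
    using near[OF st1] gn c21 x1 by (auto simp: G_le_iff)
  obtain q where q: "q \<le> n" "\<And>i. i < q \<Longrightarrow> ?c2 < g i \<omega>" "g q \<omega> \<le> ?c2" "?c2 - d \<le> g q \<omega>"
    using near[OF st2] gn x1 x12 by (auto simp: G_le_iff)
  have pq: "p \<le> q"
  proof (rule ccontr)
    assume "\<not> p \<le> q"
    then show False using p(2)[of q] q(3) c21 by simp
  qed
  have W: "W = {p..<q}"
  proof (intro set_eqI iffI)
    fix i assume i: "i \<in> W"
    have "p \<le> i" using i p(2)[of i] by (cases "i < p") (auto simp: W_def window_def)
    moreover have "i < q"
    proof (rule ccontr)
      assume "\<not> i < q"
      then show False using g_antimono[of q i \<omega>] q(3) i by (auto simp: W_def window_def)
    qed
    ultimately show "i \<in> {p..<q}" by simp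
  next
    fix i assume i: "i \<in> {p..<q}"
    then show "i \<in> W" using g_antimono[of p i \<omega>] p(3) q(1) q(2)[of i] \<omega> by (auto simp: W_def window_def)
  qed
  have "(\<Sum>i\<in>W. g i \<omega> - g (Suc i) \<omega>) = g p \<omega> - g q \<omega>"
    unfolding W using sum_Suc_diff'[OF pq, of "\<lambda>i. - g i \<omega>"] by simp
  then show "(\<Sum>i\<in>W. g i \<omega> - g (Suc i) \<omega>) \<le> ?c1 - ?c2 + d" "?c1 - ?c2 - d \<le> (\<Sum>i\<in>W. g i \<omega> - g (Suc i) \<omega>)"
    using p q by auto
qed

text \<open>With the rate within a factor \<rho> of \<phi>0, the bounds on the hazard compare the
  squares up to \<rho>^3, hence the masses up to \<rho>^2. The cycle ends before xr since it cannot
  cross the level of x2 by burning more than d.\<close>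

lemma window_ratio:
  assumes \<omega>: "\<omega> \<in> window x1 x2 i" and d: "0 \<le> d"
    and st2: "\<omega> \<notin> straddle (gf v0 m x2) d i"
    and xr: "gf v0 m xr \<le> gf v0 m x2 - d"
    and \<phi>0: "0 < \<phi>0" and \<rho>: "1 \<le> \<rho>"
    and range: "\<And>z. x1 \<le> z \<Longrightarrow> z \<le> xr \<Longrightarrow> \<phi>0 / \<rho> \<le> rate z \<and> rate z \<le> \<phi>0 * \<rho>"
  shows "2 * sqrt (\<phi>0 / lam) * Y i \<omega> \<le> \<rho>\<^sup>2 * (g i \<omega> - g (Suc i) \<omega>)"
    "g i \<omega> - g (Suc i) \<omega> \<le> \<rho>\<^sup>2 * (2 * sqrt (\<phi>0 / lam) * Y i \<omega>)"
proof -
  let ?th = "g i \<omega> - g (Suc i) \<omega>" and ?s = "2 * sqrt (\<phi>0 / lam) * Y i \<omega>"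
  have sp: "\<omega> \<in> space \<Omega>" and gi: "gf v0 m x2 < g i \<omega>" "g i \<omega> \<le> gf v0 m x1" using \<omega> by (auto simp: window_def)
  have th0: "0 \<le> ?th" using g_antimono[of i "Suc i" \<omega>] by simp
  have s0: "0 \<le> ?s" using \<phi>0 lam_pos Y_nonneg by simp
  have xS: "x1 \<le> S i \<omega>" using gi by (simp add: g_def G_le_iff)
  have "gf v0 m xr \<le> g (Suc i) \<omega>"
  proof (cases "g (Suc i) \<omega> \<le> gf v0 m x2")
    case True
    then have "g i \<omega> - g (Suc i) \<omega> \<le> d" using st2 sp gi unfolding straddle_def by force
    then show ?thesis using gi xr by linarith
  next
    case False
    then show ?thesis using xr d by linarith
  qed
  then have Sx: "S (Suc i) \<omega> \<le> xr" by (simp add: g_def G_le_iff)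
  have rng: "\<phi>0 / \<rho> \<le> rate z \<and> rate z \<le> \<phi>0 * \<rho>" if "S i \<omega> \<le> z" "z \<le> burn (b (Suc i) \<omega>) (S i \<omega>)" for z
    using that xS Sx by (intro range) (auto simp: S_Suc)
  have a0: "0 < \<phi>0 / \<rho>" using \<phi>0 \<rho> by simp
  have s2: "?s\<^sup>2 = 4 * \<phi>0 / lam * hz i \<omega>"
    using \<phi>0 lam_pos by (simp add: power_mult_distrib Y_square)
  have up: "haz (S i \<omega>) (b (Suc i) \<omega>) \<le> (\<phi>0 * \<rho>) * ?th\<^sup>2 / (4 * (\<phi>0 / \<rho>)\<^sup>2)"
    unfolding g_diff by (rule haz_upper[OF a0 rng])
  have lo: "(\<phi>0 / \<rho>) * ?th\<^sup>2 / (4 * (\<phi>0 * \<rho>)\<^sup>2) \<le> haz (S i \<omega>) (b (Suc i) \<omega>)"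
    unfolding g_diff giant_def by (rule haz_lower[OF a0 rng burn_ge order_refl])
  have alg1: "4 * p * ((p * r) * u / (4 * (p / r)\<^sup>2)) = r ^ 3 * u" if "0 < p" "0 < r" for p r u :: real
    using that by (simp add: field_simps power2_eq_square power3_eq_cube)
  have alg2: "r ^ 3 * (4 * p * ((p / r) * u / (4 * (p * r)\<^sup>2))) = u" if "0 < p" "0 < r" for p r u :: real
    using that by (simp add: field_simps power2_eq_square power3_eq_cube)
  have alg3: "r ^ 4 * u\<^sup>2 = (r\<^sup>2 * u)\<^sup>2" for r u :: real
    by (simp add: power2_eq_square power4_eq_xxxx)
  have r34: "\<rho> ^ 3 \<le> \<rho> ^ 4" using \<rho> by (intro power_increasing) auto
  have "?s\<^sup>2 \<le> \<rho> ^ 3 * ?th\<^sup>2"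
  proof -
    have "?s\<^sup>2 = 4 * \<phi>0 * haz (S i \<omega>) (b (Suc i) \<omega>)" using lam_pos s2 by (simp add: hz_def)
    also have "\<dots> \<le> 4 * \<phi>0 * ((\<phi>0 * \<rho>) * ?th\<^sup>2 / (4 * (\<phi>0 / \<rho>)\<^sup>2))"
      using \<phi>0 by (intro mult_left_mono up) auto
    also have "\<dots> = \<rho> ^ 3 * ?th\<^sup>2" using \<rho> by (intro alg1 \<phi>0) simp
    finally show ?thesis .
  qed
  also have "\<dots> \<le> \<rho> ^ 4 * ?th\<^sup>2" by (intro mult_right_mono r34) simp
  also have "\<dots> = (\<rho>\<^sup>2 * ?th)\<^sup>2" by (rule alg3)
  finally show "?s \<le> \<rho>\<^sup>2 * ?th" by (rule power2_le_imp_le) (intro mult_nonneg_nonneg th0, simp)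
  have "?th\<^sup>2 \<le> \<rho> ^ 3 * ?s\<^sup>2"
  proof -
    have "?th\<^sup>2 = \<rho> ^ 3 * (4 * \<phi>0 * ((\<phi>0 / \<rho>) * ?th\<^sup>2 / (4 * (\<phi>0 * \<rho>)\<^sup>2)))"
      using \<rho> by (intro alg2[symmetric] \<phi>0) simp
    also have "\<dots> \<le> \<rho> ^ 3 * (4 * \<phi>0 * haz (S i \<omega>) (b (Suc i) \<omega>))"
      using \<phi>0 \<rho> by (intro mult_left_mono lo) auto
    also have "\<dots> = \<rho> ^ 3 * ?s\<^sup>2" using lam_pos s2 by (simp add: hz_def)
    finally show ?thesis .
  qed
  also have "\<dots> \<le> \<rho> ^ 4 * ?s\<^sup>2" by (intro mult_right_mono r34) simp
  also have "\<dots> = (\<rho>\<^sup>2 * ?s)\<^sup>2" by (rule alg3)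
  finally show "?th \<le> \<rho>\<^sup>2 * ?s" by (rule power2_le_imp_le) (intro mult_nonneg_nonneg[OF _ s0], simp)
qed

text \<open>A pathwise estimate. Burnt mass and c Y agree up to the factor r, so the event that the
  burnt mass exceeds c x lies between Y > x r and Y > x / r. At these cut-offs the fluctuation bound
  trades the truncated sum for \<open>tail_mass\<close> times the full sum of Y, which is compared
  with the mass \<Delta> of the window.\<close>

lemma good_event_bounds:
  assumes \<omega>: "\<omega> \<in> space \<Omega>" and pos: "\<And>j. 0 < hz j \<omega>"
    and x1: "0 \<le> x1" and x12: "x1 \<le> x2" and d: "0 \<le> d"
    and st1: "\<And>j. j < n \<Longrightarrow> \<omega> \<notin> straddle (gf v0 m x1) d j"
    and st2: "\<And>j. j < n \<Longrightarrow> \<omega> \<notin> straddle (gf v0 m x2) d j"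
    and gn: "g n \<omega> < gf v0 m x2"
    and xr: "gf v0 m xr \<le> gf v0 m x2 - d"
    and \<phi>0: "0 < \<phi>0" and \<rho>: "1 \<le> \<rho>"
    and range: "\<And>z. x1 \<le> z \<Longrightarrow> z \<le> xr \<Longrightarrow> \<phi>0 / \<rho> \<le> rate z \<and> rate z \<le> \<phi>0 * \<rho>"
    and x: "0 \<le> x"
    and fl: "\<And>y. y \<in> {x / \<rho>\<^sup>2, x * \<rho>\<^sup>2} \<Longrightarrow> \<bar>\<Sum>i<n. indicator (window x1 x2 i) \<omega> * fluct y i \<omega>\<bar> \<le> e"
  defines "c \<equiv> 2 * sqrt (\<phi>0 / lam)" and "\<Delta> \<equiv> gf v0 m x1 - gf v0 m x2" and "r \<equiv> \<rho>\<^sup>2"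
  shows "burnt (c * x) (gel x2) \<omega> - burnt (c * x) (gel x1) \<omega> \<le> d + r * (tail_mass (x / r) * (r * (\<Delta> + d)) + c * e)"
    "(tail_mass (x * r) * ((\<Delta> - d) / r) - c * e) / r - d \<le> burnt (c * x) (gel x2) \<omega> - burnt (c * x) (gel x1) \<omega>"
proof -
  define W where "W = {i. i < n \<and> \<omega> \<in> window x1 x2 i}"
  have finW: "finite W" by (simp add: W_def)
  define th where "th i = g i \<omega> - g (Suc i) \<omega>" for i
  define f where "f i = (if c * x < th i then th i else 0)" for i
  have r: "1 \<le> r" using \<rho> by (simp add: r_def one_le_power)
  have c: "0 < c" using \<phi>0 lam_pos by (simp add: c_def)
  have near: "\<bar>(burnt (c * x) (gel x2) \<omega> - burnt (c * x) (gel x1) \<omega>) - sum f W\<bar> \<le> d"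
    unfolding f_def[abs_def] th_def W_def by (rule burnt_vs_window[OF \<omega> pos x12 d st1 st2 gn])
  have tot: "sum th W \<le> \<Delta> + d" "\<Delta> - d \<le> sum th W"
    unfolding th_def W_def \<Delta>_def using window_total[OF \<omega> x1 x12 d st1 st2 gn] by blast+
  have ratio: "c * Y i \<omega> \<le> r * th i" "th i \<le> r * (c * Y i \<omega>)" if i: "i \<in> W" for i
  proof -
    have iW: "i < n" "\<omega> \<in> window x1 x2 i" using i by (auto simp: W_def)
    show "c * Y i \<omega> \<le> r * th i" "th i \<le> r * (c * Y i \<omega>)"
      unfolding c_def r_def th_def by (rule window_ratio[OF iW(2) d st2[OF iW(1)] xr \<phi>0 \<rho> range]; assumption)+
  qed
  have sumfl: "(\<Sum>i\<in>W. Y i \<omega> * of_bool (y < Y i \<omega>)) = tail_mass y * (\<Sum>i\<in>W. Y i \<omega>) + (\<Sum>i<n. indicator (window x1 x2 i) \<omega> * fluct y i \<omega>)" for y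
  proof -
    have "(\<Sum>i<n. indicator (window x1 x2 i) \<omega> * fluct y i \<omega>) = (\<Sum>i\<in>{..<n}. if \<omega> \<in> window x1 x2 i then fluct y i \<omega> else 0)"
      by (intro sum.cong) (auto simp: indicator_def)
    also have "\<dots> = (\<Sum>i\<in>{i\<in>{..<n}. \<omega> \<in> window x1 x2 i}. fluct y i \<omega>)" by (rule sum.inter_filter[symmetric]) simp
    also have "{i\<in>{..<n}. \<omega> \<in> window x1 x2 i} = W" by (auto simp: W_def)
    finally show ?thesis
      by (simp add: fluct_def right_diff_distrib sum_subtractf sum_distrib_left mult.commute)
  qed
  have sY: "c * (\<Sum>i\<in>W. Y i \<omega>) \<le> r * (\<Delta> + d)" "(\<Delta> - d) / r \<le> c * (\<Sum>i\<in>W. Y i \<omega>)"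
  proof -
    have "c * (\<Sum>i\<in>W. Y i \<omega>) \<le> r * sum th W"
      unfolding sum_distrib_left by (intro sum_mono ratio)
    also have "\<dots> \<le> r * (\<Delta> + d)" using tot r by (intro mult_left_mono) auto
    finally show "c * (\<Sum>i\<in>W. Y i \<omega>) \<le> r * (\<Delta> + d)" .
    have "sum th W \<le> r * (c * (\<Sum>i\<in>W. Y i \<omega>))"
      unfolding sum_distrib_left by (intro sum_mono ratio)
    then have "\<Delta> - d \<le> (c * (\<Sum>i\<in>W. Y i \<omega>)) * r" using tot by (simp add: mult.commute)
    then show "(\<Delta> - d) / r \<le> c * (\<Sum>i\<in>W. Y i \<omega>)" using r by (simp add: pos_divide_le_eq)
  qed
  have "sum f W \<le> r * (c * (\<Sum>i\<in>W. Y i \<omega> * of_bool (x / r < Y i \<omega>)))"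
    unfolding sum_distrib_left
  proof (rule sum_mono)
    fix i assume i: "i \<in> W"
    show "f i \<le> r * (c * (Y i \<omega> * of_bool (x / r < Y i \<omega>)))"
    proof (cases "c * x < th i")
      case True
      then have "c * x < c * (r * Y i \<omega>)" using ratio(2)[OF i] by (simp add: mult_ac)
      then have "x < r * Y i \<omega>" using c by simp
      then have "x / r < Y i \<omega>" using r by (simp add: pos_divide_less_eq mult.commute)
      then show ?thesis using True ratio(2)[OF i] by (simp add: f_def)
    next
      case False
      then show ?thesis using r c Y_nonneg[of i \<omega>] by (simp add: f_def)
    qed
  qed
  also have "\<dots> \<le> r * (tail_mass (x / r) * (r * (\<Delta> + d)) + c * e)"
  proof (rule mult_left_mono)
    have xr0: "0 \<le> x / r" using x r by simp
    have "c * (\<Sum>i\<in>W. Y i \<omega> * of_bool (x / r < Y i \<omega>)) = tail_mass (x / r) * (c * (\<Sum>i\<in>W. Y i \<omega>)) + c * (\<Sum>i<n. indicator (window x1 x2 i) \<omega> * fluct (x / r) i \<omega>)"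
      unfolding sumfl by (simp add: algebra_simps)
    also have "\<dots> \<le> tail_mass (x / r) * (r * (\<Delta> + d)) + c * e"
      using fl[of "x / r"] c by (intro add_mono mult_left_mono sY tail_mass_bounds xr0) (auto simp: r_def)
    finally show "c * (\<Sum>i\<in>W. Y i \<omega> * of_bool (x / r < Y i \<omega>)) \<le> tail_mass (x / r) * (r * (\<Delta> + d)) + c * e" .
  qed (use r in simp)
  finally show "burnt (c * x) (gel x2) \<omega> - burnt (c * x) (gel x1) \<omega> \<le> d + r * (tail_mass (x / r) * (r * (\<Delta> + d)) + c * e)"
    using near by linarith
  have "(tail_mass (x * r) * ((\<Delta> - d) / r) - c * e) / r \<le> (c * (\<Sum>i\<in>W. Y i \<omega> * of_bool (x * r < Y i \<omega>))) / r"
  proof (rule divide_right_mono)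
    have xr0: "0 \<le> x * r" using x r by simp
    have "c * (- (\<Sum>i<n. indicator (window x1 x2 i) \<omega> * fluct (x * r) i \<omega>)) \<le> c * e"
      using fl[of "x * r"] c by (intro mult_left_mono) (auto simp: r_def)
    moreover have "tail_mass (x * r) * ((\<Delta> - d) / r) \<le> tail_mass (x * r) * (c * (\<Sum>i\<in>W. Y i \<omega>))"
      by (intro mult_left_mono sY tail_mass_bounds xr0)
    moreover have "c * (\<Sum>i\<in>W. Y i \<omega> * of_bool (x * r < Y i \<omega>)) = tail_mass (x * r) * (c * (\<Sum>i\<in>W. Y i \<omega>)) + c * (\<Sum>i<n. indicator (window x1 x2 i) \<omega> * fluct (x * r) i \<omega>)"
      unfolding sumfl by (simp add: algebra_simps)
    ultimately show "tail_mass (x * r) * ((\<Delta> - d) / r) - c * e \<le> c * (\<Sum>i\<in>W. Y i \<omega> * of_bool (x * r < Y i \<omega>))" by simp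
  qed (use r in simp)
  also have "\<dots> = (\<Sum>i\<in>W. c * (Y i \<omega> * of_bool (x * r < Y i \<omega>)) / r)"
    by (simp add: sum_distrib_left sum_divide_distrib)
  also have "\<dots> \<le> sum f W"
  proof (rule sum_mono)
    fix i assume i: "i \<in> W"
    have th0: "0 \<le> th i" using g_antimono[of i "Suc i" \<omega>] by (simp add: th_def)
    show "c * (Y i \<omega> * of_bool (x * r < Y i \<omega>)) / r \<le> f i"
    proof (cases "x * r < Y i \<omega>")
      case True
      then have "c * (x * r) < c * Y i \<omega>" using c by simp
      then have "r * (c * x) < r * th i" using ratio(1)[OF i] by (simp add: mult_ac)
      then have "c * x < th i" using r by simp
      then show ?thesis using True ratio(1)[OF i] r by (simp add: f_def pos_divide_le_eq mult.commute)
    next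
      case False
      then show ?thesis using th0 by (simp add: f_def)
    qed
  qed
  finally show "(tail_mass (x * r) * ((\<Delta> - d) / r) - c * e) / r - d \<le> burnt (c * x) (gel x2) \<omega> - burnt (c * x) (gel x1) \<omega>"
    using near by linarith
qed

text \<open>A union bound over the ways in which \<open>good_event_bounds\<close> can fail: a zero
  hazard, a long straddling cycle at either end, a large fluctuation at either cut-off, or a mass
  not yet below that of x2 after n cycles. The set A enters only by its inclusion in the union of
  these events.\<close>

lemma bad_event_prob:
  assumes x1: "0 \<le> x1" and x12: "x1 \<le> x2" and d: "0 < d"
    and xr: "gf v0 m xr \<le> gf v0 m x2 - d" and xr0: "0 \<le> xr"
    and \<phi>0: "0 < \<phi>0" and \<rho>: "1 \<le> \<rho>"
    and range: "\<And>z. x1 \<le> z \<Longrightarrow> z \<le> xr \<Longrightarrow> \<phi>0 / \<rho> \<le> rate z \<and> rate z \<le> \<phi>0 * \<rho>"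
    and a: "0 < a" and range0: "\<And>z. 0 \<le> z \<Longrightarrow> z \<le> xr \<Longrightarrow> a \<le> rate z \<and> rate z \<le> k"
    and x: "0 \<le> x" and e: "0 < e" and p: "0 < p"
    and c: "c = 2 * sqrt (\<phi>0 / lam)" and \<Delta>: "\<Delta> = gf v0 m x1 - gf v0 m x2" and r: "r = \<rho>\<^sup>2" and q: "q = a / (16 * k\<^sup>2)"
    and A: "A \<subseteq> space \<Omega>" and bad: "\<And>\<omega>. \<omega> \<in> A \<Longrightarrow> 
        d + r * (tail_mass (x / r) * (r * (\<Delta> + d)) + c * e) < burnt (c * x) (gel x2) \<omega> - burnt (c * x) (gel x1) \<omega> \<or>
        burnt (c * x) (gel x2) \<omega> - burnt (c * x) (gel x1) \<omega> < (tail_mass (x * r) * ((\<Delta> - d) / r) - c * e) / r - d"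
  shows "prob A \<le> 2 * (visit_bound a k * exp (- (q * lam * d\<^sup>2)) / (1 - exp (- q)))
     + 2 * (visit_bound a k * (sqrt lam * \<Delta> + 1) / e\<^sup>2) + p"
proof -
  let ?c1 = "gf v0 m x1" and ?c2 = "gf v0 m x2"
  let ?U = "\<lambda>n y \<omega>. \<Sum>i<n. indicator (window x1 x2 i) \<omega> * fluct y i \<omega>"
  have c2xr: "gf v0 m xr \<le> ?c2" using xr d by simp
  have c20: "?c2 \<le> gf v0 m 0" "?c1 \<le> gf v0 m 0" "?c2 \<le> ?c1" using x1 x12 by (auto simp: G_le_iff)
  have xx: "0 \<le> x / r" "0 \<le> x * r" using x r \<rho> by auto
  define P where "P j = prob {\<omega>\<in>space \<Omega>. ?c2 \<le> g j \<omega> \<and> g j \<omega> \<le> gf v0 m 0}" for j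
  \<comment> \<open>The expected number of cycles starting at or above the level of x2 is finite, so
    the probability of such a start at index n tends to 0. This provides a finite n for the given
    p.\<close>
  have "summable P"
    unfolding P_def
    by (rule summableI_nonneg_bounded[OF _ interval_visits[OF a range0 c2xr c20(1) xr0]]) auto
  then have "P \<longlonglongrightarrow> 0" by (rule summable_LIMSEQ_zero)
  then have "eventually (\<lambda>n. P n < p) sequentially" using p by (rule order_tendstoD)
  then obtain n where n: "P n < p" by (auto simp: eventually_sequentially)
  define B0 where "B0 = (\<Union>j. {\<omega>\<in>space \<Omega>. hz j \<omega> \<le> 0})"
  define B1 where "B1 = (\<Union>j\<in>{..<n}. straddle ?c1 d j)"
  define B2 where "B2 = (\<Union>j\<in>{..<n}. straddle ?c2 d j)"
  define B3 where "B3 y = {\<omega>\<in>space \<Omega>. e \<le> \<bar>?U n y \<omega>\<bar>}" for y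
  define B4 where "B4 = {\<omega>\<in>space \<Omega>. ?c2 \<le> g n \<omega> \<and> g n \<omega> \<le> gf v0 m 0}"
  have Wev[measurable]: "window x1 x2 i \<in> sets \<Omega>" for i using window_past past_subset by blast
  have ev[measurable]: "B0 \<in> sets \<Omega>" "B1 \<in> sets \<Omega>" "B2 \<in> sets \<Omega>" "B3 y \<in> sets \<Omega>" "B4 \<in> sets \<Omega>" for y
    unfolding B0_def B1_def B2_def B3_def B4_def by measurable
  have sub: "A \<subseteq> ((((B0 \<union> B1) \<union> B2) \<union> B3 (x / r)) \<union> B3 (x * r)) \<union> B4"
  proof
    fix \<omega> assume \<omega>A: "\<omega> \<in> A"
    then have \<omega>: "\<omega> \<in> space \<Omega>" using A by auto
    show "\<omega> \<in> ((((B0 \<union> B1) \<union> B2) \<union> B3 (x / r)) \<union> B3 (x * r)) \<union> B4"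
    proof (rule ccontr)
      assume nb: "\<omega> \<notin> ((((B0 \<union> B1) \<union> B2) \<union> B3 (x / r)) \<union> B3 (x * r)) \<union> B4"
      have pos: "0 < hz j \<omega>" for j using nb \<omega> by (auto simp: B0_def not_le)
      have s1: "\<omega> \<notin> straddle ?c1 d j" if "j < n" for j using nb that by (auto simp: B1_def)
      have s2: "\<omega> \<notin> straddle ?c2 d j" if "j < n" for j using nb that by (auto simp: B2_def)
      have gn: "g n \<omega> < ?c2" using nb \<omega> g_le_0[of n \<omega>] by (auto simp: B4_def)
      have fl: "\<bar>?U n y \<omega>\<bar> \<le> e" if "y \<in> {x / \<rho>\<^sup>2, x * \<rho>\<^sup>2}" for y using nb \<omega> that by (auto simp: B3_def r)
      show False
        using good_event_bounds[OF \<omega> pos x1 x12 less_imp_le[OF d] s1 s2 gn xr \<phi>0 \<rho> range x fl] bad[OF \<omega>A]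
        unfolding c \<Delta> r by linarith
    qed
  qed
  have "prob A \<le> prob (((((B0 \<union> B1) \<union> B2) \<union> B3 (x / r)) \<union> B3 (x * r)) \<union> B4)"
    by (rule finite_measure_mono[OF sub]) measurable
  also have "\<dots> \<le> prob B0 + prob B1 + prob B2 + prob (B3 (x / r)) + prob (B3 (x * r)) + prob B4"
    by (intro order_trans[OF measure_Un_le] add_mono order_refl) measurable
  also have "prob B0 = 0"
  proof -
    have "prob {\<omega>\<in>space \<Omega>. hz j \<omega> \<le> 0} = 0" for j using hz_cdf[of 0 j] by simp
    then have "(\<lambda>j. {\<omega>\<in>space \<Omega>. hz j \<omega> \<le> 0}) j \<in> null_sets \<Omega>" for j
      by (intro null_setsI) (auto simp: emeasure_eq_measure)
    then have "B0 \<in> null_sets \<Omega>" unfolding B0_def by (intro null_sets_UN) auto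
    then show ?thesis by (simp add: measure_def null_setsD1)
  qed
  also have "prob B1 \<le> visit_bound a k * exp (- (q * lam * d\<^sup>2)) / (1 - exp (- q))"
    unfolding B1_def q using c20 xr by (intro straddle_prob[OF a range0 d _ _ xr0]) auto
  also have "prob B2 \<le> visit_bound a k * exp (- (q * lam * d\<^sup>2)) / (1 - exp (- q))"
    unfolding B2_def q using c20 xr by (intro straddle_prob[OF a range0 d _ _ xr0]) auto
  also have "prob B4 \<le> p" using n by (simp add: B4_def P_def)
  finally have main: "prob A \<le> 0 + visit_bound a k * exp (- (q * lam * d\<^sup>2)) / (1 - exp (- q)) + visit_bound a k * exp (- (q * lam * d\<^sup>2)) / (1 - exp (- q))
    + prob (B3 (x / r)) + prob (B3 (x * r)) + p" by simp
  have B3: "prob (B3 y) \<le> visit_bound a k * (sqrt lam * \<Delta> + 1) / e\<^sup>2" if y: "0 \<le> y" for y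
  proof -
    note M = predictable_sum_second_moment[OF window_past[of x1 x2] y, of n]
    have "prob (B3 y) \<le> expectation (\<lambda>\<omega>. (?U n y \<omega>)\<^sup>2) / e\<^sup>2"
      unfolding B3_def by (rule second_moment_method[OF _ conjunct1[OF M] e]) measurable
    also have "\<dots> \<le> (\<Sum>i<n. prob (window x1 x2 i)) / e\<^sup>2"
      using M by (intro divide_right_mono) auto
    also have "(\<Sum>i<n. prob (window x1 x2 i)) \<le> (\<Sum>i<n. prob {\<omega>\<in>space \<Omega>. ?c2 \<le> g i \<omega> \<and> g i \<omega> \<le> ?c1})"
      by (intro sum_mono finite_measure_mono) (auto simp: window_def)
    also have "\<dots> \<le> visit_bound a k * (sqrt lam * (?c1 - ?c2) + 1)"
      by (rule interval_visits[OF a range0 c2xr c20(3) xr0])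
    finally show ?thesis using e by (simp add: \<Delta> divide_right_mono)
  qed
  have add: "P \<le> 2 * U + 2 * V + p" if "P \<le> 0 + U + U + V1 + V2 + p" "V1 \<le> V" "V2 \<le> V" for P U V V1 V2 :: real
    using that by linarith
  show ?thesis by (rule add[OF main B3[OF xx(1)] B3[OF xx(2)]])
qed

end

section \<open>The limit theorem\<close>

lemma right_average_tendsto:
  fixes \<phi> :: "real \<Rightarrow> real"
  assumes cont: "continuous_on {a..} \<phi>" and t: "a \<le> t"
  shows "((\<lambda>h. integral {t..t + h} \<phi> / h) \<longlongrightarrow> \<phi> t) (at_right 0)"
proof -
  have "((\<lambda>s. integral {t..s} \<phi>) has_real_derivative \<phi> t) (at t within {t..t+1})"
    using t by (intro integral_has_real_derivative continuous_on_subset[OF cont]) auto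
  then have "((\<lambda>s. integral {t..s} \<phi>) has_real_derivative \<phi> t) (at_right t)"
    using at_within_Icc_at_right[of t "t+1"] by simp
  then have "((\<lambda>s. (integral {t..s} \<phi> - integral {t..t} \<phi>) / (s - t)) \<longlongrightarrow> \<phi> t) (at_right t)"
    unfolding has_field_derivative_iff .
  then show ?thesis
    unfolding filterlim_at_right_to_0[of _ _ t] by (simp add: add.commute)
qed

lemma in_Nstar_finite_data:
  assumes N: "in_Nstar v0" and pos: "0 < m1 v0"
  shows "\<exists>m. finite_data v0 m"
proof -
  have fin: "finite {k. 1 \<le> k \<and> v0 k \<noteq> 0}" and nn: "\<And>k. 1 \<le> k \<Longrightarrow> 0 \<le> v0 k"
    using N by (auto simp: in_Nstar_def in_N_def)
  obtain m where m: "\<And>k. k \<in> {k. 1 \<le> k \<and> v0 k \<noteq> 0} \<Longrightarrow> k \<le> m"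
    using finite_nat_set_iff_bounded_le[THEN iffD1, OF fin] by blast
  have "\<exists>k\<ge>1. 0 < v0 k"
  proof (rule ccontr)
    assume "\<not> (\<exists>k\<ge>1. 0 < v0 k)"
    then have "v0 (Suc k) = 0" for k using nn[of "Suc k"] by (auto simp: not_less intro: antisym)
    then show False using pos by (simp add: m1_def)
  qed
  moreover have "v0 k = 0" if "m < k" for k
    using m[of k] that by (cases "v0 k = 0") auto
  ultimately have "finite_data v0 m" using nn by unfold_locales auto
  then show ?thesis by blast
qed

text \<open>If the first moment vanished, 1 / m1 would be 0 by the convention for division and the
  initial mass would be zero. Nothing would then be left for the positive \<phi> to remove during
  {0..1}.\<close>

lemma m1_positive:
  assumes N: "in_Nstar v0" and crit: "crit_sol v0 u"
    and phi_cont: "continuous_on {1 / m1 v0..} \<phi>"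
    and phi_pos: "\<forall>s\<ge>1 / m1 v0. \<phi> s > 0"
    and phi_int: "\<forall>s\<ge>1 / m1 v0. m0 (u 0) - m0 (u s) = integral {1 / m1 v0..s} \<phi>"
  shows "0 < m1 v0"
proof (rule ccontr)
  assume np: "\<not> 0 < m1 v0"
  have nn: "0 \<le> v0 (Suc k)" for k using N by (simp add: in_Nstar_def in_N_def)
  have fin: "finite {k. v0 (Suc k) \<noteq> 0}"
  proof -
    have "finite {k. 1 \<le> k \<and> v0 k \<noteq> 0}" using N by (simp add: in_Nstar_def)
    then have "finite (Suc -` {k. 1 \<le> k \<and> v0 k \<noteq> 0})" by (rule finite_vimageI) simp
    moreover have "Suc -` {k. 1 \<le> k \<and> v0 k \<noteq> 0} = {k. v0 (Suc k) \<noteq> 0}" by auto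
    ultimately show ?thesis by simp
  qed
  have summ: "summable (\<lambda>k. real (Suc k) * v0 (Suc k))"
    by (rule summable_finite[OF fin]) auto
  have "m1 v0 \<ge> 0" unfolding m1_def by (intro suminf_nonneg summ mult_nonneg_nonneg nn) simp
  then have m1: "m1 v0 = 0" using np by simp
  then have z: "v0 (Suc k) = 0" for k
    using suminf_eq_zero_iff[OF summ] nn unfolding m1_def by (simp del: of_nat_Suc)
  have u0: "m0 (u 0) = 0" using crit z by (simp add: crit_sol_def m0_def)
  have "0 \<le> m0 (u 1)"
    unfolding m0_def using crit by (intro suminf_nonneg) (auto simp: crit_sol_def in_N_def)
  then have le: "integral {0..1} \<phi> \<le> 0" using phi_int[rule_format, of 1] u0 m1 by simp
  have c: "continuous_on {0..1} \<phi>" using phi_cont m1 by (auto intro: continuous_on_subset)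
  obtain s where s: "s \<in> {0..1}" "\<And>r. r \<in> {0..1} \<Longrightarrow> \<phi> s \<le> \<phi> r"
    using continuous_attains_inf[OF compact_Icc _ c] by auto
  have "integral {0..1} (\<lambda>_::real. \<phi> s) \<le> integral {0..1} \<phi>"
    by (rule Henstock_Kurzweil_Integration.integral_le) (use s(2) integrable_continuous_real[OF c] in auto)
  then have "\<phi> s \<le> 0" using le by simp
  then show False using phi_pos[rule_format, of s] s m1 by simp
qed

text \<open>The two expressions are the bounds of \<open>good_event_bounds\<close> divided by \<open>\<epsilon> * \<phi>0\<close>, with
  \<open>r = 1 + h\<close>, \<open>d = h * \<epsilon>\<close> and \<open>e = h * \<epsilon> * sqrt lam\<close>.\<close>
lemma tolerance_exists:
  assumes x: "0 \<le> x" and \<phi>0: "0 < \<phi>0" and \<delta>: "0 < \<delta>"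
  shows "\<exists>h>0. h / \<phi>0 + (1 + h) * (tail_mass (x / (1 + h)) * ((1 + h) * (1 + h + h / \<phi>0)) + 2 * h / sqrt \<phi>0) < tail_mass x + \<delta>
    \<and> tail_mass x - \<delta> < (tail_mass (x * (1 + h)) * ((1 / (1 + h) - h / \<phi>0) / (1 + h)) - 2 * h / sqrt \<phi>0) / (1 + h) - h / \<phi>0"
proof -
  \<comment> \<open>Both expressions are continuous in h on {0..} and take the value
    \<open>tail_mass x\<close> at h = 0.\<close>
  let ?U = "\<lambda>h. h / \<phi>0 + (1 + h) * (tail_mass (x / (1 + h)) * ((1 + h) * (1 + h + h / \<phi>0)) + 2 * h / sqrt \<phi>0)"
  let ?L = "\<lambda>h. (tail_mass (x * (1 + h)) * ((1 / (1 + h) - h / \<phi>0) / (1 + h)) - 2 * h / sqrt \<phi>0) / (1 + h) - h / \<phi>0"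
  have nz: "1 + h \<noteq> 0" if "h \<in> {0..}" for h :: real using that by auto
  have c1: "continuous_on {0..} (\<lambda>h. tail_mass (x / (1 + h)))"
    by (rule continuous_on_compose2[OF continuous_on_tail_mass])
       (use x nz in \<open>auto intro!: continuous_intros\<close>)
  have c2: "continuous_on {0..} (\<lambda>h. tail_mass (x * (1 + h)))"
    by (rule continuous_on_compose2[OF continuous_on_tail_mass])
       (use x in \<open>auto intro!: continuous_intros\<close>)
  have sq: "sqrt \<phi>0 \<noteq> 0" "\<phi>0 \<noteq> 0" using \<phi>0 by auto
  have "continuous_on {0..} ?U" by (intro continuous_intros c1 ballI sq)
  then have "(?U \<longlongrightarrow> ?U 0) (at 0 within {0..})" unfolding continuous_on by (rule bspec) simp
  then have "(?U \<longlongrightarrow> ?U 0) (at_right 0)" by (rule tendsto_within_subset) auto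
  then have eU: "eventually (\<lambda>h. ?U h < tail_mass x + \<delta>) (at_right 0)"
    by (rule order_tendstoD(2)) (use \<delta> in simp)
  have "continuous_on {0..} ?L" by (intro continuous_intros c2 ballI sq nz)
  then have "(?L \<longlongrightarrow> ?L 0) (at 0 within {0..})" unfolding continuous_on by (rule bspec) simp
  then have "(?L \<longlongrightarrow> ?L 0) (at_right 0)" by (rule tendsto_within_subset) auto
  then have eL: "eventually (\<lambda>h. tail_mass x - \<delta> < ?L h) (at_right 0)"
    by (rule order_tendstoD(1)) (use \<delta> in simp)
  have "eventually (\<lambda>h. 0 < h \<and> ?U h < tail_mass x + \<delta> \<and> tail_mass x - \<delta> < ?L h) (at_right (0::real))"
    using eventually_at_right_less[of "0::real"] eU eL by eventually_elim simp
  then show ?thesis using eventually_happens'[OF trivial_limit_at_right_real[of 0]] by blast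
qed

text \<open>In units of eps \<phi>0, the approximate mass loss in the window, d is h / \<phi>0, c e
  is 2 h / sqrt \<phi>0, and \<Delta> is within a factor r of 1. A deviation of the ratio by more
  than \<delta> then violates one of the two pathwise bounds.\<close>

lemma scaled_event_bounds:
  fixes \<Psi> :: real
  assumes \<phi>0: "0 < \<phi>0" and r: "1 \<le> r" and h: "0 < h" and eps: "0 < eps" and lam: "0 < lam"
    and \<Delta>: "\<Delta> \<le> r * (eps * \<phi>0)" "eps * \<phi>0 / r \<le> \<Delta>"
    and tU: "0 \<le> tU" and tL: "0 \<le> tL"
    and U: "h / \<phi>0 + r * (tU * (r * (r + h / \<phi>0)) + 2 * h / sqrt \<phi>0) < L + \<delta>"
    and Lo: "L - \<delta> < (tL * ((1 / r - h / \<phi>0) / r) - 2 * h / sqrt \<phi>0) / r - h / \<phi>0"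
    and big: "\<delta> < \<bar>\<Psi> / (eps * \<phi>0) - L\<bar>"
  defines "c \<equiv> 2 * sqrt (\<phi>0 / lam)" and "e \<equiv> h * (sqrt lam * eps)" and "d \<equiv> h * eps"
  shows "d + r * (tU * (r * (\<Delta> + d)) + c * e) < \<Psi> \<or> \<Psi> < (tL * ((\<Delta> - d) / r) - c * e) / r - d"
proof -
  let ?s = "eps * \<phi>0"
  have s: "0 < ?s" using eps \<phi>0 by simp
  have r0: "0 < r" using r by simp
  have ce: "c * e = (2 * h / sqrt \<phi>0) * ?s"
  proof -
    have 1: "sqrt (\<phi>0 / lam) * sqrt lam = \<phi>0 / sqrt \<phi>0"
      using lam \<phi>0 by (simp add: real_sqrt_divide real_div_sqrt)
    have "c * e = 2 * h * eps * (sqrt (\<phi>0 / lam) * sqrt lam)" by (simp add: c_def e_def)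
    also have "\<dots> = (2 * h / sqrt \<phi>0) * ?s" unfolding 1 by simp
    finally show ?thesis .
  qed
  have d: "d = (h / \<phi>0) * ?s" using \<phi>0 by (simp add: d_def)
  consider "(L + \<delta>) * ?s < \<Psi>" | "\<Psi> < (L - \<delta>) * ?s"
  proof -
    have "L + \<delta> < \<Psi> / ?s \<or> \<Psi> / ?s < L - \<delta>" using big by linarith
    then show ?thesis using that by (simp only: pos_less_divide_eq[OF s] pos_divide_less_eq[OF s]) blast
  qed
  then show ?thesis
  proof cases
    case 1
    have "d + r * (tU * (r * (\<Delta> + d)) + c * e) \<le> d + r * (tU * (r * (r * ?s + d)) + c * e)"
      using \<Delta> r0 tU by (intro add_left_mono add_right_mono mult_left_mono) auto
    also have "\<dots> = (h / \<phi>0 + r * (tU * (r * (r + h / \<phi>0)) + 2 * h / sqrt \<phi>0)) * ?s"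
      unfolding ce d by (simp add: algebra_simps)
    also have "\<dots> < (L + \<delta>) * ?s" using U s by (rule mult_strict_right_mono)
    finally show ?thesis using 1 by simp
  next
    case 2
    have "(L - \<delta>) * ?s < ((tL * ((1 / r - h / \<phi>0) / r) - 2 * h / sqrt \<phi>0) / r - h / \<phi>0) * ?s"
      using Lo s by (rule mult_strict_right_mono)
    also have "\<dots> = (tL * ((?s / r - d) / r) - c * e) / r - d"
      unfolding ce d by (simp add: algebra_simps diff_divide_distrib add_divide_distrib)
    also have "\<dots> \<le> (tL * ((\<Delta> - d) / r) - c * e) / r - d"
      using \<Delta> r0 tL by (intro diff_right_mono divide_right_mono mult_left_mono) auto
    finally show ?thesis using 2 by simp
  qed
qed

text \<open>Straddling is of Gaussian smallness in Z, and in the fluctuation term a variance of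
  order Z is divided by Z^2. With Z = sqrt lam eps this is where the lower bound on the window
  length enters.\<close>

lemma bad_bound_tendsto_0:
  fixes Z :: "real \<Rightarrow> real"
  assumes Z: "filterlim Z at_top at_top" and q: "0 < q"
  shows "((\<lambda>lam. 2 * (A * exp (- (q * (Z lam)\<^sup>2)) / B) + 2 * (A * (k * Z lam + 1) / (h * Z lam)\<^sup>2) + 1 / lam) \<longlongrightarrow> 0) at_top"
proof -
  have Z2: "filterlim (\<lambda>lam. q * (Z lam)\<^sup>2) at_top at_top"
    by (intro filterlim_tendsto_pos_mult_at_top[OF tendsto_const q] filterlim_pow_at_top Z) simp
  have 1: "((\<lambda>lam. exp (- (q * (Z lam)\<^sup>2))) \<longlongrightarrow> 0) at_top"
    by (rule filterlim_compose[OF exp_at_bot filterlim_compose[OF filterlim_uminus_at_bot_at_top Z2]])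
  have 2: "((\<lambda>lam. inverse (Z lam)) \<longlongrightarrow> 0) at_top"
    by (rule tendsto_inverse_0_at_top[OF Z])
  have 3: "((\<lambda>lam. inverse lam) \<longlongrightarrow> (0::real)) at_top"
    by (rule tendsto_inverse_0_at_top[OF filterlim_ident])
  have "((\<lambda>lam. 2 * (A * exp (- (q * (Z lam)\<^sup>2)) * inverse B) + 2 * (A * (k * inverse (Z lam) + (inverse (Z lam))\<^sup>2) * inverse (h\<^sup>2)) + inverse lam)
     \<longlongrightarrow> 2 * (A * 0 * inverse B) + 2 * (A * (k * 0 + 0\<^sup>2) * inverse (h\<^sup>2)) + 0) at_top"
    by (intro tendsto_intros 1 2 3)
  then have lim: "((\<lambda>lam. 2 * (A * exp (- (q * (Z lam)\<^sup>2)) * inverse B) + 2 * (A * (k * inverse (Z lam) + (inverse (Z lam))\<^sup>2) * inverse (h\<^sup>2)) + inverse lam) \<longlongrightarrow> 0) at_top"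
    by simp
  have "eventually (\<lambda>lam. 0 < Z lam) at_top" using Z by (simp add: filterlim_at_top_dense)
  then have "eventually (\<lambda>lam. 2 * (A * exp (- (q * (Z lam)\<^sup>2)) * inverse B) + 2 * (A * (k * inverse (Z lam) + (inverse (Z lam))\<^sup>2) * inverse (h\<^sup>2)) + inverse lam
     = 2 * (A * exp (- (q * (Z lam)\<^sup>2)) / B) + 2 * (A * (k * Z lam + 1) / (h * Z lam)\<^sup>2) + 1 / lam) at_top"
  proof eventually_elim
    case (elim lam)
    have "(k * Z lam + 1) * inverse ((Z lam)\<^sup>2) = k * inverse (Z lam) + (inverse (Z lam))\<^sup>2"
      using elim by (simp add: field_simps power2_eq_square)
    moreover have "A * (k * Z lam + 1) / (h * Z lam)\<^sup>2 = A * ((k * Z lam + 1) * inverse ((Z lam)\<^sup>2)) * inverse (h\<^sup>2)"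
      by (simp add: divide_inverse power_mult_distrib mult_ac)
    ultimately have eq: "A * (k * Z lam + 1) / (h * Z lam)\<^sup>2 = A * (k * inverse (Z lam) + (inverse (Z lam))\<^sup>2) * inverse (h\<^sup>2)"
      by (simp only:)
    show ?case unfolding eq by (simp only: divide_inverse mult_1_left)
  qed
  with lim show ?thesis by (rule Lim_transform_eventually)
qed

theorem theorem9:
  fixes v0 :: "nat \<Rightarrow> real"
    and \<Omega> :: "real \<Rightarrow> 'a measure"
    and \<beta> :: "real \<Rightarrow> nat \<Rightarrow> 'a \<Rightarrow> real"
    and v :: "real \<Rightarrow> real \<Rightarrow> 'a \<Rightarrow> nat \<Rightarrow> real"
    and \<epsilon> :: "real \<Rightarrow> real"
    and u :: "real \<Rightarrow> nat \<Rightarrow> real"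
    and \<phi> :: "real \<Rightarrow> real"
    and t x :: real
  assumes v0: "in_Nstar v0"
    and rand: "\<forall>lam>0. random_alt_sol (\<Omega> lam) lam v0 (\<beta> lam) (v lam)"
    and eps_pos: "\<forall>lam>0. \<epsilon> lam > 0"
    and eps_big: "filterlim (\<lambda>lam. sqrt lam * \<epsilon> lam) at_top at_top"
    and eps_small: "(\<epsilon> \<longlongrightarrow> 0) at_top"
    and crit: "crit_sol v0 u"
    and phi_cont: "continuous_on {1 / m1 v0..} \<phi>"
    and phi_pos: "\<forall>s\<ge>1 / m1 v0. \<phi> s > 0"
    and phi_int: "\<forall>s\<ge>1 / m1 v0. m0 (u 0) - m0 (u s) = integral {1 / m1 v0..s} \<phi>"
    and t: "t \<ge> 1 / m1 v0"
    and x: "x \<ge> 0"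
  shows "\<forall>\<delta>>0. ((\<lambda>lam. measure (\<Omega> lam)
           {\<omega> \<in> space (\<Omega> lam).
              \<bar>(Phi (\<lambda>i. \<beta> lam i \<omega>) (\<lambda>s. v lam s \<omega>) (t + \<epsilon> lam) (2 * sqrt (\<phi> t / lam) * x)
                - Phi (\<lambda>i. \<beta> lam i \<omega>) (\<lambda>s. v lam s \<omega>) t (2 * sqrt (\<phi> t / lam) * x))
               / (\<epsilon> lam * \<phi> t)
              - integral {x..} (\<lambda>y. 4 / sqrt pi * y\<^sup>2 * exp (- (y\<^sup>2)))\<bar> > \<delta>})
         \<longlongrightarrow> 0) at_top"
proof (intro allI impI)
  fix \<delta> :: real assume \<delta>: "0 < \<delta>"
  have m1: "0 < m1 v0" by (rule m1_positive[OF v0 crit phi_cont phi_pos phi_int])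
  then obtain m where "finite_data v0 m" using in_Nstar_finite_data[OF v0] by blast
  then interpret D: finite_data v0 m .
  have T0: "1 / m1 v0 = D.gel 0" by (simp add: D.m1_v0 D.gel_def)
  note phi_cont' = phi_cont[unfolded T0] and t' = t[unfolded T0]
  have phi_int': "m0 (u 0) - m0 (u s) = integral {D.gel 0..s} \<phi>" if "D.gel 0 \<le> s" for s
    using phi_int that unfolding T0 by blast
  have crit_mass: "m0 (u (D.gel y)) = gf v0 m y" "\<phi> (D.gel y) = D.rate y" if "0 \<le> y" for y
    by (rule D.crit_sol_mass_and_rate[OF crit phi_cont' _ that], rule phi_int', assumption)+
  \<comment> \<open>The ends of the time window are traded for states: x1 has gelation time t, and
    \<open>X2 lam\<close> below has gelation time t + \<epsilon> lam.\<close>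
  obtain x1 where x1: "0 \<le> x1" "D.gel x1 = t" using D.gel_surj[OF t'] by blast
  define \<phi>0 where "\<phi>0 = \<phi> t"
  have \<phi>0: "0 < \<phi>0" using phi_pos t by (simp add: \<phi>0_def)
  have rate1: "D.rate x1 = \<phi>0" using crit_mass(2)[OF x1(1)] x1(2) by (simp add: \<phi>0_def)
  define X2 where "X2 lam = (SOME y. x1 \<le> y \<and> D.gel y = t + \<epsilon> lam)" for lam
  have X2: "x1 \<le> X2 lam" "D.gel (X2 lam) = t + \<epsilon> lam" if "0 < lam" for lam
  proof -
    have "\<exists>y\<ge>x1. D.gel y = t + \<epsilon> lam" using x1 eps_pos that by (intro D.gel_surj) auto
    then show "x1 \<le> X2 lam" "D.gel (X2 lam) = t + \<epsilon> lam"
      unfolding X2_def using someI_ex[of "\<lambda>y. x1 \<le> y \<and> D.gel y = t + \<epsilon> lam"] by blast+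
  qed
  define \<Delta> where "\<Delta> lam = gf v0 m x1 - gf v0 m (X2 lam)" for lam
  have \<Delta>_eq: "\<Delta> lam = integral {t..t + \<epsilon> lam} \<phi>" if lam: "0 < lam" for lam
  proof -
    have e: "0 < \<epsilon> lam" using eps_pos lam by simp
    have "gf v0 m x1 = m0 (u t)" using crit_mass(1)[OF x1(1)] x1(2) by simp
    moreover have "gf v0 m (X2 lam) = m0 (u (t + \<epsilon> lam))"
      using crit_mass(1)[of "X2 lam"] X2[OF lam] x1(1) by simp
    moreover have "integral {D.gel 0..t} \<phi> + integral {t..t + \<epsilon> lam} \<phi> = integral {D.gel 0..t + \<epsilon> lam} \<phi>"
      using t' e by (intro Henstock_Kurzweil_Integration.integral_combine integrable_continuous_real continuous_on_subset[OF phi_cont']) auto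
    ultimately show ?thesis
      using phi_int'[of t] phi_int'[of "t + \<epsilon> lam"] t' e by (simp add: \<Delta>_def)
  qed
  obtain h where h: "0 < h"
    "h / \<phi>0 + (1 + h) * (tail_mass (x / (1 + h)) * ((1 + h) * (1 + h + h / \<phi>0)) + 2 * h / sqrt \<phi>0) < tail_mass x + \<delta>"
    "tail_mass x - \<delta> < (tail_mass (x * (1 + h)) * ((1 / (1 + h) - h / \<phi>0) / (1 + h)) - 2 * h / sqrt \<phi>0) / (1 + h) - h / \<phi>0"
    using tolerance_exists[OF x \<phi>0 \<delta>] by blast
  define r where "r = 1 + h"
  \<comment> \<open>\<open>window_ratio\<close> loses the factor \<rho>^2, so the square root makes
    the total loss equal to r.\<close>
  define \<rho> where "\<rho> = sqrt r"
  have r: "1 < r" using h(1) by (simp add: r_def)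
  have \<rho>: "1 < \<rho>" "r = \<rho>\<^sup>2" using r by (auto simp: \<rho>_def)
  \<comment> \<open>A fixed state beyond the shrinking windows, near enough to x1 for the rate to be
    almost constant. As xr is fixed, the bounds a and k below, and with them q, are independent of
    lam.\<close>
  obtain xr where xr: "x1 < xr" "\<And>z. x1 \<le> z \<Longrightarrow> z \<le> xr \<Longrightarrow> \<phi>0 / \<rho> \<le> D.rate z \<and> D.rate z \<le> \<phi>0 * \<rho>"
  proof -
    have c: "isCont D.rate x1"
      using D.continuous_on_rate[of UNIV] by (simp add: continuous_on_eq_continuous_at)
    have "\<phi>0 / \<rho> < \<phi>0" "\<phi>0 < \<phi>0 * \<rho>" using \<phi>0 \<rho>(1) by (auto simp: divide_less_eq)
    note lt = this
    have "eventually (\<lambda>z. \<phi>0 / \<rho> < D.rate z \<and> D.rate z < \<phi>0 * \<rho>) (at x1)"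
      using isContD[OF c] lt rate1 by (intro eventually_conj order_tendstoD) auto
    then obtain d where d: "0 < d" "\<And>z. z \<noteq> x1 \<Longrightarrow> dist z x1 < d \<Longrightarrow> \<phi>0 / \<rho> < D.rate z \<and> D.rate z < \<phi>0 * \<rho>"
      unfolding eventually_at by blast
    show ?thesis
    proof (rule that[of "x1 + d / 2"])
      fix z assume "x1 \<le> z" "z \<le> x1 + d / 2"
      then have "dist z x1 < d" using d(1) by (simp add: dist_real_def)
      then show "\<phi>0 / \<rho> \<le> D.rate z \<and> D.rate z \<le> \<phi>0 * \<rho>"
        using d(2)[of z] lt rate1 by (cases "z = x1") simp_all
    qed (use d in simp)
  qed
  have xr0: "0 \<le> xr" using x1 xr by simp
  obtain a k where a: "0 < a" and range0: "\<And>z. 0 \<le> z \<Longrightarrow> z \<le> xr \<Longrightarrow> a \<le> D.rate z \<and> D.rate z \<le> k"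
  proof -
    have c: "continuous_on {0..xr} D.rate" by (rule D.continuous_on_rate)
    obtain z1 where z1: "z1 \<in> {0..xr}" "\<And>z. z \<in> {0..xr} \<Longrightarrow> D.rate z1 \<le> D.rate z"
      using continuous_attains_inf[OF compact_Icc _ c] xr0 by auto
    obtain z2 where z2: "z2 \<in> {0..xr}" "\<And>z. z \<in> {0..xr} \<Longrightarrow> D.rate z \<le> D.rate z2"
      using continuous_attains_sup[OF compact_Icc _ c] xr0 by auto
    show ?thesis by (rule that[of "D.rate z1" "D.rate z2"]) (use z1 z2 D.rate_pos in auto)
  qed
  define q where "q = a / (16 * k\<^sup>2)"
  have q: "0 < q"
  proof -
    have "0 < k" using a range0[of 0] xr0 by auto
    then show ?thesis using a by (simp add: q_def)
  qed
  define Z where "Z lam = sqrt lam * \<epsilon> lam" for lam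
  \<comment> \<open>The last summand is the p of \<open>bad_event_prob\<close>; any positive
    quantity tending to 0 can serve.\<close>
  define bnd where "bnd lam = 2 * (visit_bound a k * exp (- ((q * h\<^sup>2) * (Z lam)\<^sup>2)) / (1 - exp (- q)))
     + 2 * (visit_bound a k * ((r * \<phi>0) * Z lam + 1) / (h * Z lam)\<^sup>2) + 1 / lam" for lam
  have bnd0: "(bnd \<longlongrightarrow> 0) at_top"
    unfolding bnd_def[abs_def] using eps_big q h(1) by (intro bad_bound_tendsto_0) (auto simp: Z_def[abs_def])
  have ratio: "((\<lambda>lam. integral {t..t + \<epsilon> lam} \<phi> / \<epsilon> lam) \<longlongrightarrow> \<phi>0) at_top"
  proof -
    have "filterlim \<epsilon> (at_right 0) at_top"
      using eps_small eps_pos by (auto simp: filterlim_at intro!: eventually_mono[OF eventually_gt_at_top[of 0]])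
    from filterlim_compose[OF right_average_tendsto[OF phi_cont t] this] show ?thesis by (simp add: \<phi>0_def)
  qed
  have evD: "eventually (\<lambda>lam. \<phi>0 / r < integral {t..t + \<epsilon> lam} \<phi> / \<epsilon> lam \<and> integral {t..t + \<epsilon> lam} \<phi> / \<epsilon> lam < \<phi>0 * r) at_top"
    using \<phi>0 r by (intro eventually_conj order_tendstoD[OF ratio]) (auto simp: divide_less_eq)
  have evx: "eventually (\<lambda>lam. (r * \<phi>0 + h) * \<epsilon> lam < gf v0 m x1 - gf v0 m xr) at_top"
  proof -
    have "((\<lambda>lam. (r * \<phi>0 + h) * \<epsilon> lam) \<longlongrightarrow> (r * \<phi>0 + h) * 0) at_top" by (intro tendsto_intros eps_small)
    then show ?thesis using D.G_strict[OF xr(1)] by (intro order_tendstoD(2)) auto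
  qed
  let ?A = "\<lambda>lam. {\<omega> \<in> space (\<Omega> lam).
              \<bar>(Phi (\<lambda>i. \<beta> lam i \<omega>) (\<lambda>s. v lam s \<omega>) (t + \<epsilon> lam) (2 * sqrt (\<phi> t / lam) * x)
                - Phi (\<lambda>i. \<beta> lam i \<omega>) (\<lambda>s. v lam s \<omega>) t (2 * sqrt (\<phi> t / lam) * x))
               / (\<epsilon> lam * \<phi> t)
              - integral {x..} (\<lambda>y. 4 / sqrt pi * y\<^sup>2 * exp (- (y\<^sup>2)))\<bar> > \<delta>}"
  have "eventually (\<lambda>lam. measure (\<Omega> lam) (?A lam) \<le> bnd lam) at_top"
    using evD evx eventually_gt_at_top[of "0::real"]
  proof eventually_elim
    case (elim lam)
    then have lam: "0 < lam" by simp
    have e: "0 < \<epsilon> lam" using eps_pos lam by simp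
    have Zp: "0 < Z lam" using lam e by (simp add: Z_def)
    interpret R: random_burning v0 m "\<Omega> lam" lam "\<beta> lam" "v lam"
      by unfold_locales (use lam rand in auto)
    have \<Delta>1: "\<Delta> lam \<le> r * (\<epsilon> lam * \<phi>0)"
      using elim(1) e unfolding \<Delta>_eq[OF lam, symmetric] by (simp add: pos_divide_less_eq mult_ac)
    have "\<phi>0 / r * \<epsilon> lam \<le> \<Delta> lam"
      using elim(1) e unfolding \<Delta>_eq[OF lam, symmetric] by (simp add: pos_less_divide_eq)
    then have \<Delta>2: "\<epsilon> lam * \<phi>0 / r \<le> \<Delta> lam" by (simp add: mult.commute)
    have xrb: "gf v0 m xr \<le> gf v0 m (X2 lam) - h * \<epsilon> lam"
      using elim(2) \<Delta>1 by (simp add: \<Delta>_def algebra_simps)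
    have tb: "0 \<le> tail_mass (x / r)" "0 \<le> tail_mass (x * r)" using x r by (auto intro!: tail_mass_bounds)
    \<comment> \<open>The tolerance d = h \<epsilon> is a small fraction of the window but large
      against the cycle size 1 / sqrt lam. Likewise e = h sqrt lam \<epsilon> is a small fraction of
      the order of the number of cycles but large against its square root.\<close>
    have "measure (\<Omega> lam) (?A lam) \<le> 2 * (visit_bound a k * exp (- (q * lam * (h * \<epsilon> lam)\<^sup>2)) / (1 - exp (- q)))
       + 2 * (visit_bound a k * (sqrt lam * \<Delta> lam + 1) / (h * (sqrt lam * \<epsilon> lam))\<^sup>2) + 1 / lam"
    proof (rule R.bad_event_prob[OF x1(1) X2(1)[OF lam] _ xrb xr0 \<phi>0 less_imp_le[OF \<rho>(1)] xr(2) a range0 x _ _ refl \<Delta>_def \<rho>(2) q_def])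
      fix \<omega> assume A: "\<omega> \<in> ?A lam"
      let ?\<Psi> = "Phi (\<lambda>i. \<beta> lam i \<omega>) (\<lambda>s. v lam s \<omega>) (D.gel (X2 lam)) (2 * sqrt (\<phi>0 / lam) * x)
                - Phi (\<lambda>i. \<beta> lam i \<omega>) (\<lambda>s. v lam s \<omega>) (D.gel x1) (2 * sqrt (\<phi>0 / lam) * x)"
      have big: "\<delta> < \<bar>?\<Psi> / (\<epsilon> lam * \<phi>0) - tail_mass x\<bar>"
        using A by (simp add: x1(2) X2(2)[OF lam] \<phi>0_def tail_mass_def)
      show "h * \<epsilon> lam + r * (tail_mass (x / r) * (r * (\<Delta> lam + h * \<epsilon> lam)) + 2 * sqrt (\<phi>0 / lam) * (h * (sqrt lam * \<epsilon> lam))) < ?\<Psi> \<or>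
         ?\<Psi> < (tail_mass (x * r) * ((\<Delta> lam - h * \<epsilon> lam) / r) - 2 * sqrt (\<phi>0 / lam) * (h * (sqrt lam * \<epsilon> lam))) / r - h * \<epsilon> lam"
        by (rule scaled_event_bounds[OF \<phi>0 less_imp_le[OF r] h(1) e lam \<Delta>1 \<Delta>2 tb h(2)[folded r_def] h(3)[folded r_def] big])
    qed (use h(1) e lam in auto)
    also have "q * lam * (h * \<epsilon> lam)\<^sup>2 = (q * h\<^sup>2) * (Z lam)\<^sup>2"
      using lam by (simp add: Z_def power_mult_distrib)
    also have "2 * (visit_bound a k * (sqrt lam * \<Delta> lam + 1) / (h * (sqrt lam * \<epsilon> lam))\<^sup>2)
       \<le> 2 * (visit_bound a k * ((r * \<phi>0) * Z lam + 1) / (h * Z lam)\<^sup>2)"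
    proof -
      have "sqrt lam * \<Delta> lam \<le> sqrt lam * (r * (\<epsilon> lam * \<phi>0))" using \<Delta>1 lam by (intro mult_left_mono) auto
      also have "\<dots> = (r * \<phi>0) * Z lam" by (simp add: Z_def)
      finally show ?thesis unfolding Z_def[symmetric]
        by (intro mult_left_mono divide_right_mono add_right_mono less_imp_le[OF visit_bound_pos]) auto
    qed
    finally show ?case by (simp add: bnd_def)
  qed
  then show "((\<lambda>lam. measure (\<Omega> lam) (?A lam)) \<longlongrightarrow> 0) at_top"
    by (rule tendsto_sandwich[OF always_eventually _ tendsto_const bnd0, rotated]) simp
qed

end
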